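(* Suppose $\mathbf X$ and $Y$ are independent, and that the following three conditions hold, where $\mathbf X_1,\mathbf X_2,\mathbf X_3,\mathbf X_4$ are i.i.d. copies of $\mathbf X$ and $d$ is the double centered distance: (1) $\mathbb E\|\mathbf X\|^4<\infty$; (2) $\dfrac{\mathbb E\, d^4(\mathbf X_1,\mathbf X_2)}{n\,(\mathbb E\, d^2(\mathbf X_1,\mathbf X_2))^2}\to 0$; (3) $\dfrac{\mathbb E[d(\mathbf X_1,\mathbf X_3)d(\mathbf X_2,\mathbf X_3)d(\mathbf X_1,\mathbf X_4)d(\mathbf X_2,\mathbf X_4)]}{(\mathbb E\, d^2(\mathbf X_1,\mathbf X_2))^2}\to 0$. Then, as $\min\{n_1,\dots,n_K\}\to\infty$ and $p\to\infty$, $$\frac{\mathrm{gCov}_n(\mathbf X,Y)}{\hat\sigma_0}\stackrel{d}{\longrightarrow}\mathcal N(0,1).$$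
   Context: $\|\cdot\|$ is the Euclidean norm. $\mathbf X$ is an $\mathbb R^p$-valued random vector with distribution $F$; $Y$ is a categorical variable with values $L_1,\dots,L_K$ ($K$ fixed) and $P(Y=L_k)=p_k>0$; the conditional distribution of $\mathbf X$ given $Y=L_k$ is $F_k$ (under independence $F_1=\dots=F_K=F$). One observes an i.i.d. sample $(\mathbf X_1,Y_1),\dots,(\mathbf X_n,Y_n)$ from the joint distribution of $(\mathbf X,Y)$; $n_k$ is the number of observations with $Y_i=L_k$, these observations are denoted $\mathbf X^{(k)}_1,\dots,\mathbf X^{(k)}_{n_k}$, and $\hat p_k=n_k/n$. The asymptotics are along a sequence in which the sample size $n$ and the dimension $p=p(n)$ both diverge in an arbitrary fashion (the distribution of $\mathbf X$ may change with $p$); all limits are along this sequence. The sample Gini covariance is $\mathrm{gCov}_n(\mathbf X,Y)=U_n-\sum_{k=1}^K\hat p_kU_{n_k}$, where $U_n=\binom n2^{-1}\sum_{1\le i<j\le n}\|\mathbf X_i-\mathbf X_j\|$ and $U_{n_k}=\binom{n_k}2^{-1}\sum_{1\le i<j\le n_k}\|\mathbf X^{(k)}_i-\mathbf X^{(k)}_j\|$. The double centered distance is, for $\mathbf X_1,\mathbf X_2$ i.i.d. from $F$, $d(\mathbf X_1,\mathbf X_2)=\|\mathbf X_1-\mathbf X_2\|-\mathbb E(\|\mathbf X_1-\mathbf X_2\|\mid\mathbf X_1)-\mathbb E(\|\mathbf X_1-\mathbf X_2\|\mid\mathbf X_2)+\mathbb E\|\mathbf X_1-\mathbf X_2\|$.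 The variance estimator is $\hat\sigma_0^2=\Big(\sum_{k=1}^K\hat p_k^2\binom{n_k}2^{-1}-\binom n2^{-1}\Big)V_n^2(\mathbf X)$, where $V_n^2(\mathbf X)=\frac1{n(n-3)}\sum_{1\le k\ne l\le n}A_{k,l}^2$ and $A_{k,l}=\|\mathbf X_k-\mathbf X_l\|-\frac1{n-2}\sum_{i=1}^n\|\mathbf X_i-\mathbf X_l\|-\frac1{n-2}\sum_{j=1}^n\|\mathbf X_k-\mathbf X_j\|+\frac1{(n-1)(n-2)}\sum_{1\le i,j\le n}\|\mathbf X_i-\mathbf X_j\|$. *)

theory Defs
  imports "HOL-Probability.Probability"
begin

text \<open>The dimension varies along the asymptotic sequence, so a point of \<open>\<real>\<^sup>p\<close> is a function
  \<open>nat \<Rightarrow> real\<close> restricted to the coordinates \<open>{..<p}\<close>.\<close>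

abbreviation euclid :: "nat \<Rightarrow> (nat \<Rightarrow> real) measure" where
  "euclid p \<equiv> \<Pi>\<^sub>M j\<in>{..<p}. borel"

definition enorm :: "nat \<Rightarrow> (nat \<Rightarrow> real) \<Rightarrow> real" where
  "enorm p x = L2_set x {..<p}"

definition edist :: "nat \<Rightarrow> (nat \<Rightarrow> real) \<Rightarrow> (nat \<Rightarrow> real) \<Rightarrow> real" where
  "edist p x y = enorm p (\<lambda>j. x j - y j)"

definition iid_from :: "'a measure \<Rightarrow> 'i set \<Rightarrow> ('i \<Rightarrow> 'a \<Rightarrow> 'b) \<Rightarrow> 'b measure \<Rightarrow> 'b measure \<Rightarrow> bool" where
  "iid_from M I Z N D \<longleftrightarrow>
     prob_space M \<and> prob_space.indep_vars M (\<lambda>_. N) Z I \<and> (\<forall>i\<in>I. distr M N (Z i) = D)"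

text \<open>The library's \<open>indep_var\<close> requires both variables to take values in the same type.\<close>

definition indep_rv ::
  "'a measure \<Rightarrow> 'b measure \<Rightarrow> ('a \<Rightarrow> 'b) \<Rightarrow> 'c measure \<Rightarrow> ('a \<Rightarrow> 'c) \<Rightarrow> bool" where
  "indep_rv M N U N' V \<longleftrightarrow>
     U \<in> measurable M N \<and> V \<in> measurable M N' \<and>
     prob_space.indep_set M {U -` A \<inter> space M | A. A \<in> sets N} {V -` B \<inter> space M | B. B \<in> sets N'}"

definition cond_exp_given ::
  "'a measure \<Rightarrow> 'b measure \<Rightarrow> ('a \<Rightarrow> 'b) \<Rightarrow> ('a \<Rightarrow> real) \<Rightarrow> 'a \<Rightarrow> real" where
  "cond_exp_given M N U f = real_cond_exp M (vimage_algebra (space M) U N) f"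

text \<open>The random variable \<open>d(U, V)\<close> on the probability space \<open>M\<close>, for i.i.d. random vectors
  \<open>U\<close> and \<open>V\<close>.\<close>

definition dcd ::
  "'a measure \<Rightarrow> nat \<Rightarrow> ('a \<Rightarrow> nat \<Rightarrow> real) \<Rightarrow> ('a \<Rightarrow> nat \<Rightarrow> real) \<Rightarrow> 'a \<Rightarrow> real" where
  "dcd M p U V \<omega> =
     edist p (U \<omega>) (V \<omega>)
     - cond_exp_given M (euclid p) U (\<lambda>\<xi>. edist p (U \<xi>) (V \<xi>)) \<omega>
     - cond_exp_given M (euclid p) V (\<lambda>\<xi>. edist p (U \<xi>) (V \<xi>)) \<omega>
     + (\<integral>\<xi>. edist p (U \<xi>) (V \<xi>) \<partial>M)"

text \<open>In the sample statistics below, \<open>x i\<close> and \<open>y i\<close> for \<open>i < n\<close> are the observed vectors and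
  labels; \<open>L\<close> is the set of labels. Terms with a vanishing binomial coefficient
  are \<open>0\<close> by the convention \<open>a / 0 = 0\<close>.\<close>

definition class_idx :: "nat \<Rightarrow> (nat \<Rightarrow> 'l) \<Rightarrow> 'l \<Rightarrow> nat set" where
  "class_idx n y k = {i. i < n \<and> y i = k}"

definition class_size :: "nat \<Rightarrow> (nat \<Rightarrow> 'l) \<Rightarrow> 'l \<Rightarrow> nat" where
  "class_size n y k = card (class_idx n y k)"

definition phat :: "nat \<Rightarrow> (nat \<Rightarrow> 'l) \<Rightarrow> 'l \<Rightarrow> real" where
  "phat n y k = real (class_size n y k) / real n"

definition ustat :: "nat \<Rightarrow> (nat \<Rightarrow> nat \<Rightarrow> real) \<Rightarrow> nat set \<Rightarrow> real" where
  "ustat p x I =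
     (\<Sum>(i, j)\<in>{(i, j). i \<in> I \<and> j \<in> I \<and> i < j}. edist p (x i) (x j)) / real (card I choose 2)"

definition gCov ::
  "nat \<Rightarrow> nat \<Rightarrow> 'l set \<Rightarrow> (nat \<Rightarrow> nat \<Rightarrow> real) \<Rightarrow> (nat \<Rightarrow> 'l) \<Rightarrow> real" where
  "gCov p n L x y =
     ustat p x {..<n} - (\<Sum>k\<in>L. phat n y k * ustat p x (class_idx n y k))"

definition ucent :: "nat \<Rightarrow> nat \<Rightarrow> (nat \<Rightarrow> nat \<Rightarrow> real) \<Rightarrow> nat \<Rightarrow> nat \<Rightarrow> real" where
  "ucent p n x k l =
     edist p (x k) (x l)
     - (\<Sum>i<n. edist p (x i) (x l)) / (real n - 2)
     - (\<Sum>j<n. edist p (x k) (x j)) / (real n - 2)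
     + (\<Sum>i<n. \<Sum>j<n. edist p (x i) (x j)) / ((real n - 1) * (real n - 2))"

definition Vn2 :: "nat \<Rightarrow> nat \<Rightarrow> (nat \<Rightarrow> nat \<Rightarrow> real) \<Rightarrow> real" where
  "Vn2 p n x =
     (\<Sum>k<n. \<Sum>l\<in>{..<n} - {k}. (ucent p n x k l)\<^sup>2) / (real n * (real n - 3))"

definition sigma0_sq ::
  "nat \<Rightarrow> nat \<Rightarrow> 'l set \<Rightarrow> (nat \<Rightarrow> nat \<Rightarrow> real) \<Rightarrow> (nat \<Rightarrow> 'l) \<Rightarrow> real" where
  "sigma0_sq p n L x y =
     ((\<Sum>k\<in>L. (phat n y k)\<^sup>2 / real (class_size n y k choose 2)) - 1 / real (n choose 2))
     * Vn2 p n x"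

end

theory Submission
  imports Defs
begin

text \<open>Given the labels, the Gini covariance is a weighted sum of pairwise distances whose weights have
  zero row sums, so the distances may be replaced by the doubly centered distances
  (\<open>gCov_weights_additive\<close>). If the features are independent of the labels, they remain i.i.d. given
  the labels, and the statistic is a degenerate quadratic form \<open>S\<close> with deterministic weights. Its
  conditional variance is the deterministic factor of the variance estimator times the second
  moment of the doubly centered distance (\<open>sum_pair_weight_square\<close>).

  Asymptotic normality of \<open>S\<close> is shown by a Stein argument for characteristic functions.
  Let \<open>T k\<close> be the sum of the terms of \<open>S\<close> that involve the observation \<open>k\<close>, so that \<open>S\<close> is half
  the sum of the \<open>T k\<close>. By degeneracy \<open>T k\<close> is centered given the other observations, and
  \<open>S - T k\<close> does not involve the observation \<open>k\<close>. Hence the mean of \<open>T k * exp (\<i> u S)\<close>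
  equals that of \<open>T k * (exp (\<i> u S) - exp (\<i> u (S - T k)))\<close>, which is
  \<open>\<i> u (T k)\<^sup>2 exp (\<i> u S)\<close> up to a cubic error (\<open>stein_identity\<close>). If half the sum of
  the squares \<open>(T k)\<^sup>2\<close> is close to \<open>1\<close> in mean square and the fourth moments of the \<open>T k\<close> are
  negligible, the characteristic function nearly solves \<open>\<phi>' = - u \<phi>\<close>, and it is close to the Gaussian
  one (\<open>char_gaussian_bound\<close>). This replaces a martingale central limit theorem.

  Both requirements are fourth-order moment bounds. Expanding the moments into graphs with four edges,
  every vertex on a single edge annihilates its term. The surviving configurations have
  either at most three vertices, with a total contribution of order \<open>E d\<^sup>4 / (n (E d\<^sup>2)\<^sup>2)\<close>, or they
  form a four-cycle, whose contribution is the quantity in the last moment condition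
  (\<open>path_pair_moment\<close>, \<open>quadratic_variation_L2\<close>).

  U-centering also removes the additive part of the distances, and the variance estimator is the
  average of the squared doubly centered distances up to terms of relative order \<open>1 / n\<close>
  (\<open>U_var_ratio\<close>). Studentization is therefore harmless (\<open>studentized_char_bound\<close>).

  All bounds are uniform over labels with class frequencies bounded away from zero, and by Hoeffding's
  inequality the other labels have vanishing probability. Averaging over the finitely many
  label vectors (\<open>stat_char_bound\<close>) and Levy's continuity theorem conclude the proof.\<close>

section \<open>Degenerate kernels and samples\<close>

lemma norm_integral_le:
  fixes f :: "'a \<Rightarrow> 'b::{banach, second_countable_topology}"
  assumes "integrable M f" "integrable M g" "\<And>x. norm (f x) \<le> g x"
  shows "norm (\<integral>x. f x \<partial>M) \<le> (\<integral>x. g x \<partial>M)"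
  using assms by (intro order_trans[OF integral_norm_bound integral_mono]) auto

text \<open>The kernel of a degenerate U-statistic of degree two. Integrability and centering of the
  sections are required at every point, so that an inner integral over one argument vanishes
  identically and no exceptional null sets have to be carried through Fubini arguments.\<close>
locale degenerate_kernel = prob_space F for F :: "'x measure" +
  fixes h :: "'x \<Rightarrow> 'x \<Rightarrow> real"
  assumes h_meas: "case_prod h \<in> borel_measurable (F \<Otimes>\<^sub>M F)"
    and h_sym: "h x y = h y x"
    and h_int1: "x \<in> space F \<Longrightarrow> integrable F (h x)"
    and h_deg: "x \<in> space F \<Longrightarrow> (\<integral>y. h x y \<partial>F) = 0"
    and h_int4: "integrable (F \<Otimes>\<^sub>M F) (\<lambda>(x, y). h x y ^ 4)"
begin

definition m2 :: real where "m2 = (\<integral>(x, y). (h x y)\<^sup>2 \<partial>(F \<Otimes>\<^sub>M F))"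
definition m4 :: real where "m4 = (\<integral>(x, y). h x y ^ 4 \<partial>(F \<Otimes>\<^sub>M F))"

text \<open>Setting the diagonal to \<open>0\<close> makes every product of these variables integrable, so sums over all
  pairs of indices need no distinctness conditions.\<close>
definition H :: "nat \<Rightarrow> nat \<Rightarrow> (nat \<Rightarrow> 'x) \<Rightarrow> real" where
  "H i j x = (if i = j then 0 else h (x i) (x j))"

lemma H_same [simp]: "H i i x = 0" by (simp add: H_def)

lemma H_sym: "H i j x = H j i x" by (simp add: H_def h_sym)

lemma H_upd: "l \<noteq> i \<Longrightarrow> l \<noteq> j \<Longrightarrow> H i j (x(l := y)) = H i j x" by (simp add: H_def)

text \<open>The fourth-order moment along a four-cycle \<open>1 - 3 - 2 - 4 - 1\<close>; it is the squared
  Hilbert-Schmidt norm of the square of the integral operator with kernel \<open>h\<close>, and it is the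
  quantity that separates a Gaussian limit from a mixture of chi-squares.\<close>
definition cyc :: real where
  "cyc = (\<integral>x. h (x 1) (x 3) * h (x 2) (x 3) * h (x 1) (x 4) * h (x 2) (x 4) \<partial>Pi\<^sub>M {1..4::nat} (\<lambda>_. F))"

lemma m4_nonneg: "m4 \<ge> 0" unfolding m4_def by (intro integral_nonneg_AE) auto

end

locale kernel_sample = degenerate_kernel F h for F :: "'x measure" and h +
  fixes I :: "nat set"
  assumes fin: "finite I"
begin

sublocale PP: finite_product_prob_space "\<lambda>_::nat. F" I
  by unfold_locales (rule fin)

lemma total_one [simp]: "measure (Pi\<^sub>M J (\<lambda>_. F)) (space (Pi\<^sub>M J (\<lambda>_. F))) = 1"
  by (intro prob_space.prob_space prob_space_PiM prob_space_axioms)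

abbreviation P where "P \<equiv> Pi\<^sub>M I (\<lambda>_. F)"

text \<open>Fubini with the coordinate \<open>i\<close> innermost.\<close>
lemma integral_coordinate_last:
  fixes f :: "(nat \<Rightarrow> 'x) \<Rightarrow> 'b::{banach, second_countable_topology}"
  assumes "i \<in> I" "integrable P f"
  shows "integral\<^sup>L P f = (\<integral>x. (\<integral>y. f (x(i := y)) \<partial>F) \<partial>Pi\<^sub>M (I - {i}) (\<lambda>_. F))"
proof -
  have I: "insert i (I - {i}) = I" using assms by auto
  show ?thesis
    using PP.product_integral_insert[of "I - {i}" i f, unfolded I] assms fin by simp
qed

text \<open>If \<open>R\<close> does not involve the coordinate \<open>i\<close>, integrating that coordinate first produces a section
  of the kernel, which is centered. All cancellations by degeneracy below come from here.\<close>
lemma degenerate_integral_zero: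
  fixes R :: "(nat \<Rightarrow> 'x) \<Rightarrow> 'b::{banach, second_countable_topology}"
  assumes "i \<in> I" "k \<in> I"
    and int: "integrable P (\<lambda>x. H i k x *\<^sub>R R x)"
    and R: "\<And>x y. R (x(i := y)) = R x"
  shows "(\<integral>x. H i k x *\<^sub>R R x \<partial>P) = 0"
proof (cases "i = k")
  case False
  have "(\<integral>x. H i k x *\<^sub>R R x \<partial>P) =
      (\<integral>x. (\<integral>y. h (x k) y *\<^sub>R R x \<partial>F) \<partial>Pi\<^sub>M (I - {i}) (\<lambda>_. F))"
    using False by (subst integral_coordinate_last[OF assms(1) int])
      (simp add: R H_def h_sym[of y "x k" for y x])
  also have "\<dots> = (\<integral>x. 0 \<partial>Pi\<^sub>M (I - {i}) (\<lambda>_. F))"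
  proof (intro Bochner_Integration.integral_cong refl)
    fix x assume "x \<in> space (Pi\<^sub>M (I - {i}) (\<lambda>_. F))"
    then have xk: "x k \<in> space F" using assms False by (auto simp: space_PiM PiE_def Pi_def)
    then show "(\<integral>y. h (x k) y *\<^sub>R R x \<partial>F) = 0"
      by (subst integral_scaleR_left) (auto simp: h_int1 h_deg)
  qed
  finally show ?thesis by simp
qed simp

lemma component_meas [measurable]: "i \<in> I \<Longrightarrow> (\<lambda>x. x i) \<in> measurable P F"
  by (rule measurable_component_singleton)

lemma H_meas [measurable]: "i \<in> I \<Longrightarrow> j \<in> I \<Longrightarrow> H i j \<in> borel_measurable P"
proof -
  assume "i \<in> I" "j \<in> I"
  then have "(\<lambda>x. case_prod h (x i, x j)) \<in> borel_measurable P"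
    by (intro measurable_compose[OF _ h_meas] measurable_Pair component_meas)
  then show ?thesis by (cases "i = j") (simp_all add: H_def[abs_def])
qed

lemma pair_distr:
  assumes "i \<in> I" "j \<in> I" "i \<noteq> j"
  shows "distr P (F \<Otimes>\<^sub>M F) (\<lambda>x. (x i, x j)) = F \<Otimes>\<^sub>M F"
proof (rule pair_measure_eqI[symmetric])
  show "sigma_finite_measure F" "sigma_finite_measure F" by unfold_locales
  show "sets (F \<Otimes>\<^sub>M F) = sets (distr P (F \<Otimes>\<^sub>M F) (\<lambda>x. (x i, x j)))" by simp
  fix A B assume [measurable]: "A \<in> sets F" "B \<in> sets F"
  let ?E = "\<lambda>l. if l = i then A else if l = j then B else space F"
  have *: "(\<lambda>x. (x i, x j)) -` (A \<times> B) \<inter> space P = Pi\<^sub>E I ?E"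
  proof (intro set_eqI iffI)
    fix x assume "x \<in> (\<lambda>x. (x i, x j)) -` (A \<times> B) \<inter> space P"
    then show "x \<in> Pi\<^sub>E I ?E" by (auto simp: space_PiM PiE_iff)
  next
    fix x assume x: "x \<in> Pi\<^sub>E I ?E"
    then have "x i \<in> A" "x j \<in> B" using assms by (auto simp: PiE_iff dest: bspec)
    moreover have "x l \<in> space F" if "l \<in> I" for l
      using PiE_mem[OF x that] sets.sets_into_space[OF \<open>A \<in> sets F\<close>]
        sets.sets_into_space[OF \<open>B \<in> sets F\<close>] by (auto split: if_splits)
    ultimately show "x \<in> (\<lambda>x. (x i, x j)) -` (A \<times> B) \<inter> space P"
      using x by (auto simp: space_PiM PiE_iff)
  qed
  have "emeasure (distr P (F \<Otimes>\<^sub>M F) (\<lambda>x. (x i, x j))) (A \<times> B) = emeasure P (Pi\<^sub>E I ?E)"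
  proof (subst emeasure_distr)
    show "(\<lambda>x. (x i, x j)) \<in> measurable P (F \<Otimes>\<^sub>M F)"
      using assms by (intro measurable_Pair component_meas)
  qed (simp_all only: * pair_measureI \<open>A \<in> sets F\<close> \<open>B \<in> sets F\<close>)
  also have "\<dots> = (\<Prod>l\<in>I. emeasure F (?E l))"
    by (intro PP.measure_times) auto
  also have "\<dots> = emeasure F A * (emeasure F B * (\<Prod>l\<in>I - {i} - {j}. emeasure F (?E l)))"
    using assms fin by (subst prod.remove[of _ i], simp, simp, subst prod.remove[of _ j]) auto
  also have "(\<Prod>l\<in>I - {i} - {j}. emeasure F (?E l)) = 1"
    by (intro prod.neutral) (auto simp: emeasure_space_1)
  finally show "emeasure F A * emeasure F B
      = emeasure (distr P (F \<Otimes>\<^sub>M F) (\<lambda>x. (x i, x j))) (A \<times> B)" by simp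
qed

lemma pair_integral:
  fixes f :: "'x \<times> 'x \<Rightarrow> real"
  assumes "i \<in> I" "j \<in> I" "i \<noteq> j" and f: "f \<in> borel_measurable (F \<Otimes>\<^sub>M F)"
  shows "(\<integral>x. f (x i, x j) \<partial>P) = (\<integral>z. f z \<partial>(F \<Otimes>\<^sub>M F))"
    and "integrable P (\<lambda>x. f (x i, x j)) \<longleftrightarrow> integrable (F \<Otimes>\<^sub>M F) f"
proof -
  have m: "(\<lambda>x. (x i, x j)) \<in> measurable P (F \<Otimes>\<^sub>M F)"
    using assms by (intro measurable_Pair component_meas)
  show "(\<integral>x. f (x i, x j) \<partial>P) = (\<integral>z. f z \<partial>(F \<Otimes>\<^sub>M F))"
    using integral_distr[OF m f] pair_distr[OF assms(1-3)] by simp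
  show "integrable P (\<lambda>x. f (x i, x j)) \<longleftrightarrow> integrable (F \<Otimes>\<^sub>M F) f"
    using integrable_distr_eq[OF m f] pair_distr[OF assms(1-3)] by simp
qed

lemma H_fourth:
  assumes "i \<in> I" "j \<in> I"
  shows "integrable P (\<lambda>x. H i j x ^ 4)" "(\<integral>x. H i j x ^ 4 \<partial>P) \<le> m4"
    "i \<noteq> j \<Longrightarrow> (\<integral>x. H i j x ^ 4 \<partial>P) = m4"
proof -
  have m: "(\<lambda>(x, y). h x y ^ 4) \<in> borel_measurable (F \<Otimes>\<^sub>M F)" using h_int4 by simp
  have *: "integrable P (\<lambda>x. H i j x ^ 4) \<and> (\<integral>x. H i j x ^ 4 \<partial>P) = m4" if "i \<noteq> j"
    using pair_integral[OF assms that m] h_int4 that by (simp add: H_def m4_def)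
  then show "i \<noteq> j \<Longrightarrow> (\<integral>x. H i j x ^ 4 \<partial>P) = m4" by blast
  show "integrable P (\<lambda>x. H i j x ^ 4)" "(\<integral>x. H i j x ^ 4 \<partial>P) \<le> m4"
    using * m4_nonneg by (cases "i = j"; simp)+
qed

lemma H_square:
  assumes "i \<in> I" "j \<in> I"
  shows "integrable P (\<lambda>x. (H i j x)\<^sup>2)" "i \<noteq> j \<Longrightarrow> (\<integral>x. (H i j x)\<^sup>2 \<partial>P) = m2"
proof -
  have m: "(\<lambda>(x, y). (h x y)\<^sup>2) \<in> borel_measurable (F \<Otimes>\<^sub>M F)"
    using h_meas by (auto simp: case_prod_beta' intro!: borel_measurable_power)
  have *: "(\<integral>x. (H i j x)\<^sup>2 \<partial>P) = m2" if "i \<noteq> j"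
    using pair_integral(1)[OF assms that m] that by (simp add: H_def m2_def)
  show "integrable P (\<lambda>x. (H i j x)\<^sup>2)"
  proof (rule Bochner_Integration.integrable_bound)
    show "integrable P (\<lambda>x. H i j x ^ 4 + 1)" using H_fourth[OF assms] by simp
    have "t\<^sup>2 \<le> t ^ 4 + 1" for t :: real
      using zero_le_power2[of "t\<^sup>2 - 1"] zero_le_power2[of "t\<^sup>2 "]
      by (simp add: power2_diff power4_eq_xxxx power2_eq_square algebra_simps)
    then show "AE x in P. norm ((H i j x)\<^sup>2) \<le> norm (H i j x ^ 4 + 1)" by auto
  qed (use assms in measurable)
  show "i \<noteq> j \<Longrightarrow> (\<integral>x. (H i j x)\<^sup>2 \<partial>P) = m2" using * by blast
qed

lemma abs_prod4_le: "\<bar>a * b * c * d\<bar> \<le> (a ^ 4 + b ^ 4 + c ^ 4 + d ^ 4) / 4" for a b c d :: real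
proof -
  have "\<bar>x * y\<bar> \<le> (x\<^sup>2 + y\<^sup>2) / 2" for x y :: real
    using sum_squares_bound[of "\<bar>x\<bar>" "\<bar>y\<bar>"] by (simp add: abs_mult)
  from this[of "a * b" "c * d"] this[of "a\<^sup>2" "b\<^sup>2"] this[of "c\<^sup>2" "d\<^sup>2"]
  show ?thesis by (simp add: power_mult_distrib abs_mult mult.assoc flip: power_mult)
qed

lemma prod4_integrable:
  assumes "i \<in> I" "j \<in> I" "i' \<in> I" "j' \<in> I" "k \<in> I" "l \<in> I" "k' \<in> I" "l' \<in> I"
  shows "integrable P (\<lambda>x. H i j x * H i' j' x * H k l x * H k' l' x)"
    "\<bar>\<integral>x. H i j x * H i' j' x * H k l x * H k' l' x \<partial>P\<bar> \<le> m4"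
proof -
  let ?g = "\<lambda>x. (H i j x ^ 4 + H i' j' x ^ 4 + H k l x ^ 4 + H k' l' x ^ 4) / 4"
  have g: "integrable P ?g" using H_fourth assms by auto
  show "integrable P (\<lambda>x. H i j x * H i' j' x * H k l x * H k' l' x)"
  proof (rule Bochner_Integration.integrable_bound[OF g])
    show "AE x in P. norm (H i j x * H i' j' x * H k l x * H k' l' x) \<le> norm (?g x)"
      by (intro AE_I2) (simp only: real_norm_def order_trans[OF abs_prod4_le abs_ge_self])
  qed (use assms in measurable)
  have "\<bar>\<integral>x. H i j x * H i' j' x * H k l x * H k' l' x \<partial>P\<bar> \<le> integral\<^sup>L P ?g"
    unfolding real_norm_def[symmetric]
    by (rule norm_integral_le) (fact, fact, simp only: real_norm_def abs_prod4_le)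
  also have "\<dots> \<le> m4"
    using H_fourth(1,2)[OF assms(1,2)] H_fourth(1,2)[OF assms(3,4)] H_fourth(1,2)[OF assms(5,6)] H_fourth(1,2)[OF assms(7,8)]
    by simp
  finally show "\<bar>\<integral>x. H i j x * H i' j' x * H k l x * H k' l' x \<partial>P\<bar> \<le> m4" .
qed

lemma prod2_integrable:
  assumes "i \<in> I" "j \<in> I" "k \<in> I" "l \<in> I"
  shows "integrable P (\<lambda>x. H i j x * H k l x)"
proof (rule Bochner_Integration.integrable_bound)
  show "integrable P (\<lambda>x. (H i j x)\<^sup>2 + (H k l x)\<^sup>2)" using H_square(1) assms by auto
  show "AE x in P. norm (H i j x * H k l x) \<le> norm ((H i j x)\<^sup>2 + (H k l x)\<^sup>2)"
  proof (intro AE_I2)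
    fix x
    have "0 \<le> \<bar>H i j x\<bar> * \<bar>H k l x\<bar>" by simp
    then show "norm (H i j x * H k l x) \<le> norm ((H i j x)\<^sup>2 + (H k l x)\<^sup>2)"
      using sum_squares_bound[of "\<bar>H i j x\<bar>" "\<bar>H k l x\<bar>"]
      by (simp add: abs_mult del: zero_le_mult_iff mult_nonneg_nonneg)
  qed
qed (use assms in measurable)

end

section \<open>Vanishing and bounded fourth-order moments\<close>

lemma integral_square_sum_le:
  fixes f :: "'t \<Rightarrow> 'a \<Rightarrow> real"
  assumes "finite A" and int: "\<And>s t. s \<in> A \<Longrightarrow> t \<in> A \<Longrightarrow> integrable M (\<lambda>x. f s x * f t x)"
    and le: "\<And>s t. s \<in> A \<Longrightarrow> t \<in> A \<Longrightarrow> \<bar>\<integral>x. f s x * f t x \<partial>M\<bar> \<le> c s t"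
  shows "integrable M (\<lambda>x. (\<Sum>s\<in>A. f s x)\<^sup>2)"
    and "(\<integral>x. (\<Sum>s\<in>A. f s x)\<^sup>2 \<partial>M) \<le> (\<Sum>s\<in>A. \<Sum>t\<in>A. c s t)"
proof -
  have *: "(\<Sum>s\<in>A. f s x)\<^sup>2 = (\<Sum>s\<in>A. \<Sum>t\<in>A. f s x * f t x)" for x
    by (simp add: power2_eq_square sum_product)
  show "integrable M (\<lambda>x. (\<Sum>s\<in>A. f s x)\<^sup>2)" unfolding * using int by auto
  have "(\<integral>x. (\<Sum>s\<in>A. f s x)\<^sup>2 \<partial>M) = (\<Sum>s\<in>A. \<Sum>t\<in>A. \<integral>x. f s x * f t x \<partial>M)"
    unfolding * using int by (simp add: Bochner_Integration.integral_sum)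
  also have "\<dots> \<le> (\<Sum>s\<in>A. \<Sum>t\<in>A. c s t)"
    by (intro sum_mono order_trans[OF abs_ge_self le])
  finally show "(\<integral>x. (\<Sum>s\<in>A. f s x)\<^sup>2 \<partial>M) \<le> (\<Sum>s\<in>A. \<Sum>t\<in>A. c s t)" .
qed

context kernel_sample
begin

lemma zero_edge:
  assumes "i \<in> I" "k \<in> I" "integrable P (\<lambda>x. H i k x * R x)" "\<And>x y. R (x(i := y)) = R x"
  shows "(\<integral>x. H i k x * R x \<partial>P) = 0"
  using degenerate_integral_zero[of i k R] assms by simp

text \<open>Regard a product of four kernels as a graph with four edges: a vertex that lies on one edge only
  makes the moment vanish.\<close>
lemma prod4_zero:
  assumes "i \<in> I" "j \<in> I" "i' \<in> I" "j' \<in> I" "k \<in> I" "l \<in> I" "k' \<in> I" "l' \<in> I"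
    and "i \<notin> {i', j', k, l, k', l'}"
  shows "(\<integral>x. H i j x * H i' j' x * H k l x * H k' l' x \<partial>P) = 0"
proof -
  have "(\<integral>x. H i j x * (H i' j' x * H k l x * H k' l' x) \<partial>P) = 0"
    using assms prod4_integrable(1)[OF assms(1-8)]
    by (intro zero_edge) (auto simp: H_upd mult.assoc)
  then show ?thesis by (simp add: mult.assoc)
qed

lemma prod2_zero:
  assumes "i \<in> I" "j \<in> I" "k \<in> I" "l \<in> I" "i \<notin> {k, l}"
  shows "(\<integral>x. H i j x * H k l x \<partial>P) = 0"
  using assms prod2_integrable[OF assms(1-4)] by (intro zero_edge) (auto simp: H_upd)

lemma cycle_moment:
  assumes "i \<in> I" "j \<in> I" "k \<in> I" "l \<in> I" "distinct [i, j, k, l]"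
  shows "(\<integral>x. H i k x * H j k x * H i l x * H j l x \<partial>P) = cyc"
proof -
  interpret D: kernel_sample F h "{1..4}" by unfold_locales simp
  define f :: "nat \<Rightarrow> nat" where
    "f = (\<lambda>n. if n = 1 then i else if n = 2 then j else if n = 3 then k else l)"
  have f4: "f 1 = i" "f 2 = j" "f 3 = k" "f 4 = l" by (simp_all add: f_def)
  have set4: "{1..4::nat} = {1, 2, 3, 4}" by auto
  have f: "inj_on f {1..4}" "f \<in> {1..4} \<rightarrow> I"
    unfolding set4 using assms by (auto simp: f_def)
  let ?r = "\<lambda>\<omega>. \<lambda>n\<in>{1..4}. \<omega> (f n)"
  let ?g = "\<lambda>x. H 1 3 x * H 2 3 x * H 1 4 x * H 2 4 x"
  have d: "distr P (Pi\<^sub>M {1..4} (\<lambda>_. F)) ?r = Pi\<^sub>M {1..4} (\<lambda>_. F)"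
    using distr_PiM_reindex[OF _ f, of "\<lambda>_. F"] prob_space_axioms by simp
  have m: "?r \<in> measurable P (Pi\<^sub>M {1..4} (\<lambda>_. F))"
    using f(2) by (intro measurable_restrict component_meas) auto
  have "cyc = (\<integral>x. ?g x \<partial>Pi\<^sub>M {1..4} (\<lambda>_. F))"
    unfolding cyc_def H_def by simp
  also have "\<dots> = (\<integral>x. ?g x \<partial>distr P (Pi\<^sub>M {1..4} (\<lambda>_. F)) ?r)" using d by simp
  also have "\<dots> = (\<integral>x. ?g (?r x) \<partial>P)"
    by (rule integral_distr[OF m]) measurable
  also have "\<dots> = (\<integral>x. H i k x * H j k x * H i l x * H j l x \<partial>P)"
    using assms by (intro Bochner_Integration.integral_cong refl) (simp add: H_def f4 f4(1)[unfolded One_nat_def])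
  finally show ?thesis by simp
qed

lemma indep_coordinates:
  assumes "I \<noteq> {}"
  shows "PP.indep_vars (\<lambda>_. F) (\<lambda>i x. x i) I"
proof -
  have "distr P (Pi\<^sub>M I (\<lambda>_. F)) (\<lambda>x. \<lambda>i\<in>I. x i) = distr P P (\<lambda>x. x)"
    by (intro distr_cong) (auto simp: space_PiM PiE_def extensional_restrict)
  also have "\<dots> = Pi\<^sub>M I (\<lambda>i. distr P F (\<lambda>x. x i))"
    by (subst distr_id2) (auto intro!: PiM_cong simp: PP.PiM_component)
  finally show ?thesis
    by (subst PP.indep_vars_iff_distr_eq_PiM'[OF assms]) auto
qed

lemma centered_square:
  assumes "i \<in> I" "j \<in> I" "i \<noteq> j"
  shows "integrable P (\<lambda>x. (H i j x)\<^sup>2 - m2)" "(\<integral>x. (H i j x)\<^sup>2 - m2 \<partial>P) = 0"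
    "integrable P (\<lambda>x. ((H i j x)\<^sup>2 - m2)\<^sup>2)" "(\<integral>x. ((H i j x)\<^sup>2 - m2)\<^sup>2 \<partial>P) \<le> m4"
proof -
  show 1: "integrable P (\<lambda>x. (H i j x)\<^sup>2 - m2)" "(\<integral>x. (H i j x)\<^sup>2 - m2 \<partial>P) = 0"
    using H_square[OF assms(1,2)] assms(3) by auto
  have *: "((H i j x)\<^sup>2 - m2)\<^sup>2 = H i j x ^ 4 - 2 * m2 * ((H i j x)\<^sup>2 - m2) - m2\<^sup>2" for x
    by (simp add: power2_eq_square power4_eq_xxxx algebra_simps)
  show "integrable P (\<lambda>x. ((H i j x)\<^sup>2 - m2)\<^sup>2)" "(\<integral>x. ((H i j x)\<^sup>2 - m2)\<^sup>2 \<partial>P) \<le> m4"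
    unfolding * using H_fourth[OF assms(1,2)] 1 assms(3) zero_le_power2[of m2] by auto
qed

lemma centered_square_disjoint:
  assumes "i \<in> I" "k \<in> I" "j \<in> I" "l \<in> I" "i \<noteq> k" "j \<noteq> l" "{i, k} \<inter> {j, l} = {}"
  shows "(\<integral>x. ((H i k x)\<^sup>2 - m2) * ((H j l x)\<^sup>2 - m2) \<partial>P) = 0"
proof -
  interpret A: kernel_sample F h "{i, k}" by unfold_locales simp
  interpret B: kernel_sample F h "{j, l}" by unfold_locales simp
  have "PP.indep_var (Pi\<^sub>M {i, k} (\<lambda>_. F)) (\<lambda>x. restrict (\<lambda>i. x i) {i, k})
      (Pi\<^sub>M {j, l} (\<lambda>_. F)) (\<lambda>x. restrict (\<lambda>i. x i) {j, l})"
    using assms by (intro PP.indep_var_restrict[OF indep_coordinates]) auto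
  moreover have "(\<lambda>x. (H i k x)\<^sup>2 - m2) \<in> borel_measurable (Pi\<^sub>M {i, k} (\<lambda>_. F))"
    by measurable
  moreover have "(\<lambda>x. (H j l x)\<^sup>2 - m2) \<in> borel_measurable (Pi\<^sub>M {j, l} (\<lambda>_. F))"
    by measurable
  ultimately have "PP.indep_var borel ((\<lambda>x. (H i k x)\<^sup>2 - m2) \<circ> (\<lambda>x. restrict (\<lambda>i. x i) {i, k}))
      borel ((\<lambda>x. (H j l x)\<^sup>2 - m2) \<circ> (\<lambda>x. restrict (\<lambda>i. x i) {j, l}))"
    by (rule PP.indep_var_compose)
  then have "PP.indep_var borel (\<lambda>x. (H i k x)\<^sup>2 - m2) borel (\<lambda>x. (H j l x)\<^sup>2 - m2)"
    using assms(5,6) by (simp add: H_def comp_def)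
  from PP.indep_var_lebesgue_integral[OF this] show ?thesis
    using centered_square[of i k] centered_square[of j l] assms by auto
qed

lemma sum_of_bool_eq1: "i \<in> I \<Longrightarrow> (\<Sum>j\<in>I. of_bool (i = j)) = (1 :: real)"
  using fin by (simp add: of_bool_def)

text \<open>Squared kernels on disjoint pairs are uncorrelated, so only pairs of pairs with a common index
  contribute, and there are at most \<open>4 n\<^sup>3\<close> of them.\<close>
lemma square_sum_variance:
  assumes a: "\<And>i k. i \<in> I \<Longrightarrow> k \<in> I \<Longrightarrow> \<bar>a i k\<bar> \<le> \<beta>" and diag: "\<And>i. a i i = 0"
  shows "integrable P (\<lambda>x. (\<Sum>i\<in>I. \<Sum>k\<in>I. a i k * ((H i k x)\<^sup>2 - m2))\<^sup>2)"
    and "(\<integral>x. (\<Sum>i\<in>I. \<Sum>k\<in>I. a i k * ((H i k x)\<^sup>2 - m2))\<^sup>2 \<partial>P) \<le> 4 * real (card I) ^ 3 * (\<beta>\<^sup>2 * m4)"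
proof -
  let ?f = "\<lambda>(i, k) x. a i k * ((H i k x)\<^sup>2 - m2)"
  let ?c = "\<lambda>(i, k) (j, l). (of_bool (i = j) + of_bool (i = l) + of_bool (k = j) + of_bool (k = l)) * (\<beta>\<^sup>2 * m4)"
  have pair: "integrable P (\<lambda>x. ?f (i, k) x * ?f (j, l) x) \<and>
      \<bar>\<integral>x. ?f (i, k) x * ?f (j, l) x \<partial>P\<bar> \<le> ?c (i, k) (j, l)"
    if I: "i \<in> I" "k \<in> I" "j \<in> I" "l \<in> I" for i k j l
  proof (cases "i = k \<or> j = l")
    case True
    then show ?thesis using m4_nonneg by (auto simp: diag)
  next
    case False
    note ne = False
    let ?u = "\<lambda>x. (H i k x)\<^sup>2 - m2" and ?v = "\<lambda>x. (H j l x)\<^sup>2 - m2"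
    have b: "\<bar>?u x * ?v x\<bar> \<le> ((?u x)\<^sup>2 + (?v x)\<^sup>2) / 2" for x
      using sum_squares_bound[of "\<bar>?u x\<bar>" "\<bar>?v x\<bar>"] by (simp add: abs_mult)
    note cs = centered_square(3,4)[of i k] centered_square(3,4)[of j l]
    have bi: "integrable P (\<lambda>x. ((?u x)\<^sup>2 + (?v x)\<^sup>2) / 2)" using cs I ne by auto
    have int: "integrable P (\<lambda>x. ?u x * ?v x)"
    proof (rule Bochner_Integration.integrable_bound[OF bi])
      show "AE x in P. norm (?u x * ?v x) \<le> norm (((?u x)\<^sup>2 + (?v x)\<^sup>2) / 2)"
        by (intro AE_I2) (simp only: real_norm_def order_trans[OF b abs_ge_self])
    qed (use I in measurable)
    have "\<bar>\<integral>x. ?u x * ?v x \<partial>P\<bar> \<le> (\<integral>x. ((?u x)\<^sup>2 + (?v x)\<^sup>2) / 2 \<partial>P)"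
      unfolding real_norm_def[symmetric]
      by (rule norm_integral_le) (fact int, fact bi, simp only: real_norm_def b)
    also have "\<dots> \<le> m4" using cs I ne by auto
    finally have le: "\<bar>\<integral>x. ?u x * ?v x \<partial>P\<bar> \<le> m4" .
    have fe: "?f (i, k) x * ?f (j, l) x = (a i k * a j l) * (?u x * ?v x)" for x by simp
    have "\<bar>\<integral>x. ?f (i, k) x * ?f (j, l) x \<partial>P\<bar> = \<bar>a i k * a j l\<bar> * \<bar>\<integral>x. ?u x * ?v x \<partial>P\<bar>"
      unfolding fe by (simp only: integral_mult_right_zero abs_mult)
    also have "\<dots> \<le> ?c (i, k) (j, l)"
    proof (cases "{i, k} \<inter> {j, l} = {}")
      case True
      have "(\<integral>x. ?u x * ?v x \<partial>P) = 0"
        using ne by (intro centered_square_disjoint I True) auto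
      then show ?thesis using True by simp
    next
      case False
      have "\<bar>a i k * a j l\<bar> \<le> \<beta>\<^sup>2"
        unfolding abs_mult power2_eq_square using a I by (intro mult_mono') auto
      then have "\<bar>a i k * a j l\<bar> * \<bar>\<integral>x. ?u x * ?v x \<partial>P\<bar> \<le> 1 * (\<beta>\<^sup>2 * m4)"
        using mult_mono[OF _ le] m4_nonneg by simp
      also have "\<dots> \<le> ?c (i, k) (j, l)"
        unfolding prod.case using False m4_nonneg by (intro mult_right_mono) auto
      finally show ?thesis .
    qed
    finally show ?thesis unfolding fe using int by auto
  qed
  have *: "(\<Sum>i\<in>I. \<Sum>k\<in>I. a i k * ((H i k x)\<^sup>2 - m2)) = (\<Sum>t\<in>I \<times> I. ?f t x)" for x
    by (simp add: sum.cartesian_product case_prod_beta')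
  have "(\<Sum>s\<in>I \<times> I. \<Sum>t\<in>I \<times> I. ?c s t) = 4 * real (card I) ^ 3 * (\<beta>\<^sup>2 * m4)"
    unfolding sum.cartesian_product' prod.case sum_distrib_right[symmetric] sum.distrib
    by (simp add: sum_of_bool_eq1 power3_eq_cube flip: sum_distrib_left cong: sum.cong)
  moreover have "finite (I \<times> I)" using fin by simp
  moreover have "integrable P (\<lambda>x. ?f s x * ?f t x)" "\<bar>\<integral>x. ?f s x * ?f t x \<partial>P\<bar> \<le> ?c s t"
    if "s \<in> I \<times> I" "t \<in> I \<times> I" for s t
    using pair[of "fst s" "snd s" "fst t" "snd t"] that by (auto simp: case_prod_beta')
  ultimately show
    "integrable P (\<lambda>x. (\<Sum>i\<in>I. \<Sum>k\<in>I. a i k * ((H i k x)\<^sup>2 - m2))\<^sup>2)"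
    "(\<integral>x. (\<Sum>i\<in>I. \<Sum>k\<in>I. a i k * ((H i k x)\<^sup>2 - m2))\<^sup>2 \<partial>P) \<le> 4 * real (card I) ^ 3 * (\<beta>\<^sup>2 * m4)"
    unfolding * using integral_square_sum_le[of "I \<times> I" P ?f ?c] by auto
qed

end

context kernel_sample
begin

lemma sum_of_bool_mem_le:
  assumes "card A \<le> c" "finite A"
  shows "(\<Sum>j\<in>I. of_bool (j \<in> A)) \<le> real c"
proof -
  have "(\<Sum>j\<in>I. of_bool (j \<in> A)) = real (card (I \<inter> A))"
    using sum.inter_restrict[OF fin, of "\<lambda>_. 1::real" A] by (simp add: of_bool_def)
  also have "\<dots> \<le> real (card A)" using assms by (simp add: card_mono)
  finally show ?thesis using assms(1) by linarith
qed

text \<open>The next three quantities count the index patterns whose moments need not vanish. As named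
  constants they remain opaque to the simplifier, which otherwise expands the memberships into
  many cases.\<close>
definition in_triple :: "nat \<Rightarrow> nat \<Rightarrow> nat \<Rightarrow> nat \<Rightarrow> nat \<Rightarrow> nat \<Rightarrow> real" where
  "in_triple i j k i' j' k' =
     of_bool (k' \<in> {i, j, k}) * (of_bool (i' \<in> {i, j, k}) * of_bool (j' \<in> {i, j, k}))"

definition same_ends :: "nat \<Rightarrow> nat \<Rightarrow> nat \<Rightarrow> nat \<Rightarrow> real" where
  "same_ends i j i' j' = of_bool (i = i') * of_bool (j = j') + of_bool (i = j') * of_bool (j = i')"

definition paired :: "nat \<Rightarrow> nat \<Rightarrow> nat \<Rightarrow> nat \<Rightarrow> real" where
  "paired i j i' j' = of_bool (i = j) * of_bool (i' = j') + of_bool (i = i') * of_bool (j = j')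
      + of_bool (i = j') * of_bool (j = i')"

lemma match_nonneg: "0 \<le> in_triple i j k i' j' k'" "0 \<le> same_ends i j i' j'" "0 \<le> paired i j i' j'"
  unfolding in_triple_def same_ends_def paired_def
  by (intro add_nonneg_nonneg mult_nonneg_nonneg zero_less_eq_of_bool)+

lemma sum_in_triple_le: "(\<Sum>k'\<in>I. \<Sum>i'\<in>I. \<Sum>j'\<in>I. in_triple i j k i' j' k') \<le> 27"
proof -
  let ?s = "\<Sum>l\<in>I. of_bool (l \<in> {i, j, k}) :: real"
  have "(\<Sum>k'\<in>I. \<Sum>i'\<in>I. \<Sum>j'\<in>I. in_triple i j k i' j' k') = ?s * (?s * ?s)"
    unfolding in_triple_def sum_distrib_left[symmetric] sum_distrib_right[symmetric] ..
  also have "\<dots> \<le> 3 * (3 * 3)"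
  proof -
    have s: "?s \<le> 3" using sum_of_bool_mem_le[of "{i, j, k}" 3] by (simp add: card_insert_if)
    have "0 \<le> ?s" by (intro sum_nonneg zero_less_eq_of_bool)
    with s show ?thesis by (intro mult_mono mult_nonneg_nonneg) (assumption | simp only: zero_le_numeral)+
  qed
  finally show ?thesis by simp
qed

lemma sum_match_eq:
  assumes "i \<in> I" "j \<in> I"
  shows "(\<Sum>i'\<in>I. \<Sum>j'\<in>I. of_bool (i = i') * of_bool (j = j')) = (1 :: real)"
    "(\<Sum>i'\<in>I. \<Sum>j'\<in>I. of_bool (i = j') * of_bool (j = i')) = (1 :: real)"
  unfolding sum_distrib_left[symmetric] sum_distrib_right[symmetric] sum_of_bool_eq1[OF assms(1)]
    sum_of_bool_eq1[OF assms(2)] mult_1_left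
  by (rule refl)+

lemma sum_same_ends: "i \<in> I \<Longrightarrow> j \<in> I \<Longrightarrow> (\<Sum>i'\<in>I. \<Sum>j'\<in>I. same_ends i j i' j') = 2"
  unfolding same_ends_def sum.distrib by (simp only: sum_match_eq one_add_one)

lemma sum_paired: "(\<Sum>i\<in>I. \<Sum>j\<in>I. \<Sum>i'\<in>I. \<Sum>j'\<in>I. paired i j i' j') = 3 * (real (card I))\<^sup>2"
proof -
  have "(\<Sum>i\<in>I. \<Sum>j\<in>I. \<Sum>i'\<in>I. \<Sum>j'\<in>I. of_bool (i = i') * of_bool (j = j') :: real)
      = (real (card I))\<^sup>2"
    "(\<Sum>i\<in>I. \<Sum>j\<in>I. \<Sum>i'\<in>I. \<Sum>j'\<in>I. of_bool (i = j') * of_bool (j = i') :: real)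
      = (real (card I))\<^sup>2"
    by (simp_all only: sum_match_eq sum_constant power2_eq_square mult_1_right cong: sum.cong)
  moreover have "(\<Sum>i\<in>I. \<Sum>j\<in>I. of_bool (i = j) :: real) = real (card I)"
    by (simp only: sum_of_bool_eq1 sum_constant mult_1_right cong: sum.cong)
  then have "(\<Sum>i\<in>I. \<Sum>j\<in>I. \<Sum>i'\<in>I. \<Sum>j'\<in>I. of_bool (i = j) * of_bool (i' = j') :: real)
      = (real (card I))\<^sup>2"
    by (simp only: sum_distrib_left[symmetric] sum_distrib_right[symmetric] power2_eq_square)
  ultimately show ?thesis unfolding paired_def sum.distrib by simp
qed

text \<open>Two paths \<open>i - k - j\<close> and \<open>i' - k' - j'\<close> with distinct endpoints. Every endpoint must be met by
  the other path. Either the second path stays within the vertices of the first, or its midpoint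
  is new and the endpoints coincide, which closes a four-cycle.\<close>
lemma path_pair_moment:
  assumes I: "i \<in> I" "j \<in> I" "k \<in> I" "i' \<in> I" "j' \<in> I" "k' \<in> I"
    and ne: "i \<noteq> j" "i' \<noteq> j'"
  shows "\<bar>\<integral>x. H i k x * H j k x * H i' k' x * H j' k' x \<partial>P\<bar>
    \<le> m4 * in_triple i j k i' j' k' + \<bar>cyc\<bar> * same_ends i j i' j'"
    (is "\<bar>?Q\<bar> \<le> ?R")
proof -
  have R0: "?R \<ge> 0"
    by (intro add_nonneg_nonneg mult_nonneg_nonneg m4_nonneg match_nonneg abs_ge_zero)
  consider (loop) "i = k \<or> j = k \<or> i' = k' \<or> j' = k'"
    | (out) "i \<noteq> k" "j \<noteq> k" "i' \<noteq> k'" "j' \<noteq> k'" "i' \<notin> {i, j, k} \<or> j' \<notin> {i, j, k}"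
    | (inside) "i' \<in> {i, j, k}" "j' \<in> {i, j, k}" "k' \<in> {i, j, k}"
    | (four) "i \<noteq> k" "j \<noteq> k" "i' \<noteq> k'" "j' \<noteq> k'" "i' \<in> {i, j, k}" "j' \<in> {i, j, k}" "k' \<notin> {i, j, k}"
    by blast
  then show ?thesis
  proof cases
    case loop
    then have "?Q = 0" by auto
    then show ?thesis using R0 by (simp only: abs_zero)
  next
    case out
    have "?Q = (\<integral>x. H i' k' x * H j' k' x * H i k x * H j k x \<partial>P)"
      "?Q = (\<integral>x. H j' k' x * H i' k' x * H i k x * H j k x \<partial>P)" by (simp_all only: ac_simps)
    moreover have "(\<integral>x. H i' k' x * H j' k' x * H i k x * H j k x \<partial>P) = 0" if "i' \<notin> {i, j, k}"
      using that out(1-4) ne by (intro prod4_zero I) auto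
    moreover have "(\<integral>x. H j' k' x * H i' k' x * H i k x * H j k x \<partial>P) = 0" if "j' \<notin> {i, j, k}"
      using that out(1-4) ne by (intro prod4_zero I) auto
    ultimately have "?Q = 0" using out(5) by argo
    then show ?thesis using R0 by (simp only: abs_zero)
  next
    case inside
    have "\<bar>?Q\<bar> \<le> m4" using I by (intro prod4_integrable(2))
    moreover have "in_triple i j k i' j' k' = 1"
      by (simp only: in_triple_def inside of_bool_eq mult_1_right)
    moreover have "0 \<le> \<bar>cyc\<bar> * same_ends i j i' j'" by (simp add: match_nonneg)
    ultimately show ?thesis by simp
  next
    case four
    have z: "?Q = 0" if "i \<notin> {i', j'}"
      using that four(1,2,7) ne by (intro prod4_zero I) auto
    have "?Q = (\<integral>x. H j k x * H i k x * H i' k' x * H j' k' x \<partial>P)" by (simp only: ac_simps)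
    also have "\<dots> = 0" if "j \<notin> {i', j'}"
      using that four(1,2,7) ne by (intro prod4_zero I) auto
    finally have z': "?Q = 0" if "j \<notin> {i', j'}" using that by simp
    have d: "distinct [i, j, k, k']" using four(1,2,7) ne(1) by auto
    consider "i \<notin> {i', j'} \<or> j \<notin> {i', j'}" | "i' = i" "j' = j" | "i' = j" "j' = i"
      using ne by blast
    then show ?thesis
    proof cases
      case 1
      then have "?Q = 0" using z z' by blast
      then show ?thesis using R0 by (simp only: abs_zero)
    next
      case 2
      have "?Q = cyc" unfolding 2 by (intro cycle_moment I d)
      moreover have "same_ends i j i' j' = 1"
        unfolding 2 same_ends_def using ne(1) by simp
      ultimately show ?thesis by (simp add: m4_nonneg match_nonneg)
    next
      case 3
      have "?Q = (\<integral>x. H i k x * H j k x * H i k' x * H j k' x \<partial>P)" unfolding 3 by (simp only: ac_simps)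
      also have "\<dots> = cyc" by (intro cycle_moment I d)
      finally have "?Q = cyc" .
      moreover have "same_ends i j i' j' = 1"
        unfolding 3 same_ends_def using ne(1) by simp
      ultimately show ?thesis by (simp add: m4_nonneg match_nonneg)
    qed
  qed
qed

text \<open>Four edges that meet in \<open>k\<close>: unless the outer ends coincide in pairs, one of them lies on a single
  edge.\<close>
lemma star_moment:
  assumes I: "i \<in> I" "j \<in> I" "i' \<in> I" "j' \<in> I" "k \<in> I"
  shows "\<bar>\<integral>x. H i k x * H j k x * H i' k x * H j' k x \<partial>P\<bar>
    \<le> m4 * paired i j i' j'"
    (is "\<bar>?Q\<bar> \<le> ?R")
proof -
  have R0: "?R \<ge> 0" by (intro mult_nonneg_nonneg m4_nonneg match_nonneg)
  have z: "(\<integral>x. H p k x * H q k x * H r k x * H s k x \<partial>P) = 0"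
    if "p \<in> I" "q \<in> I" "r \<in> I" "s \<in> I" "p \<notin> {q, r, s}" for p q r s
  proof (cases "p = k")
    case False
    then show ?thesis using that I by (intro prod4_zero) auto
  qed simp
  have perm: "?Q = (\<integral>x. H j k x * H i k x * H i' k x * H j' k x \<partial>P)"
    "?Q = (\<integral>x. H i' k x * H i k x * H j k x * H j' k x \<partial>P)"
    "?Q = (\<integral>x. H j' k x * H i k x * H j k x * H i' k x \<partial>P)" by (simp_all only: ac_simps)
  have "?Q = 0" if "i \<notin> {j, i', j'}" using that z I by blast
  moreover have "?Q = 0" if "j \<notin> {i, i', j'}" unfolding perm(1) using that z I by blast
  moreover have "?Q = 0" if "i' \<notin> {i, j, j'}" unfolding perm(2) using that z I by blast
  moreover have "?Q = 0" if "j' \<notin> {i, j, i'}" unfolding perm(3) using that z I by blast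
  moreover have "\<bar>?Q\<bar> \<le> ?R" if "(i = j \<and> i' = j') \<or> (i = i' \<and> j = j') \<or> (i = j' \<and> j = i')"
  proof -
    have "\<bar>?Q\<bar> \<le> m4 * 1" using prod4_integrable(2)[OF I(1,5,2,5,3,5,4,5)] by simp
    also have "\<dots> \<le> ?R" using that unfolding paired_def by (intro mult_left_mono m4_nonneg) auto
    finally show ?thesis .
  qed
  moreover have "(i = j \<and> i' = j') \<or> (i = i' \<and> j = j') \<or> (i = j' \<and> j = i')"
    if "i \<in> {j, i', j'}" "j \<in> {i, i', j'}" "i' \<in> {i, j, j'}" "j' \<in> {i, j, i'}"
    using that by auto
  ultimately have "?Q = 0 \<or> \<bar>?Q\<bar> \<le> ?R" by blast
  then show ?thesis
  proof
    assume "?Q = 0"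
    with R0 show ?thesis by (simp only: abs_zero)
  qed
qed

end

section \<open>Weighted quadratic forms\<close>

text \<open>A quadratic form \<open>S\<close> in the kernel. Its part \<open>T k\<close> collects the terms that involve the observation
  \<open>k\<close>; since each term has two indices, \<open>S\<close> is half the sum of these parts.\<close>
locale weighted_sample = kernel_sample F h I for F :: "'x measure" and h I +
  fixes a :: "nat \<Rightarrow> nat \<Rightarrow> real" and b :: real
  assumes a_sym: "a i k = a k i" and a_diag [simp]: "a i i = 0"
    and a_bound: "i \<in> I \<Longrightarrow> k \<in> I \<Longrightarrow> \<bar>a i k\<bar> \<le> b"
begin

definition T :: "nat \<Rightarrow> (nat \<Rightarrow> 'x) \<Rightarrow> real" where
  "T k x = (\<Sum>i\<in>I. a i k * H i k x)"

definition S :: "(nat \<Rightarrow> 'x) \<Rightarrow> real" where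
  "S x = (\<Sum>k\<in>I. T k x) / 2"

abbreviation quad_var :: "(nat \<Rightarrow> 'x) \<Rightarrow> real" where
  "quad_var x \<equiv> (\<Sum>k\<in>I. (T k x)\<^sup>2) / 2"

lemma T_meas [measurable]: "k \<in> I \<Longrightarrow> T k \<in> borel_measurable P"
  unfolding T_def[abs_def] by measurable

lemma S_meas [measurable]: "S \<in> borel_measurable P"
  unfolding S_def[abs_def] by measurable

lemma abs_weights4:
  assumes "i \<in> I" "k \<in> I" "j \<in> I" "l \<in> I" "i' \<in> I" "k' \<in> I" "j' \<in> I" "l' \<in> I"
  shows "\<bar>a i k * a j l * a i' k' * a j' l'\<bar> \<le> b ^ 4"
proof -
  have "\<bar>a i k * a j l * a i' k' * a j' l'\<bar> \<le> b * b * b * b"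
    unfolding abs_mult using a_bound assms
    by (intro mult_mono') (auto intro!: mult_nonneg_nonneg)
  then show ?thesis by (simp add: power4_eq_xxxx)
qed

lemma weighted_prod4:
  assumes "i \<in> I" "k \<in> I" "j \<in> I" "l \<in> I" "i' \<in> I" "k' \<in> I" "j' \<in> I" "l' \<in> I"
    and le: "\<bar>\<integral>x. H i k x * H j l x * H i' k' x * H j' l' x \<partial>P\<bar> \<le> c"
    and eq: "\<And>x. f x = (a i k * a j l * a i' k' * a j' l') * (H i k x * H j l x * H i' k' x * H j' l' x)"
  shows "integrable P f" "\<bar>\<integral>x. f x \<partial>P\<bar> \<le> b ^ 4 * c"
proof -
  show "integrable P f" unfolding eq[abs_def] using prod4_integrable(1)[OF assms(1-8)] by simp
  have "\<bar>\<integral>x. f x \<partial>P\<bar> = \<bar>a i k * a j l * a i' k' * a j' l'\<bar> * \<bar>\<integral>x. H i k x * H j l x * H i' k' x * H j' l' x \<partial>P\<bar>"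
    unfolding eq[abs_def] by (simp only: integral_mult_right_zero abs_mult)
  also have "\<dots> \<le> b ^ 4 * c"
    using abs_weights4[OF assms(1-8)] le by (intro mult_mono) auto
  finally show "\<bar>\<integral>x. f x \<partial>P\<bar> \<le> b ^ 4 * c" .
qed

abbreviation path_sum :: "(nat \<Rightarrow> 'x) \<Rightarrow> real" where
  "path_sum x \<equiv> \<Sum>k\<in>I. \<Sum>i\<in>I. \<Sum>j\<in>I - {i}. a i k * H i k x * (a j k * H j k x)"

lemma path_sum_second_moment:
  shows "integrable P (\<lambda>x. (path_sum x)\<^sup>2)"
    and "(\<integral>x. (path_sum x)\<^sup>2 \<partial>P)
      \<le> b ^ 4 * (27 * real (card I) ^ 3 * m4 + 2 * real (card I) ^ 4 * \<bar>cyc\<bar>)"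
proof -
  let ?n = "real (card I)"
  let ?f = "\<lambda>(k, i, j) x. of_bool (i \<noteq> j) * (a i k * H i k x * (a j k * H j k x))"
  let ?c = "\<lambda>(k, i, j) (k', i', j'). b ^ 4 * (
     m4 * in_triple i j k i' j' k' + \<bar>cyc\<bar> * same_ends i j i' j')"
  let ?A = "I \<times> I \<times> I"
  have pair: "integrable P (\<lambda>x. ?f (k, i, j) x * ?f (k', i', j') x) \<and>
      \<bar>\<integral>x. ?f (k, i, j) x * ?f (k', i', j') x \<partial>P\<bar> \<le> ?c (k, i, j) (k', i', j')"
    if I: "i \<in> I" "j \<in> I" "k \<in> I" "i' \<in> I" "j' \<in> I" "k' \<in> I" for i j k i' j' k'
  proof (cases "i \<noteq> j \<and> i' \<noteq> j'")
    case True
    note w = weighted_prod4[OF I(1,3,2,3,4,6,5,6) path_pair_moment[OF I]]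
    show ?thesis unfolding prod.case
      by (intro conjI w) (use True in \<open>simp_all add: ac_simps\<close>)
  next
    case False
    moreover have "0 \<le> ?c (k, i, j) (k', i', j')"
      unfolding prod.case by (intro mult_nonneg_nonneg add_nonneg_nonneg m4_nonneg match_nonneg) simp_all
    ultimately show ?thesis by auto
  qed
  have "(\<Sum>j\<in>I - {i}. g j) = (\<Sum>j\<in>I. of_bool (i \<noteq> j) * g j)" for i and g :: "nat \<Rightarrow> real"
    using fin by (intro sum.mono_neutral_cong_left) auto
  then have *: "path_sum x = (\<Sum>t\<in>?A. ?f t x)" for x
    unfolding sum.cartesian_product' prod.case by simp
  have t: "(\<Sum>k'\<in>I. \<Sum>i'\<in>I. \<Sum>j'\<in>I. ?c (k, i, j) (k', i', j')) \<le> b ^ 4 * (27 * m4 + 2 * ?n * \<bar>cyc\<bar>)"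
    if I: "i \<in> I" "j \<in> I" "k \<in> I" for i j k
  proof -
    have "(\<Sum>k'\<in>I. \<Sum>i'\<in>I. \<Sum>j'\<in>I. ?c (k, i, j) (k', i', j'))
        = b ^ 4 * (m4 * (\<Sum>k'\<in>I. \<Sum>i'\<in>I. \<Sum>j'\<in>I. in_triple i j k i' j' k')
          + \<bar>cyc\<bar> * (?n * (\<Sum>i'\<in>I. \<Sum>j'\<in>I. same_ends i j i' j')))"
      by (simp only: prod.case sum_distrib_left[symmetric] sum.distrib sum_constant)
    also have "\<dots> \<le> b ^ 4 * (m4 * 27 + \<bar>cyc\<bar> * (?n * 2))"
      unfolding sum_same_ends[OF I(1,2)]
      by (intro mult_left_mono add_right_mono sum_in_triple_le m4_nonneg) simp
    finally show ?thesis by (simp add: algebra_simps)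
  qed
  have "(\<Sum>s\<in>?A. \<Sum>t\<in>?A. ?c s t) \<le> (\<Sum>k\<in>I. \<Sum>i\<in>I. \<Sum>j\<in>I. b ^ 4 * (27 * m4 + 2 * ?n * \<bar>cyc\<bar>))"
    unfolding sum.cartesian_product' by (intro sum_mono t)
  also have "\<dots> = b ^ 4 * (27 * ?n ^ 3 * m4 + 2 * ?n ^ 4 * \<bar>cyc\<bar>)"
    by (simp add: power3_eq_cube power4_eq_xxxx algebra_simps)
  finally have c: "(\<Sum>s\<in>?A. \<Sum>t\<in>?A. ?c s t) \<le> b ^ 4 * (27 * ?n ^ 3 * m4 + 2 * ?n ^ 4 * \<bar>cyc\<bar>)" .
  have fA: "finite ?A" using fin by simp
  have fi: "integrable P (\<lambda>x. ?f s x * ?f t x)" and fc: "\<bar>\<integral>x. ?f s x * ?f t x \<partial>P\<bar> \<le> ?c s t"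
    if "s \<in> ?A" "t \<in> ?A" for s t
    using pair[of "fst (snd s)" "snd (snd s)" "fst s" "fst (snd t)" "snd (snd t)" "fst t"] that
    by (auto simp: case_prod_beta')
  note sq = integral_square_sum_le[of ?A P ?f ?c, OF fA fi fc]
  show "integrable P (\<lambda>x. (path_sum x)\<^sup>2)"
    unfolding * by (rule sq(1))
  show "(\<integral>x. (path_sum x)\<^sup>2 \<partial>P)
      \<le> b ^ 4 * (27 * ?n ^ 3 * m4 + 2 * ?n ^ 4 * \<bar>cyc\<bar>)"
    unfolding * by (rule order_trans[OF sq(2) c])
qed

lemma T_fourth_moment:
  assumes k: "k \<in> I"
  shows "integrable P (\<lambda>x. T k x ^ 4)"
    and "(\<integral>x. T k x ^ 4 \<partial>P) \<le> b ^ 4 * (3 * real (card I) ^ 2 * m4)"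
proof -
  let ?n = "real (card I)"
  let ?f = "\<lambda>(i, j) x. a i k * H i k x * (a j k * H j k x)"
  let ?c = "\<lambda>(i, j) (i', j'). b ^ 4 * (m4 * paired i j i' j')"
  let ?A = "I \<times> I"
  have pair: "integrable P (\<lambda>x. ?f (i, j) x * ?f (i', j') x) \<and>
      \<bar>\<integral>x. ?f (i, j) x * ?f (i', j') x \<partial>P\<bar> \<le> ?c (i, j) (i', j')"
    if I: "i \<in> I" "j \<in> I" "i' \<in> I" "j' \<in> I" for i j i' j'
  proof -
    note w = weighted_prod4[OF I(1) k I(2) k I(3) k I(4) k star_moment[OF I k]]
    show ?thesis unfolding prod.case by (intro conjI w) (simp_all add: ac_simps)
  qed
  have *: "T k x ^ 4 = (\<Sum>t\<in>?A. ?f t x)\<^sup>2" for x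
  proof -
    have "(\<Sum>t\<in>?A. ?f t x) = (T k x)\<^sup>2"
      unfolding sum.cartesian_product' prod.case T_def power2_eq_square sum_product ..
    then show ?thesis by simp
  qed
  have c: "(\<Sum>s\<in>?A. \<Sum>t\<in>?A. ?c s t) = b ^ 4 * (3 * ?n ^ 2 * m4)"
    unfolding sum.cartesian_product' prod.case sum_distrib_left[symmetric] sum_paired by simp
  have fA: "finite ?A" using fin by simp
  have fi: "integrable P (\<lambda>x. ?f s x * ?f t x)" and fc: "\<bar>\<integral>x. ?f s x * ?f t x \<partial>P\<bar> \<le> ?c s t"
    if "s \<in> ?A" "t \<in> ?A" for s t
    using pair[of "fst s" "snd s" "fst t" "snd t"] that by (auto simp: case_prod_beta')
  note sq = integral_square_sum_le[of ?A P ?f ?c, OF fA fi fc]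
  show "integrable P (\<lambda>x. T k x ^ 4)" unfolding * by (rule sq(1))
  show "(\<integral>x. T k x ^ 4 \<partial>P) \<le> b ^ 4 * (3 * ?n ^ 2 * m4)"
    unfolding * c[symmetric] by (rule sq(2))
qed

lemma T_square:
  assumes k: "k \<in> I"
  shows "integrable P (\<lambda>x. (T k x)\<^sup>2)"
    and "(\<integral>x. (T k x)\<^sup>2 \<partial>P) = (\<Sum>i\<in>I. (a i k)\<^sup>2 * m2)"
proof -
  have *: "(T k x)\<^sup>2 = (\<Sum>i\<in>I. \<Sum>j\<in>I. (a i k * a j k) * (H i k x * H j k x))" for x
    unfolding T_def power2_eq_square sum_product by (simp add: ac_simps)
  have int: "integrable P (\<lambda>x. H i k x * H j k x)" if "i \<in> I" "j \<in> I" for i j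
    using that k by (intro prod2_integrable)
  show "integrable P (\<lambda>x. (T k x)\<^sup>2)" unfolding * using int by auto
  have "(\<integral>x. (T k x)\<^sup>2 \<partial>P) = (\<Sum>i\<in>I. \<Sum>j\<in>I. (a i k * a j k) * (\<integral>x. H i k x * H j k x \<partial>P))"
    unfolding * using int by (simp add: Bochner_Integration.integral_sum)
  also have "\<dots> = (\<Sum>i\<in>I. \<Sum>j\<in>I. if i = j then (a i k)\<^sup>2 * m2 else 0)"
  proof (intro sum.cong refl)
    fix i j assume "i \<in> I" "j \<in> I"
    then show "(a i k * a j k) * (\<integral>x. H i k x * H j k x \<partial>P) = (if i = j then (a i k)\<^sup>2 * m2 else 0)"
      using prod2_zero[of i k j k] H_square(2)[of i k] k
      by (cases "i = k") (auto simp: power2_eq_square)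
  qed
  finally show "(\<integral>x. (T k x)\<^sup>2 \<partial>P) = (\<Sum>i\<in>I. (a i k)\<^sup>2 * m2)" using fin by simp
qed

text \<open>The sum of the squares of the parts \<open>T k\<close> splits into a diagonal, the weighted sum of squared
  kernels, and the sum over paths \<open>i - k - j\<close> with distinct ends, which has mean zero. The two pieces
  are controlled by \<open>square_sum_variance\<close> and \<open>path_sum_second_moment\<close>.\<close>
lemma quadratic_variation_L2:
  assumes "b \<ge> 0" and norm1: "(\<Sum>i\<in>I. \<Sum>k\<in>I. (a i k)\<^sup>2) * m2 = 2"
  shows "integrable P (\<lambda>x. (quad_var x - 1)\<^sup>2)"
    and "(\<integral>x. (quad_var x - 1)\<^sup>2 \<partial>P)
      \<le> b ^ 4 * (16 * real (card I) ^ 3 * m4 + real (card I) ^ 4 * \<bar>cyc\<bar>)"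
proof -
  let ?n = "real (card I)"
  let ?A = "\<lambda>x. \<Sum>i\<in>I. \<Sum>k\<in>I. (a i k)\<^sup>2 * ((H i k x)\<^sup>2 - m2)"
    have a2: "\<bar>(a i k)\<^sup>2\<bar> \<le> b\<^sup>2" if "i \<in> I" "k \<in> I" for i k
    using a_bound[OF that] by (simp add: abs_le_square_iff[symmetric])
  have d: "(a i i)\<^sup>2 = 0" for i by simp
  note A = square_sum_variance[of "\<lambda>i k. (a i k)\<^sup>2" "b\<^sup>2", OF a2 d]
  note B = path_sum_second_moment
  have *: "quad_var x - 1 = (?A x + path_sum x) / 2" for x
  proof -
    have "(T k x)\<^sup>2 = (\<Sum>i\<in>I. (a i k)\<^sup>2 * (H i k x)\<^sup>2
        + (\<Sum>j\<in>I - {i}. a i k * H i k x * (a j k * H j k x)))" for k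
      unfolding T_def power2_eq_square sum_product
      using fin by (intro sum.cong refl) (subst sum.remove, auto simp: ac_simps)
    then have "(\<Sum>k\<in>I. (T k x)\<^sup>2) = (\<Sum>k\<in>I. \<Sum>i\<in>I. (a i k)\<^sup>2 * (H i k x)\<^sup>2) + path_sum x"
      by (simp add: sum.distrib)
    also have "(\<Sum>k\<in>I. \<Sum>i\<in>I. (a i k)\<^sup>2 * (H i k x)\<^sup>2) = (\<Sum>i\<in>I. \<Sum>k\<in>I. (a i k)\<^sup>2 * (H i k x)\<^sup>2)"
      by (rule sum.swap)
    also have "\<dots> = ?A x + 2"
      unfolding norm1[symmetric] sum_distrib_right
      by (simp add: algebra_simps flip: sum.distrib)
    finally have "(\<Sum>k\<in>I. (T k x)\<^sup>2) = ?A x + 2 + path_sum x" .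
    moreover have "z / 2 - 1 = (u + v) / 2" if "z = u + 2 + v" for z u v :: real
      by (simp add: that add_divide_distrib)
    ultimately show ?thesis by blast
  qed
  have le: "((?A x + path_sum x) / 2)\<^sup>2 \<le> ((?A x)\<^sup>2 + (path_sum x)\<^sup>2) / 2" for x
  proof -
    have "((u + v) / 2)\<^sup>2 \<le> (u\<^sup>2 + v\<^sup>2) / 2" for u v :: real
      using zero_le_power2[of "u - v"] by (simp add: power2_eq_square field_simps)
    then show ?thesis .
  qed
  have int: "integrable P (\<lambda>x. ((?A x)\<^sup>2 + (path_sum x)\<^sup>2) / 2)" using A B by auto
  show i: "integrable P (\<lambda>x. (quad_var x - 1)\<^sup>2)"
  proof (rule Bochner_Integration.integrable_bound[OF int])
    show "AE x in P. norm ((quad_var x - 1)\<^sup>2) \<le> norm (((?A x)\<^sup>2 + (path_sum x)\<^sup>2) / 2)"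
      unfolding * using le by (intro AE_I2) simp
  qed measurable
  have "(\<integral>x. (quad_var x - 1)\<^sup>2 \<partial>P) \<le> (\<integral>x. ((?A x)\<^sup>2 + (path_sum x)\<^sup>2) / 2 \<partial>P)"
    by (intro integral_mono i int) (simp only: * le)
  also have "\<dots> \<le> (4 * ?n ^ 3 * ((b\<^sup>2)\<^sup>2 * m4) + b ^ 4 * (27 * ?n ^ 3 * m4 + 2 * ?n ^ 4 * \<bar>cyc\<bar>)) / 2"
    using A B by simp
  also have "\<dots> \<le> b ^ 4 * (16 * ?n ^ 3 * m4 + ?n ^ 4 * \<bar>cyc\<bar>)"
    using m4_nonneg by (simp add: algebra_simps flip: power_mult)
  finally show "(\<integral>x. (quad_var x - 1)\<^sup>2 \<partial>P)
      \<le> b ^ 4 * (16 * ?n ^ 3 * m4 + ?n ^ 4 * \<bar>cyc\<bar>)" .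
qed

end

section \<open>A Stein equation for the characteristic function\<close>

text \<open>The Gaussian characteristic function solves \<open>\<phi>' = - u \<phi>\<close>. An approximate solution stays close
  to it, because \<open>exp (u\<^sup>2 / 2) \<phi> u\<close> has a small derivative.\<close>
lemma gaussian_char_ode:
  fixes \<phi> \<phi>' :: "real \<Rightarrow> complex"
  assumes "\<epsilon> \<ge> 0" and \<phi>0: "\<phi> 0 = 1"
    and deriv: "\<And>u. (\<phi> has_vector_derivative \<phi>' u) (at u)"
    and bound: "\<And>u. norm (\<phi>' u + of_real u * \<phi> u) \<le> \<epsilon> * (\<bar>u\<bar> + u\<^sup>2)"
  shows "norm (\<phi> t - of_real (exp (- (t\<^sup>2 / 2)))) \<le> \<epsilon> * (t\<^sup>2 + \<bar>t\<bar> ^ 3)"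
proof -
  define \<psi> where "\<psi> u = exp (u\<^sup>2 / 2) *\<^sub>R \<phi> u" for u :: real
  define d where "d u = exp (u\<^sup>2 / 2) *\<^sub>R (\<phi>' u + of_real u * \<phi> u)" for u :: real
  have \<psi>': "(\<psi> has_derivative (\<lambda>h. h *\<^sub>R d u)) (at u within A)" for u A
  proof -
    have "((\<lambda>u. exp (u\<^sup>2 / 2)) has_real_derivative (exp (u\<^sup>2 / 2) * u)) (at u)"
      by (auto intro!: derivative_eq_intros)
    then have "((\<lambda>u. exp (u\<^sup>2 / 2) *\<^sub>R \<phi> u) has_vector_derivative
        (exp (u\<^sup>2 / 2) *\<^sub>R \<phi>' u + (exp (u\<^sup>2 / 2) * u) *\<^sub>R \<phi> u)) (at u)"
      by (rule has_vector_derivative_scaleR[OF _ deriv])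
    then have "(\<psi> has_vector_derivative d u) (at u)"
      by (simp add: \<psi>_def[abs_def] d_def scaleR_conv_of_real algebra_simps)
    then show ?thesis
      unfolding has_vector_derivative_def by (rule has_derivative_at_withinI)
  qed
  have "norm (\<psi> t - \<psi> 0) \<le> (exp (t\<^sup>2 / 2) * (\<epsilon> * (\<bar>t\<bar> + t\<^sup>2))) * norm (t - 0)"
  proof (rule differentiable_bound[of "closed_segment 0 t"])
    fix u assume "u \<in> closed_segment 0 t"
    then have u: "\<bar>u\<bar> \<le> \<bar>t\<bar>" by (auto simp: closed_segment_eq_real_ivl split: if_splits)
    then have u2: "u\<^sup>2 \<le> t\<^sup>2" by (simp add: abs_le_square_iff)
    show "(\<psi> has_derivative (\<lambda>h. h *\<^sub>R d u)) (at u within closed_segment 0 t)" by (rule \<psi>')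
    have "norm (d u) \<le> exp (u\<^sup>2 / 2) * (\<epsilon> * (\<bar>u\<bar> + u\<^sup>2))"
      unfolding d_def using bound[of u] by simp
    also have "\<dots> \<le> exp (t\<^sup>2 / 2) * (\<epsilon> * (\<bar>t\<bar> + t\<^sup>2))"
      using u u2 assms(1) by (intro mult_mono add_mono) auto
    finally have "norm (d u) \<le> exp (t\<^sup>2 / 2) * (\<epsilon> * (\<bar>t\<bar> + t\<^sup>2))" .
    then show "onorm (\<lambda>h. h *\<^sub>R d u) \<le> exp (t\<^sup>2 / 2) * (\<epsilon> * (\<bar>t\<bar> + t\<^sup>2))"
      by (intro onorm_le) (simp add: mult.commute mult_left_mono)
  qed auto
  then have 1: "norm (\<psi> t - 1) \<le> exp (t\<^sup>2 / 2) * (\<epsilon> * (t\<^sup>2 + \<bar>t\<bar> ^ 3))"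
    by (simp add: \<psi>_def \<phi>0 power2_eq_square power3_eq_cube algebra_simps flip: power2_abs abs_mult)
  have "norm (\<phi> t - of_real (exp (- (t\<^sup>2 / 2)))) = exp (- (t\<^sup>2 / 2)) * norm (\<psi> t - 1)"
  proof -
    have "exp (- (t\<^sup>2 / 2)) *\<^sub>R (\<psi> t - 1) = \<phi> t - of_real (exp (- (t\<^sup>2 / 2)))"
    proof -
      have "complex_of_real (exp (- (t\<^sup>2 / 2))) * of_real (exp (t\<^sup>2 / 2)) = 1"
        by (simp only: of_real_mult[symmetric] exp_add[symmetric]) simp
      then show ?thesis
        by (simp only: \<psi>_def scaleR_conv_of_real right_diff_distrib mult.assoc[symmetric]) simp
    qed
    then show ?thesis by (metis norm_scaleR abs_exp_cancel)
  qed
  also have "\<dots> \<le> exp (- (t\<^sup>2 / 2)) * (exp (t\<^sup>2 / 2) * (\<epsilon> * (t\<^sup>2 + \<bar>t\<bar> ^ 3)))"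
    by (intro mult_left_mono 1) simp
  also have "\<dots> = \<epsilon> * (t\<^sup>2 + \<bar>t\<bar> ^ 3)"
    by (simp add: exp_minus)
  finally show ?thesis .
qed

lemma iexp_first_order: "cmod (iexp v - 1 - \<i> * v) \<le> v\<^sup>2 / 2"
  using iexp_approx1[of v 1] by (simp add: algebra_simps power2_eq_square numeral_2_eq_2)

text \<open>Square integrability gives the derivative directly from the quadratic bound for the remainder of
  the exponential.\<close>
lemma (in prob_space) char_has_derivative:
  fixes S :: "'a \<Rightarrow> real"
  assumes [measurable]: "S \<in> borel_measurable M" and int: "integrable M (\<lambda>x. (S x)\<^sup>2)"
  shows "((\<lambda>u. \<integral>x. iexp (u * S x) \<partial>M) has_vector_derivative
      (\<integral>x. \<i> * (S x * iexp (u * S x)) \<partial>M)) (at u)"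
proof -
  let ?D = "\<lambda>h. (\<integral>x. iexp ((u + h) * S x) \<partial>M) - (\<integral>x. iexp (u * S x) \<partial>M)
    - h *\<^sub>R (\<integral>x. \<i> * (S x * iexp (u * S x)) \<partial>M)"
  let ?d = "\<lambda>h x. iexp ((u + h) * S x) - iexp (u * S x) - h *\<^sub>R (\<i> * (S x * iexp (u * S x)))"
  have S1: "integrable M S"
    by (rule square_integrable_imp_integrable) (use int in simp_all)
  have iS: "integrable M (\<lambda>x. \<i> * (S x * iexp (u * S x)))"
    by (rule Bochner_Integration.integrable_bound[OF S1]) (auto simp: norm_mult)
  have ie: "integrable M (\<lambda>x. iexp (v * S x))" for v
    by (rule integrable_const_bound[of _ 1]) auto
  have step: "norm (?D h) \<le> h\<^sup>2 * (\<integral>x. (S x)\<^sup>2 / 2 \<partial>M)" for h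
  proof -
    have "?D h
      = (\<integral>x. ?d h x \<partial>M)"
      by (simp only: Bochner_Integration.integral_diff Bochner_Integration.integrable_diff ie iS
          integrable_scaleR_right integral_scaleR_right)
    also have "norm \<dots> \<le> (\<integral>x. h\<^sup>2 * ((S x)\<^sup>2 / 2) \<partial>M)"
    proof (rule norm_integral_le)
      fix x
      have "?d h x
          = iexp (u * S x) * (iexp (h * S x) - 1 - \<i> * of_real (h * S x))"
        by (simp add: algebra_simps exp_add scaleR_conv_of_real)
      then have "norm (?d h x)
          = cmod (iexp (h * S x) - 1 - \<i> * of_real (h * S x))"
        by (simp add: norm_mult)
      also have "\<dots> \<le> (h * S x)\<^sup>2 / 2" by (rule iexp_first_order)
      finally show "norm (?d h x)
          \<le> h\<^sup>2 * ((S x)\<^sup>2 / 2)" by (simp add: power_mult_distrib)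
      show "integrable M (\<lambda>x. ?d h x)"
        by (intro Bochner_Integration.integrable_diff integrable_scaleR_right ie iS)
    qed (use int in auto)
    finally show ?thesis by simp
  qed
  define K where "K = (\<integral>x. (S x)\<^sup>2 / 2 \<partial>M)"
  have K0: "K \<ge> 0" unfolding K_def by (intro integral_nonneg_AE) auto
  show ?thesis
    unfolding has_vector_derivative_def has_derivative_at
  proof (intro conjI bounded_linear_scaleR_left)
    show "(\<lambda>h. norm (?D h) / norm h) \<midarrow>0\<rightarrow> 0"
    proof (rule Lim_null_comparison)
      show "\<forall>\<^sub>F h in at 0. norm (norm (?D h) / norm h) \<le> \<bar>h\<bar> * K"
      proof (intro always_eventually allI)
        fix h :: real
        have "norm (?D h) / norm h \<le> (h\<^sup>2 * K) / \<bar>h\<bar>"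
          unfolding K_def real_norm_def by (intro divide_right_mono step abs_ge_zero)
        also have "\<dots> = \<bar>h\<bar> * K"
          by (cases "h = 0") (auto simp: power2_eq_square field_simps abs_if)
        finally show "norm (norm (?D h) / norm h) \<le> \<bar>h\<bar> * K" by simp
      qed
      show "((\<lambda>h. \<bar>h\<bar> * K) \<longlongrightarrow> 0) (at 0)"
        by (auto intro!: tendsto_eq_intros)
    qed
  qed
qed

lemma abs_le_amgm: "(\<epsilon>::real) > 0 \<Longrightarrow> \<bar>v\<bar> \<le> (\<epsilon> + v\<^sup>2 / \<epsilon>) / 2"
proof -
  assume e: "\<epsilon> > 0"
  have "2 * \<epsilon> * \<bar>v\<bar> \<le> \<epsilon>\<^sup>2 + \<bar>v\<bar>\<^sup>2" using sum_squares_bound[of \<epsilon> "\<bar>v\<bar>"] by simp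
  then show ?thesis using e by (simp add: field_simps power2_eq_square)
qed

context weighted_sample
begin

definition S_without :: "nat \<Rightarrow> (nat \<Rightarrow> 'x) \<Rightarrow> real" where
  "S_without k x = (\<Sum>l\<in>I - {k}. \<Sum>i\<in>I - {k}. a i l * H i l x) / 2"

lemma S_without_meas [measurable]: "S_without k \<in> borel_measurable P"
  unfolding S_without_def[abs_def] by measurable

lemma S_split:
  assumes "k \<in> I"
  shows "S x = S_without k x + T k x"
proof -
  let ?g = "\<lambda>i l. a i l * H i l x"
  have "(\<Sum>l\<in>I. \<Sum>i\<in>I. ?g i l) = (\<Sum>i\<in>I. ?g i k) + (\<Sum>l\<in>I - {k}. \<Sum>i\<in>I. ?g i l)"
    by (rule sum.remove[OF fin assms])
  also have "(\<Sum>l\<in>I - {k}. \<Sum>i\<in>I. ?g i l) = (\<Sum>l\<in>I - {k}. ?g k l) + (\<Sum>l\<in>I - {k}. \<Sum>i\<in>I - {k}. ?g i l)"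
    unfolding sum.remove[OF fin assms, of "\<lambda>i. ?g i _"] by (rule sum.distrib)
  also have "(\<Sum>l\<in>I - {k}. ?g k l) = (\<Sum>l\<in>I. ?g k l)"
    using assms fin by (simp add: sum.remove[of I k "?g k"])
  also have "\<dots> = T k x" unfolding T_def by (simp add: a_sym[of k] H_sym[of k])
  finally show ?thesis by (simp add: S_def S_without_def T_def[symmetric])
qed

lemma S_without_upd: "S_without k (x(k := y)) = S_without k x"
  unfolding S_without_def by (intro arg_cong2[where f = "(/)"] sum.cong refl) (simp add: H_upd)

lemma T_integral_zero:
  fixes R :: "(nat \<Rightarrow> 'x) \<Rightarrow> 'c::{banach, second_countable_topology}"
  assumes k: "k \<in> I" and int: "\<And>i. i \<in> I \<Longrightarrow> integrable P (\<lambda>x. H i k x *\<^sub>R R x)"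
    and R: "\<And>x y. R (x(k := y)) = R x"
  shows "(\<integral>x. T k x *\<^sub>R R x \<partial>P) = 0"
proof -
  have "(\<integral>x. T k x *\<^sub>R R x \<partial>P) = (\<Sum>i\<in>I. a i k *\<^sub>R (\<integral>x. H i k x *\<^sub>R R x \<partial>P))"
    unfolding T_def using int
    by (simp add: scaleR_sum_left Bochner_Integration.integral_sum flip: scaleR_scaleR)
  also have "\<dots> = 0"
    using degenerate_integral_zero[OF k _ _ R] int by (intro sum.neutral) (simp add: H_sym[of _ k])
  finally show ?thesis .
qed

lemma T_integrable: "k \<in> I \<Longrightarrow> integrable P (T k)"
  by (rule PP.square_integrable_imp_integrable[OF T_meas T_square(1)])

text \<open>The part \<open>T k\<close> is orthogonal to \<open>S_without k\<close>, hence the mean of \<open>T k * S\<close> is that of the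
  square of \<open>T k\<close>.\<close>
lemma S_square:
  assumes norm1: "(\<Sum>i\<in>I. \<Sum>k\<in>I. (a i k)\<^sup>2) * m2 = 2"
  shows "integrable P (\<lambda>x. (S x)\<^sup>2)" "(\<integral>x. (S x)\<^sup>2 \<partial>P) = 1"
proof -
  have HT: "integrable P (\<lambda>x. H i k x * T l x)" if "i \<in> I" "k \<in> I" "l \<in> I" for i k l
    unfolding T_def sum_distrib_left using prod2_integrable that
    by (auto simp: mult.left_commute)
  have HS: "integrable P (\<lambda>x. H i k x * S x)" if "i \<in> I" "k \<in> I" for i k
    unfolding S_def sum_distrib_left times_divide_eq_right using HT that by auto
  have TS: "integrable P (\<lambda>x. T k x * S x)" if "k \<in> I" for k
    unfolding T_def sum_distrib_right using HS that by (auto simp: mult.assoc)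
  have S2: "(S x)\<^sup>2 = (\<Sum>k\<in>I. T k x * S x) / 2" for x
  proof -
    have "(\<Sum>k\<in>I. T k x) = 2 * S x" by (simp add: S_def)
    then show ?thesis by (simp add: power2_eq_square flip: sum_distrib_right)
  qed
  show "integrable P (\<lambda>x. (S x)\<^sup>2)" unfolding S2 using TS by auto
  have E: "(\<integral>x. T k x * S x \<partial>P) = (\<Sum>i\<in>I. (a i k)\<^sup>2 * m2)" if k: "k \<in> I" for k
  proof -
    have w: "S_without k x = S x - T k x" for x using S_split[OF k, of x] by simp
    have "integrable P (\<lambda>x. H i k x * S_without k x)" if "i \<in> I" for i
      unfolding w right_diff_distrib using HS HT that k by auto
    then have "(\<integral>x. T k x * S_without k x \<partial>P) = 0"
      using T_integral_zero[OF k, of "S_without k"] by (simp add: S_without_upd)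
    moreover have "T k x * S_without k x = T k x * S x - (T k x)\<^sup>2" for x
      by (simp add: w power2_eq_square algebra_simps)
    ultimately show ?thesis using TS[OF k] T_square[OF k] by simp
  qed
  have "(\<integral>x. (S x)\<^sup>2 \<partial>P) = (\<Sum>k\<in>I. \<Sum>i\<in>I. (a i k)\<^sup>2 * m2) / 2"
    unfolding S2 using TS E by (simp add: Bochner_Integration.integral_sum)
  also have "(\<Sum>k\<in>I. \<Sum>i\<in>I. (a i k)\<^sup>2 * m2) = (\<Sum>i\<in>I. \<Sum>k\<in>I. (a i k)\<^sup>2) * m2"
    by (subst sum.swap) (simp add: sum_distrib_right)
  finally show "(\<integral>x. (S x)\<^sup>2 \<partial>P) = 1" by (simp add: norm1)
qed

text \<open>An approximate Stein equation for \<open>S\<close>. Since \<open>T k\<close> is centered given all other observations,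
  the mean of \<open>T k * exp (\<i> u S)\<close> does not change when \<open>exp (\<i> u (S - T k))\<close> is subtracted from the
  exponential. A first-order expansion in \<open>T k\<close> then leaves \<open>\<i> u (T k)\<^sup>2 exp (\<i> u S)\<close> and a cubic
  remainder.\<close>
lemma stein_identity:
  assumes norm1: "(\<Sum>i\<in>I. \<Sum>k\<in>I. (a i k)\<^sup>2) * m2 = 2"
    and T3: "\<And>k. k \<in> I \<Longrightarrow> integrable P (\<lambda>x. \<bar>T k x\<bar> ^ 3)"
  shows "norm ((\<integral>x. S x * iexp (u * S x) \<partial>P)
      - \<i> * of_real u * (\<integral>x. of_real (quad_var x) * iexp (u * S x) \<partial>P))
    \<le> u\<^sup>2 / 4 * (\<Sum>k\<in>I. \<integral>x. \<bar>T k x\<bar> ^ 3 \<partial>P)"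
proof -
  let ?e = "\<lambda>x. iexp (u * S x)" and ?w = "\<lambda>k x. iexp (u * S_without k x)"
  have unim: "integrable P (\<lambda>x. of_real (f x) * e x)"
    if "integrable P f" "e \<in> borel_measurable P" "\<And>x. norm (e x) = 1" for f :: "_ \<Rightarrow> real" and e :: "_ \<Rightarrow> complex"
    by (rule Bochner_Integration.integrable_bound[OF that(1)])
      (use that in \<open>auto simp: norm_mult\<close>)
  have i1: "integrable P (\<lambda>x. of_real (T k x) * ?e x)"
    and i2: "integrable P (\<lambda>x. of_real ((T k x)\<^sup>2) * ?e x)"
    and i3: "integrable P (\<lambda>x. of_real (T k x) * ?w k x)" if "k \<in> I" for k
    using T_integrable[OF that] T_square(1)[OF that] by (intro unim; simp)+
  have z: "(\<integral>x. of_real (T k x) * ?w k x \<partial>P) = 0" if k: "k \<in> I" for k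
  proof -
    have H1: "integrable P (H i k)" if "i \<in> I" for i
      by (rule PP.square_integrable_imp_integrable[OF H_meas[OF that k] H_square(1)[OF that k]])
    have "(\<integral>x. T k x *\<^sub>R ?w k x \<partial>P) = 0"
      by (rule T_integral_zero[OF k])
        (use H1 in \<open>auto simp: scaleR_conv_of_real S_without_upd intro!: unim\<close>)
    then show ?thesis by (simp add: scaleR_conv_of_real)
  qed
  have local: "norm ((\<integral>x. of_real (T k x) * ?e x \<partial>P) - \<i> * of_real u * (\<integral>x. of_real ((T k x)\<^sup>2) * ?e x \<partial>P))
      \<le> u\<^sup>2 / 2 * (\<integral>x. \<bar>T k x\<bar> ^ 3 \<partial>P)" if k: "k \<in> I" for k
  proof -
    let ?r = "\<lambda>x. of_real (T k x) * ?e x - of_real (T k x) * ?w k x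
      - \<i> * of_real u * (of_real ((T k x)\<^sup>2) * ?e x)"
    have eq: "(\<integral>x. of_real (T k x) * ?e x \<partial>P) - \<i> * of_real u * (\<integral>x. of_real ((T k x)\<^sup>2) * ?e x \<partial>P)
       = (\<integral>x. ?r x \<partial>P)"
      using i1[OF k] i2[OF k] i3[OF k] z[OF k] by simp
    have le: "norm (\<integral>x. ?r x \<partial>P) \<le> (\<integral>x. u\<^sup>2 / 2 * \<bar>T k x\<bar> ^ 3 \<partial>P)"
    proof (rule norm_integral_le)
      fix x
      have w: "?w k x = ?e x * iexp (- u * T k x)"
        using S_split[OF k, of x] by (simp add: algebra_simps flip: exp_add)
      have "?r x
          = - (of_real (T k x) * ?e x * (iexp (- u * T k x) - 1 - \<i> * of_real (- u * T k x)))"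
        unfolding w by (simp add: algebra_simps power2_eq_square)
      then have "norm (?r x)
          = \<bar>T k x\<bar> * cmod (iexp (- u * T k x) - 1 - \<i> * of_real (- u * T k x))"
        by (simp only: norm_minus_cancel norm_mult norm_of_real norm_exp_i_times mult_1_right)
      also have "\<dots> \<le> \<bar>T k x\<bar> * ((- u * T k x)\<^sup>2 / 2)"
        by (intro mult_left_mono iexp_first_order) simp
      also have "\<dots> = u\<^sup>2 / 2 * \<bar>T k x\<bar> ^ 3"
        by (cases "T k x \<ge> 0") (simp_all add: power2_eq_square power3_eq_cube)
      finally show "norm (?r x) \<le> u\<^sup>2 / 2 * \<bar>T k x\<bar> ^ 3" .
    qed (use i1[OF k] i2[OF k] i3[OF k] T3[OF k] in auto)
    show ?thesis unfolding eq by (rule order_trans[OF le]) (simp only: integral_mult_right_zero order_refl)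
  qed
  have "(\<integral>x. S x * ?e x \<partial>P) = (\<Sum>k\<in>I. \<integral>x. of_real (T k x) * ?e x \<partial>P) / 2"
  proof -
    have "S x * ?e x = (\<Sum>k\<in>I. of_real (T k x) * ?e x) / 2" for x
      unfolding sum_distrib_right[symmetric] by (simp add: S_def)
    then show ?thesis
      by (simp only: integral_divide_zero Bochner_Integration.integral_sum i1)
  qed
  moreover have "(\<integral>x. of_real (quad_var x) * ?e x \<partial>P)
      = (\<Sum>k\<in>I. \<integral>x. of_real ((T k x)\<^sup>2) * ?e x \<partial>P) / 2"
  proof -
    have "of_real (quad_var x) * ?e x = (\<Sum>k\<in>I. of_real ((T k x)\<^sup>2) * ?e x) / 2" for x
      unfolding sum_distrib_right[symmetric] by simp
    then show ?thesis
      by (simp only: integral_divide_zero Bochner_Integration.integral_sum i2)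
  qed
  ultimately have "(\<integral>x. S x * ?e x \<partial>P)
      - \<i> * of_real u * (\<integral>x. of_real (quad_var x) * ?e x \<partial>P)
      = (\<Sum>k\<in>I. (\<integral>x. of_real (T k x) * ?e x \<partial>P)
          - \<i> * of_real u * (\<integral>x. of_real ((T k x)\<^sup>2) * ?e x \<partial>P)) / 2"
    by (simp add: sum_subtractf sum_distrib_left diff_divide_distrib)
  also have "norm \<dots> \<le> (\<Sum>k\<in>I. u\<^sup>2 / 2 * (\<integral>x. \<bar>T k x\<bar> ^ 3 \<partial>P)) / 2"
    by (simp only: norm_divide) (intro divide_mono sum_norm_le local; simp add: sum_nonneg)
  also have "\<dots> = u\<^sup>2 / 4 * (\<Sum>k\<in>I. \<integral>x. \<bar>T k x\<bar> ^ 3 \<partial>P)"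
    by (simp only: sum_distrib_left[symmetric])
  finally show ?thesis .
qed

text \<open>In the Stein equation the squares of the parts, halved, may be replaced by \<open>1\<close>, and the third
  moments are interpolated between the second and the fourth. The result is the approximate
  differential equation of \<open>gaussian_char_ode\<close>.\<close>
lemma char_gaussian_bound:
  assumes "\<epsilon> > 0" and norm1: "(\<Sum>i\<in>I. \<Sum>k\<in>I. (a i k)\<^sup>2) * m2 = 2"
    and qv_int: "integrable P (\<lambda>x. (quad_var x - 1)\<^sup>2)"
    and qv: "(\<integral>x. (quad_var x - 1)\<^sup>2 \<partial>P) \<le> \<epsilon>\<^sup>2"
    and T4: "(\<Sum>k\<in>I. \<integral>x. T k x ^ 4 \<partial>P) \<le> \<epsilon>\<^sup>2"
  shows "norm ((\<integral>x. iexp (t * S x) \<partial>P) - of_real (exp (- (t\<^sup>2 / 2)))) \<le> \<epsilon> * (t\<^sup>2 + \<bar>t\<bar> ^ 3)"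
proof (rule gaussian_char_ode[where \<phi>' = "\<lambda>u. \<integral>x. \<i> * (S x * iexp (u * S x)) \<partial>P"])
  show "\<epsilon> \<ge> 0" using assms by simp
  show "(\<integral>x. iexp (0 * S x) \<partial>P) = 1" by simp
  show "((\<lambda>u. \<integral>x. iexp (u * S x) \<partial>P) has_vector_derivative (\<integral>x. \<i> * (S x * iexp (u * S x)) \<partial>P)) (at u)" for u
    by (rule prob_space.char_has_derivative[OF prob_space_PiM[OF prob_space_axioms]])
      (use S_square[OF norm1] in simp_all)
  fix u :: real
  \<comment> \<open>Interpolation with weight \<open>\<epsilon>\<close>, to match the bounds for the second and fourth moments.\<close>
  have cube_le: "\<bar>v\<bar> ^ 3 \<le> (\<epsilon> * v\<^sup>2 + v ^ 4 / \<epsilon>) / 2" for v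
  proof -
    have "\<bar>v\<bar> * v\<^sup>2 \<le> (\<epsilon> + v\<^sup>2 / \<epsilon>) / 2 * v\<^sup>2"
      by (intro mult_right_mono abs_le_amgm assms) simp
    also have "\<dots> = (\<epsilon> * v\<^sup>2 + v ^ 4 / \<epsilon>) / 2"
      by (simp add: power2_eq_square power4_eq_xxxx field_simps)
    finally show ?thesis by (simp add: power3_eq_cube power2_eq_square abs_mult_self_eq mult.assoc)
  qed
  have i3: "integrable P (\<lambda>x. (\<epsilon> * (T k x)\<^sup>2 + T k x ^ 4 / \<epsilon>) / 2)" if "k \<in> I" for k
    using T_square(1)[OF that] T_fourth_moment(1)[OF that] by simp
  have T3: "integrable P (\<lambda>x. \<bar>T k x\<bar> ^ 3)" if "k \<in> I" for k
  proof (rule Bochner_Integration.integrable_bound[OF i3[OF that]])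
    show "AE x in P. norm (\<bar>T k x\<bar> ^ 3) \<le> norm ((\<epsilon> * (T k x)\<^sup>2 + T k x ^ 4 / \<epsilon>) / 2)"
      by (intro AE_I2) (metis abs_ge_self cube_le order_trans power_abs abs_abs real_norm_def)
  qed (use that in measurable)
  have "(\<Sum>k\<in>I. \<integral>x. \<bar>T k x\<bar> ^ 3 \<partial>P) \<le> (\<Sum>k\<in>I. \<integral>x. (\<epsilon> * (T k x)\<^sup>2 + T k x ^ 4 / \<epsilon>) / 2 \<partial>P)"
    by (intro sum_mono integral_mono T3 i3 cube_le)
  also have "\<dots> = (\<epsilon> * (\<Sum>k\<in>I. \<integral>x. (T k x)\<^sup>2 \<partial>P) + (\<Sum>k\<in>I. \<integral>x. T k x ^ 4 \<partial>P) / \<epsilon>) / 2"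
    using T_square(1) T_fourth_moment(1)
    by (simp add: sum.distrib sum_distrib_left flip: sum_divide_distrib)
  also have "(\<Sum>k\<in>I. \<integral>x. (T k x)\<^sup>2 \<partial>P) = 2"
  proof -
    have "(\<Sum>k\<in>I. \<integral>x. (T k x)\<^sup>2 \<partial>P) = (\<Sum>k\<in>I. \<Sum>i\<in>I. (a i k)\<^sup>2 * m2)"
      by (intro sum.cong refl T_square)
    also have "\<dots> = (\<Sum>i\<in>I. \<Sum>k\<in>I. (a i k)\<^sup>2) * m2"
      by (subst sum.swap) (simp add: sum_distrib_right)
    finally show ?thesis by (simp add: norm1)
  qed
  also have "(\<epsilon> * 2 + (\<Sum>k\<in>I. \<integral>x. T k x ^ 4 \<partial>P) / \<epsilon>) / 2 \<le> (\<epsilon> * 2 + \<epsilon>) / 2"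
    using T4 assms(1) by (simp add: field_simps power2_eq_square)
  finally have third: "(\<Sum>k\<in>I. \<integral>x. \<bar>T k x\<bar> ^ 3 \<partial>P) \<le> 2 * \<epsilon>" using assms(1) by simp
  have V1: "integrable P (\<lambda>x. quad_var x - 1)" using T_square(1) by simp
  have "(\<integral>x. \<bar>quad_var x - 1\<bar> \<partial>P) \<le> (\<integral>x. (\<epsilon> + (quad_var x - 1)\<^sup>2 / \<epsilon>) / 2 \<partial>P)"
    using V1 qv_int by (intro integral_mono abs_le_amgm assms(1)) auto
  also have "\<dots> = (\<epsilon> + (\<integral>x. (quad_var x - 1)\<^sup>2 \<partial>P) / \<epsilon>) / 2" using qv_int by simp
  also have "\<dots> \<le> \<epsilon>" using qv assms(1) by (simp add: field_simps power2_eq_square)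
  finally have V: "(\<integral>x. \<bar>quad_var x - 1\<bar> \<partial>P) \<le> \<epsilon>" .
  have iV: "integrable P (\<lambda>x. of_real (quad_var x - 1) * iexp (u * S x))"
  proof (rule Bochner_Integration.integrable_bound[OF V1])
    show "AE x in P. norm (of_real (quad_var x - 1) * iexp (u * S x)) \<le> norm (quad_var x - 1)"
      by (intro AE_I2) (simp only: norm_mult norm_of_real norm_exp_i_times mult_1_right real_norm_def order_refl)
  qed measurable
  have ie: "integrable P (\<lambda>x. iexp (u * S x))"
    by (rule PP.integrable_const_bound[of _ 1]) auto
  have "of_real (quad_var x) * iexp (u * S x) = of_real (quad_var x - 1) * iexp (u * S x) + iexp (u * S x)" for x
    by (simp add: algebra_simps)
  then have VD: "(\<integral>x. of_real (quad_var x) * iexp (u * S x) \<partial>P)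
      = (\<integral>x. of_real (quad_var x - 1) * iexp (u * S x) \<partial>P) + (\<integral>x. iexp (u * S x) \<partial>P)"
    using Bochner_Integration.integral_add[OF iV ie] by presburger
  \<comment> \<open>Splits off the deviation of half the sum of squares from \<open>1\<close>.\<close>
  have alg: "\<i> * A + w * B = \<i> * (A - \<i> * w * (D + B)) - w * D" for A B D w :: complex
    by (simp add: algebra_simps)
  have "norm (\<integral>x. of_real (quad_var x - 1) * iexp (u * S x) \<partial>P) \<le> (\<integral>x. \<bar>quad_var x - 1\<bar> \<partial>P)"
    using V1 by (intro norm_integral_le iV integrable_abs)
      (simp_all only: norm_mult norm_of_real norm_exp_i_times mult_1_right real_norm_def order_refl)
  then have n1: "norm (of_real u * (\<integral>x. of_real (quad_var x - 1) * iexp (u * S x) \<partial>P)) \<le> \<bar>u\<bar> * \<epsilon>"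
    unfolding norm_mult norm_of_real using V by (intro mult_left_mono) auto
  have n2: "norm (\<i> * ((\<integral>x. S x * iexp (u * S x) \<partial>P)
      - \<i> * of_real u * (\<integral>x. of_real (quad_var x) * iexp (u * S x) \<partial>P))) \<le> u\<^sup>2 / 4 * (2 * \<epsilon>)"
    unfolding norm_mult norm_ii mult_1_left
    by (rule order_trans[OF stein_identity[OF norm1 T3] mult_left_mono[OF third]]) simp_all
  have "norm ((\<integral>x. \<i> * (S x * iexp (u * S x)) \<partial>P) + of_real u * (\<integral>x. iexp (u * S x) \<partial>P))
      \<le> u\<^sup>2 / 4 * (2 * \<epsilon>) + \<bar>u\<bar> * \<epsilon>"
    unfolding integral_mult_right_zero
      alg[of _ _ _ "\<integral>x. of_real (quad_var x - 1) * iexp (u * S x) \<partial>P"] VD[symmetric]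
    by (rule order_trans[OF norm_triangle_ineq4 add_mono[OF n2 n1]])
  also have "\<dots> \<le> \<epsilon> * (\<bar>u\<bar> + u\<^sup>2)"
    using assms(1) by (simp add: algebra_simps)
  finally show "norm ((\<integral>x. \<i> * (S x * iexp (u * S x)) \<partial>P) + of_real u * (\<integral>x. iexp (u * S x) \<partial>P))
      \<le> \<epsilon> * (\<bar>u\<bar> + u\<^sup>2)" .
qed

end

section \<open>U-centering and studentization\<close>

text \<open>The U-centering of a distance matrix, in the form used by the variance estimator.\<close>
definition ucentered :: "nat \<Rightarrow> (nat \<Rightarrow> nat \<Rightarrow> real) \<Rightarrow> nat \<Rightarrow> nat \<Rightarrow> real" where
  "ucentered n D k l = D k l - (\<Sum>i<n. D i l) / (real n - 2) - (\<Sum>j<n. D k j) / (real n - 2)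
     + (\<Sum>i<n. \<Sum>j<n. D i j) / ((real n - 1) * (real n - 2))"

text \<open>U-centering annihilates matrices that are additive off the diagonal and zero on it. The distances
  may therefore be replaced by the doubly centered distances.\<close>
lemma ucentered_additive:
  assumes n: "n \<ge> 3" and kl: "k < n" "l < n" "k \<noteq> l"
    and D: "\<And>i j. D i j = (if i = j then 0 else E i j + g i + g j)" and E: "\<And>i. E i i = 0"
  shows "ucentered n D k l = ucentered n E k l"
proof -
  define G where "G = (\<Sum>i<n. g i)"
  have D': "D i j = E i j + (g i + g j) - (if i = j then 2 * g j else 0)" for i j
    using D[of i j] E by auto
  have col: "(\<Sum>i<n. D i j) = (\<Sum>i<n. E i j) + G + (real n - 2) * g j" if "j < n" for j
    using that unfolding D' by (simp add: sum.distrib sum_subtractf G_def algebra_simps)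
  have row: "(\<Sum>j<n. D i j) = (\<Sum>j<n. E i j) + G + (real n - 2) * g i" if "i < n" for i
  proof -
    have "(\<Sum>j<n. if i = j then 2 * g j else 0) = 2 * g i" using that by simp
    then show ?thesis unfolding D' by (simp add: sum.distrib sum_subtractf G_def algebra_simps)
  qed
  have "(\<Sum>i<n. \<Sum>j<n. D i j) = (\<Sum>i<n. (\<Sum>j<n. E i j) + G + (real n - 2) * g i)"
    by (intro sum.cong refl row) simp
  also have "\<dots> = (\<Sum>i<n. \<Sum>j<n. E i j) + 2 * (real n - 1) * G"
    unfolding sum.distrib sum_distrib_left[symmetric] G_def[symmetric] by (simp add: algebra_simps)
  finally have tot: "(\<Sum>i<n. \<Sum>j<n. D i j) = (\<Sum>i<n. \<Sum>j<n. E i j) + 2 * (real n - 1) * G" .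
  have n0: "real n - 2 \<noteq> 0" "real n - 1 \<noteq> 0" using n by auto
  have "2 * u * G / (u * w) = 2 * (G / w)" if "u \<noteq> 0" for u w :: real
    using that by simp
  from this[OF n0(2)] have q: "(2 * (real n - 1) * G) / ((real n - 1) * (real n - 2)) = 2 * (G / (real n - 2))"
    "((real n - 2) * v) / (real n - 2) = v" for v
    using n0(1) by simp_all
  show ?thesis
    unfolding ucentered_def tot col[OF kl(2)] row[OF kl(1)] add_divide_distrib q
    using kl D[of k l] by simp
qed

text \<open>U-centering is the orthogonal projection along the additive matrices, because all rows of a
  centered matrix sum to zero. Its squared norm is that of the matrix minus the squared norm of
  the removed part, which is expressed by the row sums.\<close>
lemma ucentered_norm:
  assumes n: "n \<ge> 3" and sym: "\<And>i j. E i j = E j i" and E: "\<And>i. E i i = 0"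
  shows "(\<Sum>k<n. \<Sum>l\<in>{..<n} - {k}. (ucentered n E k l)\<^sup>2)
    = (\<Sum>k<n. \<Sum>l<n. (E k l)\<^sup>2) - 2 / (real n - 2) * (\<Sum>k<n. (\<Sum>i<n. E i k)\<^sup>2)
      + (\<Sum>k<n. \<Sum>i<n. E i k)\<^sup>2 / ((real n - 1) * (real n - 2))"
proof -
  define R where "R k = (\<Sum>i<n. E i k)" for k
  define W where "W = (\<Sum>k<n. R k)"
  define r where "r k = R k / (real n - 2)" for k
  define c where "c = W / ((real n - 1) * (real n - 2))"
  define A where "A k l = E k l - r l - r k + c" for k l
  let ?J = "\<lambda>k. {..<n} - {k}"
  have n0: "real n - 2 \<noteq> 0" "real n - 1 \<noteq> 0" using n by auto
  have R': "(\<Sum>j<n. E k j) = R k" for k unfolding R_def by (simp add: sym[of k])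
  have W': "(\<Sum>i<n. \<Sum>j<n. E i j) = W" unfolding W_def R' ..
  have uA: "ucentered n E k l = A k l" for k l
    by (simp only: ucentered_def A_def r_def c_def R' R_def[symmetric] W_def)
  have Asym: "A k l = A l k" for k l unfolding A_def by (simp add: sym[of k])
  have off: "(\<Sum>l\<in>?J k. f l) = (\<Sum>l<n. f l) - f k" if "k < n" for k and f :: "nat \<Rightarrow> real"
    using that by (simp add: sum_diff1)
  have row0: "(\<Sum>l\<in>?J k. A k l) = 0" if k: "k < n" for k
  proof -
    have "(\<Sum>l<n. r l) = W / (real n - 2)" unfolding r_def W_def by (simp add: sum_divide_distrib)
    then have "(\<Sum>l\<in>?J k. A k l) = R k - W / (real n - 2) - (real n - 2) * r k + (real n - 1) * c"
      unfolding off[OF k] A_def by (simp add: sum.distrib sum_subtractf R' E algebra_simps)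
    also have "\<dots> = 0" using n0 by (simp add: r_def c_def)
    finally show ?thesis .
  qed
  have swap: "(\<Sum>k<n. \<Sum>l\<in>?J k. f k l) = (\<Sum>l<n. \<Sum>k\<in>?J l. f k l)" for f :: "nat \<Rightarrow> nat \<Rightarrow> real"
  proof -
    have "(\<Sum>k<n. \<Sum>l\<in>?J k. f k l) = (\<Sum>k<n. \<Sum>l<n. if l = k then 0 else f k l)"
      by (intro sum.cong refl sum.mono_neutral_cong_left) auto
    also have "\<dots> = (\<Sum>l<n. \<Sum>k<n. if l = k then 0 else f k l)" by (rule sum.swap)
    also have "\<dots> = (\<Sum>l<n. \<Sum>k\<in>?J l. f k l)"
      by (intro sum.cong refl sum.mono_neutral_cong_right) auto
    finally show ?thesis .
  qed
  have Ar: "(\<Sum>k<n. \<Sum>l\<in>?J k. A k l * r k) = 0"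
    unfolding sum_distrib_right[symmetric] by (intro sum.neutral ballI) (simp only: row0 lessThan_iff mult_zero_left)
  have Ac: "(\<Sum>k<n. \<Sum>l\<in>?J k. A k l * c) = 0"
    unfolding sum_distrib_right[symmetric] by (simp add: row0)
  have Al: "(\<Sum>k<n. \<Sum>l\<in>?J k. A k l * r l) = 0"
    by (subst swap, subst Asym) (rule Ar)
  have AA: "(A k l)\<^sup>2 = A k l * E k l - A k l * r l - A k l * r k + A k l * c" for k l
    by (simp add: A_def power2_eq_square algebra_simps)
  have AE: "A k l * E k l = (E k l)\<^sup>2 - r l * E k l - r k * E k l + c * E k l" for k l
    by (simp add: A_def power2_eq_square algebra_simps)
  have "(\<Sum>k<n. \<Sum>l\<in>?J k. (A k l)\<^sup>2) = (\<Sum>k<n. \<Sum>l\<in>?J k. A k l * E k l)"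
    unfolding AA sum.distrib sum_subtractf Ar Ac Al by simp
  also have "\<dots> = (\<Sum>k<n. \<Sum>l<n. A k l * E k l)"
  proof (rule sum.cong[OF refl])
    fix k assume "k \<in> {..<n}"
    then show "(\<Sum>l\<in>?J k. A k l * E k l) = (\<Sum>l<n. A k l * E k l)"
      using off[of k "\<lambda>l. A k l * E k l"] by (simp only: E lessThan_iff mult_zero_right diff_zero)
  qed
  also have "\<dots> = (\<Sum>k<n. \<Sum>l<n. (E k l)\<^sup>2) - (\<Sum>k<n. \<Sum>l<n. r l * E k l)
      - (\<Sum>k<n. \<Sum>l<n. r k * E k l) + (\<Sum>k<n. \<Sum>l<n. c * E k l)"
    unfolding AE by (simp only: sum.distrib sum_subtractf)
  also have "(\<Sum>k<n. \<Sum>l<n. r k * E k l) = (\<Sum>k<n. r k * R k)"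
    by (simp only: sum_distrib_left[symmetric] R')
  also have "(\<Sum>k<n. \<Sum>l<n. r l * E k l) = (\<Sum>k<n. r k * R k)"
    by (subst sum.swap) (simp only: sum_distrib_left[symmetric] R_def)
  also have "(\<Sum>k<n. \<Sum>l<n. c * E k l) = c * W"
    by (simp only: sum_distrib_left[symmetric] W')
  also have "(\<Sum>k<n. r k * R k) = (\<Sum>k<n. (R k)\<^sup>2) / (real n - 2)"
    unfolding r_def by (simp add: sum_divide_distrib power2_eq_square)
  finally show ?thesis
    unfolding uA by (simp add: R_def W_def c_def power2_eq_square)
qed

lemma iexp_lipschitz: "cmod (iexp a - iexp b) \<le> \<bar>a - b\<bar>"
proof -
  have "iexp a - iexp b = iexp b * (iexp (a - b) - 1)"
    by (simp add: algebra_simps flip: exp_add)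
  then have "cmod (iexp a - iexp b) = cmod (iexp (a - b) - 1)" by (simp add: norm_mult)
  then show ?thesis using iexp_approx1[of "a - b" 0] by simp
qed

lemma inverse_sqrt_near_one:
  fixes v \<delta> :: real
  assumes "\<bar>v - 1\<bar> \<le> \<delta>" "\<delta> \<le> 1 / 2"
  shows "\<bar>1 / sqrt v - 1\<bar> \<le> \<delta>"
proof -
  define s where "s = sqrt v"
  have v: "v \<ge> 1 / 2" using assms by auto
  then have s2: "s\<^sup>2 = v" "s \<ge> 0" by (auto simp: s_def)
  have "s \<ge> 1 / 2"
  proof (rule ccontr)
    assume "\<not> s \<ge> 1 / 2"
    then have "s\<^sup>2 < (1 / 2)\<^sup>2" using s2 by (intro power_strict_mono) auto
    then show False using s2 v by (simp add: power2_eq_square)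
  qed
  then have s: "s > 0" "s * (1 + s) \<ge> 1"
    using s2 v by (auto simp: power2_eq_square algebra_simps)
  have "1 / s - 1 = (1 - v) / (s * (1 + s))"
    using s by (simp add: field_simps power2_eq_square flip: s2(1))
  then have "\<bar>1 / s - 1\<bar> = \<bar>1 - v\<bar> / (s * (1 + s))" using s by (simp add: abs_mult)
  also have "\<dots> \<le> \<bar>1 - v\<bar> / 1" using s by (intro divide_left_mono) auto
  finally show ?thesis using assms by (simp add: s_def)
qed

text \<open>The two alternatives are a random variance \<open>v\<close> close to \<open>1\<close>, where the exponential is Lipschitz,
  and a distant one, where the trivial bound \<open>2\<close> is at most a multiple of \<open>\<bar>v - 1\<bar>\<close>.\<close>
lemma studentize_pointwise:
  fixes s v t \<delta> :: real
  assumes "0 < \<delta>" "\<delta> \<le> 1 / 2"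
  shows "cmod (iexp (t * (s / sqrt v)) - iexp (t * s)) \<le> \<bar>t\<bar> * \<bar>s\<bar> * \<delta> + 2 / \<delta> * \<bar>v - 1\<bar>"
proof (cases "\<bar>v - 1\<bar> \<le> \<delta>")
  case True
  have "cmod (iexp (t * (s / sqrt v)) - iexp (t * s)) \<le> \<bar>t * (s / sqrt v) - t * s\<bar>"
    by (rule iexp_lipschitz)
  also have "t * (s / sqrt v) - t * s = t * s * (1 / sqrt v - 1)" by (simp add: algebra_simps)
  also have "\<bar>\<dots>\<bar> \<le> \<bar>t\<bar> * \<bar>s\<bar> * \<delta>"
    unfolding abs_mult by (intro mult_left_mono inverse_sqrt_near_one True assms) auto
  finally show ?thesis using assms by (simp add: add_increasing2)
next
  case False
  have "cmod (iexp (t * (s / sqrt v)) - iexp (t * s)) \<le> 1 + 1"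
    by (intro order_trans[OF norm_triangle_ineq4] add_mono) (simp_all only: norm_exp_i_times order_refl)
  also have "\<dots> \<le> 2 / \<delta> * \<bar>v - 1\<bar>" using False assms by (simp add: field_simps)
  finally show ?thesis using assms by (simp add: add_increasing)
qed

context kernel_sample
begin

definition U_var :: "nat \<Rightarrow> (nat \<Rightarrow> 'x) \<Rightarrow> real" where
  "U_var n x = (\<Sum>k<n. \<Sum>l\<in>{..<n} - {k}. (ucentered n (\<lambda>i j. H i j x) k l)\<^sup>2) / (real n * (real n - 3))"

lemma U_var_meas [measurable]: "I = {..<n} \<Longrightarrow> U_var n \<in> borel_measurable P"
  unfolding U_var_def[abs_def] ucentered_def by measurable

text \<open>Consistency of the variance estimator. By \<open>ucentered_norm\<close> the leading term is the average of the
  squared kernels, whose variance is of order \<open>m4 / n\<close>; the corrections are governed by the row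
  sums and are of relative order \<open>1 / n\<close> in mean.\<close>
lemma U_var_ratio:
  assumes I: "I = {..<n}" and n: "n \<ge> 4" and m2: "m2 > 0" and \<eta>: "\<eta> > 0"
    and q: "64 * (m4 / (real n * m2\<^sup>2)) \<le> \<eta>\<^sup>2" and n\<eta>: "40 / real n \<le> \<eta>"
  shows "integrable P (\<lambda>x. \<bar>U_var n x / m2 - 1\<bar>)" "(\<integral>x. \<bar>U_var n x / m2 - 1\<bar> \<partial>P) \<le> 2 * \<eta>"
proof -
  let ?n = "real n"
  \<comment> \<open>With unit weights the parts \<open>W.T k\<close> are the row sums of the kernel matrix.\<close>
  interpret W: weighted_sample F h I "\<lambda>i k. of_bool (i \<noteq> k)" 1
    by unfold_locales auto
  have cI: "card I = n" by (simp add: I)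
  have WT: "W.T k x = (\<Sum>i\<in>I. H i k x)" for k x
    unfolding W.T_def by (intro sum.cong refl) (simp add: H_def)
  let ?Q = "\<lambda>x. \<Sum>i\<in>I. \<Sum>k\<in>I. of_bool (i \<noteq> k) * ((H i k x)\<^sup>2 - m2)"
  let ?R = "\<lambda>x. \<Sum>k\<in>I. (W.T k x)\<^sup>2"
  have Q: "integrable P (\<lambda>x. (?Q x)\<^sup>2)" "(\<integral>x. (?Q x)\<^sup>2 \<partial>P) \<le> 4 * ?n ^ 3 * m4"
    using square_sum_variance[of "\<lambda>i k. of_bool (i \<noteq> k)" 1] by (simp_all add: cI)
  have R: "integrable P ?R" using W.T_square(1) by simp
  have ER: "(\<integral>x. ?R x \<partial>P) = ?n * (?n - 1) * m2"
  proof -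
    have "(\<integral>x. ?R x \<partial>P) = (\<Sum>k\<in>I. \<Sum>i\<in>I. (of_bool (i \<noteq> k))\<^sup>2 * m2)"
      using W.T_square by simp
    also have "\<dots> = (\<Sum>k\<in>I. \<Sum>i\<in>I - {k}. m2)"
      using fin by (intro sum.cong refl sum.mono_neutral_cong_right) auto
    also have "\<dots> = (\<Sum>k\<in>I. (?n - 1) * m2)"
      using n by (intro sum.cong refl) (simp add: card_Diff_singleton cI of_nat_diff)
    finally show ?thesis by (simp add: cI)
  qed
  define C where "C = ?n * (?n - 3) * m2"
  have n3: "?n - 3 \<ge> ?n / 4" "?n \<ge> 4" using n by auto
  have C0: "C > 0" unfolding C_def using n3 m2 by simp
  have CL: "C \<ge> ?n * (?n / 4) * m2" unfolding C_def using n3 m2 by (intro mult_right_mono mult_left_mono) auto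
  have main: "\<bar>U_var n x / m2 - 1\<bar> \<le> \<bar>?Q x / C\<bar> + 8 / ?n + 4 / (?n - 2) * ?R x / C" for x
  proof -
    let ?Z = "(\<Sum>k<n. \<Sum>i<n. H i k x)\<^sup>2"
    have Q': "?Q x = (\<Sum>k<n. \<Sum>l<n. (H k l x)\<^sup>2) - ?n * (?n - 1) * m2"
    proof -
      have "(\<Sum>k<n. \<Sum>l<n. of_bool (k \<noteq> l) * m2) = (\<Sum>k<n. \<Sum>l\<in>{..<n} - {k}. m2)"
        by (intro sum.cong refl sum.mono_neutral_cong_right) auto
      also have "\<dots> = (\<Sum>k<n. (?n - 1) * m2)"
        using n by (intro sum.cong refl) (simp add: of_nat_diff)
      finally have "(\<Sum>k<n. \<Sum>l<n. of_bool (k \<noteq> l) * m2) = ?n * (?n - 1) * m2" by simp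
      moreover have "of_bool (k \<noteq> l) * ((H k l x)\<^sup>2 - m2) = (H k l x)\<^sup>2 - of_bool (k \<noteq> l) * m2" for k l
        by (simp add: H_def)
      ultimately show ?thesis unfolding I by (simp only: sum_subtractf)
    qed
    have R': "?R x = (\<Sum>k<n. (\<Sum>i<n. H i k x)\<^sup>2)" unfolding WT unfolding I ..
    have Z: "0 \<le> ?Z" "?Z \<le> ?n * ?R x"
      using sum_squared_le_sum_of_squares[of "\<lambda>k. \<Sum>i<n. H i k x" "{..<n}"]
      by (simp_all add: R' mult.commute)
    have R0: "0 \<le> ?R x" by (intro sum_nonneg) simp
    have "U_var n x / m2 = (?Q x + ?n * (?n - 1) * m2 - 2 / (?n - 2) * ?R x + ?Z / ((?n - 1) * (?n - 2))) / C"
      unfolding U_var_def C_def Q' R'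
      using n by (subst ucentered_norm) (auto simp: H_sym)
    moreover have "?n * (?n - 1) * m2 / C = 1 + 2 / (?n - 3)"
      unfolding C_def using n3 m2 by (simp add: field_simps)
    ultimately have "U_var n x / m2 - 1 = ?Q x / C + 2 / (?n - 3)
        + (?Z / ((?n - 1) * (?n - 2)) - 2 / (?n - 2) * ?R x) / C"
      by (simp add: add_divide_distrib diff_divide_distrib)
    moreover have "\<bar>(?Z / ((?n - 1) * (?n - 2)) - 2 / (?n - 2) * ?R x) / C\<bar> \<le> 4 / (?n - 2) * ?R x / C"
    proof -
      have "?Z / ((?n - 1) * (?n - 2)) \<le> (?n * ?R x) / ((?n - 1) * (?n - 2))"
        using Z n3 by (intro divide_right_mono) auto
      also have "\<dots> = ?n / (?n - 1) * (?R x / (?n - 2))" by simp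
      also have "\<dots> \<le> 2 * (?R x / (?n - 2))"
        using n3 R0 by (intro mult_right_mono) (auto simp: field_simps)
      finally have z: "?Z / ((?n - 1) * (?n - 2)) \<le> 2 * (?R x / (?n - 2))" .
      have z0: "0 \<le> ?Z / ((?n - 1) * (?n - 2))" "0 \<le> ?R x / (?n - 2)"
        using n3 R0 Z by auto
      have "\<bar>?Z / ((?n - 1) * (?n - 2)) - 2 / (?n - 2) * ?R x\<bar> \<le> 4 / (?n - 2) * ?R x"
        using z z0 by (simp add: abs_le_iff)
      then show ?thesis
        unfolding abs_divide abs_of_pos[OF C0] by (rule divide_right_mono) (use C0 in simp)
    qed
    moreover have "0 \<le> 2 / (?n - 3)" "2 / (?n - 3) \<le> 8 / ?n" using n3 by (auto simp: field_simps)
    ultimately show ?thesis by linarith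
  qed
  let ?B = "\<lambda>x. (\<eta> + (?Q x / C)\<^sup>2 / \<eta>) / 2 + 8 / ?n + 4 / (?n - 2) * ?R x / C"
  have iQ: "integrable P (\<lambda>x. (\<eta> + (?Q x / C)\<^sup>2 / \<eta>) / 2)"
    using Q(1) by (simp add: power_divide)
  have iB: "integrable P (\<lambda>x. ?B x)"
    using iQ R by simp
  have le: "\<bar>U_var n x / m2 - 1\<bar> \<le> ?B x" for x
    using main[of x] abs_le_amgm[OF \<eta>, of "?Q x / C"] by linarith
  show int: "integrable P (\<lambda>x. \<bar>U_var n x / m2 - 1\<bar>)"
  proof (rule Bochner_Integration.integrable_bound[OF iB])
    show "AE x in P. norm \<bar>U_var n x / m2 - 1\<bar>
        \<le> norm (?B x)"
      by (intro AE_I2) (simp only: real_norm_def abs_abs order_trans[OF le abs_ge_self])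
    show "(\<lambda>x. \<bar>U_var n x / m2 - 1\<bar>) \<in> borel_measurable P" using U_var_meas[OF I] by measurable
  qed
  have "(\<integral>x. \<bar>U_var n x / m2 - 1\<bar> \<partial>P)
      \<le> (\<integral>x. ?B x \<partial>P)"
    by (intro integral_mono int iB le)
  also have "\<dots> = (\<eta> + ((\<integral>x. (?Q x)\<^sup>2 \<partial>P) / C\<^sup>2) / \<eta>) / 2 + 8 / ?n + 4 / (?n - 2) * (?n * (?n - 1) * m2) / C"
  proof -
    have "(\<integral>x. (\<eta> + (?Q x / C)\<^sup>2 / \<eta>) / 2 \<partial>P) = (\<eta> + ((\<integral>x. (?Q x)\<^sup>2 \<partial>P) / C\<^sup>2) / \<eta>) / 2"
      using Q(1) by (simp add: power_divide)
    then show ?thesis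
      using iQ R ER by (simp del: integral_divide_zero)
  qed
  also have "\<dots> \<le> (\<eta> + \<eta>\<^sup>2 / \<eta>) / 2 + 8 / ?n + 32 / ?n"
  proof -
    have "(\<integral>x. (?Q x)\<^sup>2 \<partial>P) / C\<^sup>2 \<le> (4 * ?n ^ 3 * m4) / (?n * (?n / 4) * m2)\<^sup>2"
      using Q(2) CL m2 n3 m4_nonneg by (intro frac_le power_mono) auto
    also have "\<dots> = 64 * (m4 / (?n * m2\<^sup>2))"
      using n3 m2 by (simp add: field_simps power2_eq_square power3_eq_cube)
    finally have 1: "(\<integral>x. (?Q x)\<^sup>2 \<partial>P) / C\<^sup>2 \<le> \<eta>\<^sup>2" using q by linarith
    have "4 / (?n - 2) * (?n * (?n - 1) * m2) / C = 4 * ((?n - 1) / (?n - 2)) / (?n - 3)"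
    proof -
      have "4 / x * (?n * y * m2) / (?n * z * m2) = 4 * (y / x) / z" for x y z
        using n3 m2 by simp
      then show ?thesis unfolding C_def .
    qed
    also have "\<dots> \<le> 4 * 2 / (?n / 4)"
      using n3 by (intro frac_le mult_left_mono) (auto simp: field_simps)
    finally have 2: "4 / (?n - 2) * (?n * (?n - 1) * m2) / C \<le> 32 / ?n" by simp
    show ?thesis
      by (intro add_mono divide_right_mono 1 2 order_refl) (use \<eta> in auto)
  qed
  also have "\<dots> \<le> 2 * \<eta>" using n\<eta> \<eta> by (simp add: power2_eq_square)
  finally show "(\<integral>x. \<bar>U_var n x / m2 - 1\<bar> \<partial>P) \<le> 2 * \<eta>" .
qed

end

context weighted_sample
begin

text \<open>The conclusion for fixed weights. The bound depends on the weights only through \<open>c\<close>, so that it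
  is uniform in the class labels from which the weights will be computed.\<close>
lemma studentized_char_bound:
  assumes I: "I = {..<n}" and n: "n \<ge> 4" and m2: "m2 > 0"
    and norm1: "(\<Sum>i\<in>I. \<Sum>k\<in>I. (a i k)\<^sup>2) * m2 = 2"
    and b: "b = c / (real n * sqrt m2)"
    and pos: "\<epsilon> > 0" "\<eta> > 0" "\<delta> > 0" "\<delta> \<le> 1 / 2"
    and \<epsilon>: "c ^ 4 * (16 * (m4 / (real n * m2\<^sup>2)) + \<bar>cyc\<bar> / m2\<^sup>2) \<le> \<epsilon>\<^sup>2"
    and \<eta>: "64 * (m4 / (real n * m2\<^sup>2)) \<le> \<eta>\<^sup>2" and n\<eta>: "40 / real n \<le> \<eta>"
  shows "cmod ((\<integral>x. iexp (t * (S x / sqrt (U_var n x / m2))) \<partial>P) - of_real (exp (- (t\<^sup>2 / 2))))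
    \<le> \<epsilon> * (t\<^sup>2 + \<bar>t\<bar> ^ 3) + (\<bar>t\<bar> * \<delta> + 4 * \<eta> / \<delta>)"
proof -
  let ?z = "\<lambda>x. iexp (t * (S x / sqrt (U_var n x / m2)))"
  let ?n = "real n"
  have cI: "card I = n" by (simp add: I)
  have n0: "?n > 0" using n by simp
  have "0 \<in> I" using n by (simp add: I)
  then have b0: "b \<ge> 0" using a_bound[of 0 0] by simp
  have b4: "b ^ 4 = c ^ 4 / (?n ^ 4 * m2\<^sup>2)"
    using m2 by (simp add: b power_divide power_mult_distrib power4_eq_xxxx power2_eq_square)
  have qv_int: "integrable P (\<lambda>x. (quad_var x - 1)\<^sup>2)"
    by (rule quadratic_variation_L2[OF b0 norm1])
  have "(\<integral>x. (quad_var x - 1)\<^sup>2 \<partial>P) \<le> b ^ 4 * (16 * ?n ^ 3 * m4 + ?n ^ 4 * \<bar>cyc\<bar>)"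
    using quadratic_variation_L2(2)[OF b0 norm1] by (simp add: cI)
  also have "\<dots> = c ^ 4 * (16 * (m4 / (?n * m2\<^sup>2)) + \<bar>cyc\<bar> / m2\<^sup>2)"
    unfolding b4 using n0 m2 by (simp add: field_simps power3_eq_cube power4_eq_xxxx)
  also note \<epsilon>
  finally have qv: "(\<integral>x. (quad_var x - 1)\<^sup>2 \<partial>P) \<le> \<epsilon>\<^sup>2" .
  have "(\<Sum>k\<in>I. \<integral>x. T k x ^ 4 \<partial>P) \<le> (\<Sum>k\<in>I. b ^ 4 * (3 * ?n ^ 2 * m4))"
    using T_fourth_moment(2) by (intro sum_mono) (simp add: cI)
  also have "\<dots> = c ^ 4 * (3 * (m4 / (?n * m2\<^sup>2)))"
    unfolding b4 using n0 m2 by (simp add: cI field_simps power2_eq_square power4_eq_xxxx)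
  also have "\<dots> \<le> c ^ 4 * (16 * (m4 / (?n * m2\<^sup>2)) + \<bar>cyc\<bar> / m2\<^sup>2)"
    using m4_nonneg n0 m2 by (intro mult_left_mono add_increasing2 mult_right_mono) auto
  also note \<epsilon>
  finally have T4: "(\<Sum>k\<in>I. \<integral>x. T k x ^ 4 \<partial>P) \<le> \<epsilon>\<^sup>2" .
  note gauss = char_gaussian_bound[OF pos(1) norm1 qv_int qv T4, of t]
  note V = U_var_ratio[OF I n m2 pos(2) \<eta> n\<eta>]
  note Vm = U_var_meas[OF I, measurable]
  have iS: "integrable P S"
    by (rule PP.square_integrable_imp_integrable[OF S_meas S_square(1)[OF norm1]])
  have "(\<integral>x. \<bar>S x\<bar> \<partial>P) \<le> (\<integral>x. (1 + (S x)\<^sup>2 / 1) / 2 \<partial>P)"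
    using S_square(1)[OF norm1] iS by (intro integral_mono abs_le_amgm) auto
  also have "\<dots> = 1" using S_square[OF norm1] by simp
  finally have S1: "(\<integral>x. \<bar>S x\<bar> \<partial>P) \<le> 1" .
  have i1: "integrable P (\<lambda>x. ?z x)"
    and i2: "integrable P (\<lambda>x. iexp (t * S x))"
    by (rule PP.integrable_const_bound[of _ 1]; simp)+
  have "cmod (\<integral>x. ?z x - iexp (t * S x) \<partial>P)
      \<le> (\<integral>x. \<bar>t\<bar> * \<bar>S x\<bar> * \<delta> + 2 / \<delta> * \<bar>U_var n x / m2 - 1\<bar> \<partial>P)"
    by (intro norm_integral_le Bochner_Integration.integrable_diff i1 i2 studentize_pointwise pos)
      (use iS V(1) in auto)
  also have "\<dots> = \<bar>t\<bar> * (\<integral>x. \<bar>S x\<bar> \<partial>P) * \<delta> + 2 / \<delta> * (\<integral>x. \<bar>U_var n x / m2 - 1\<bar> \<partial>P)"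
    using iS V(1) by simp
  also have "\<dots> \<le> \<bar>t\<bar> * 1 * \<delta> + 2 / \<delta> * (2 * \<eta>)"
    using S1 V(2) pos by (intro add_mono mult_left_mono mult_right_mono) auto
  finally have diff: "cmod ((\<integral>x. ?z x \<partial>P) - (\<integral>x. iexp (t * S x) \<partial>P))
      \<le> \<bar>t\<bar> * \<delta> + 4 * \<eta> / \<delta>"
    unfolding Bochner_Integration.integral_diff[OF i1 i2] by simp
  have "cmod (A - C) \<le> cmod (B - C) + cmod (A - B)" for A B C :: complex
    using norm_triangle_ineq[of "B - C" "A - B"] by simp
  from this[of "\<integral>x. ?z x \<partial>P" _ "\<integral>x. iexp (t * S x) \<partial>P"]
  show ?thesis by (rule order_trans[OF _ add_mono[OF gauss diff]])
qed

end

section \<open>The Gini covariance as a weighted sum of distances\<close>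

lemma edist_sym: "edist p x y = edist p y x"
  by (simp add: edist_def enorm_def L2_set_def power2_commute)

lemma edist_refl [simp]: "edist p x x = 0"
  by (simp add: edist_def enorm_def L2_set_def)

lemma sum_less_pairs:
  fixes D :: "nat \<Rightarrow> nat \<Rightarrow> real"
  assumes "finite A" and sym: "\<And>i j. D i j = D j i" and diag: "\<And>i. D i i = 0"
  shows "(\<Sum>(i, j)\<in>{(i, j). i \<in> A \<and> j \<in> A \<and> i < j}. D i j) = (\<Sum>i\<in>A. \<Sum>j\<in>A. D i j) / 2"
proof -
  let ?L = "{(i, j). i \<in> A \<and> j \<in> A \<and> i < j}" and ?G = "{(i, j). i \<in> A \<and> j \<in> A \<and> j < i}"
  let ?E = "{(i, j). i \<in> A \<and> j \<in> A \<and> i = j}"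
  have sub: "?L \<subseteq> A \<times> A" "?G \<subseteq> A \<times> A" "?E \<subseteq> A \<times> A" by auto
  have f: "finite ?L" "finite ?G" "finite ?E"
    using finite_subset[OF sub(1)] finite_subset[OF sub(2)] finite_subset[OF sub(3)] assms(1) by simp_all
  have U: "A \<times> A = ?L \<union> (?G \<union> ?E)" by auto
  have E0: "(\<Sum>(i, j)\<in>?E. D i j) = 0" by (intro sum.neutral) (auto simp: diag)
  have GL: "(\<Sum>(i, j)\<in>?G. D i j) = (\<Sum>(i, j)\<in>?L. D i j)"
    by (rule sum.reindex_bij_witness[of _ "\<lambda>(i, j). (j, i)" "\<lambda>(i, j). (j, i)"]) (auto simp: sym)
  have "(\<Sum>i\<in>A. \<Sum>j\<in>A. D i j) = (\<Sum>(i, j)\<in>?L \<union> (?G \<union> ?E). D i j)"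
    unfolding sum.cartesian_product U ..
  also have "\<dots> = (\<Sum>(i, j)\<in>?L. D i j) + ((\<Sum>(i, j)\<in>?G. D i j) + (\<Sum>(i, j)\<in>?E. D i j))"
    using f by (subst sum.union_disjoint, simp, simp, force, subst sum.union_disjoint) auto
  finally show ?thesis using E0 GL by simp
qed

lemma real_choose_two: "real (c choose 2) = real c * (real c - 1) / 2"
proof (cases c)
  case (Suc d)
  have "even (c * (c - 1))" by (simp add: Suc)
  then show ?thesis by (simp add: choose_two real_of_nat_div Suc algebra_simps)
qed simp

lemma ustat_eq:
  assumes "finite A"
  shows "ustat p x A = (\<Sum>i\<in>A. \<Sum>j\<in>A. edist p (x i) (x j)) / (real (card A) * (real (card A) - 1))"
  using sum_less_pairs[OF assms, of "\<lambda>i j. edist p (x i) (x j)"]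
  by (simp add: ustat_def edist_sym real_choose_two)

text \<open>Label vectors for which all within-class averages are averages over nonempty sets of pairs.\<close>
locale class_weights =
  fixes n :: nat and L :: "'l set" and y :: "nat \<Rightarrow> 'l"
  assumes L_fin: "finite L" and L_card: "card L \<ge> 2"
    and labels: "\<And>i. i < n \<Longrightarrow> y i \<in> L"
    and sizes: "\<And>k. k \<in> L \<Longrightarrow> class_size n y k \<ge> 2"
begin

abbreviation cls where "cls k \<equiv> class_idx n y k"
abbreviation nn where "nn k \<equiv> real (class_size n y k)"

text \<open>The weights refer to ordered pairs and are twice those of unordered pairs, so that the statistic is
  half of a double sum. The part \<open>within_weight\<close> comes from the within-class averages.\<close>
definition within_weight :: "nat \<Rightarrow> nat \<Rightarrow> real" where
  "within_weight i j = (if i \<noteq> j \<and> y i = y j then 2 / (real n * (nn (y i) - 1)) else 0)"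

definition pair_weight :: "nat \<Rightarrow> nat \<Rightarrow> real" where
  "pair_weight i j = (if i = j then 0 else 2 / (real n * (real n - 1)) - within_weight i j)"

definition weight_var :: real where
  "weight_var = (\<Sum>k\<in>L. (phat n y k)\<^sup>2 / real (class_size n y k choose 2)) - 1 / real (n choose 2)"

lemma class_idx_finite [simp]: "finite (cls k)"
  by (simp add: class_idx_def)

lemma size_le: "class_size n y k \<le> n"
proof -
  have "class_size n y k \<le> card {..<n}"
    unfolding class_size_def by (intro card_mono) (auto simp: class_idx_def)
  then show ?thesis by simp
qed

lemma n_ge: "n \<ge> 2" and n_real: "real n \<ge> 2"
proof -
  obtain k where "k \<in> L" using L_card by (cases "L = {}") auto
  then show "n \<ge> 2" using sizes[of k] size_le[of k] by linarith
  then show "real n \<ge> 2" by simp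
qed

lemma nn_ge: "k \<in> L \<Longrightarrow> nn k \<ge> 2" and nn_le: "nn k \<le> real n"
  using sizes[of k] size_le[of k] by simp_all

lemma sum_by_class: "(\<Sum>k\<in>L. \<Sum>i\<in>cls k. f i) = (\<Sum>i<n. f i)" for f :: "nat \<Rightarrow> real"
proof -
  have "(\<Sum>k\<in>L. \<Sum>i\<in>{i \<in> {..<n}. y i = k}. f i) = (\<Sum>i<n. f i)"
    by (rule sum.group) (use L_fin labels in auto)
  moreover have "{i \<in> {..<n}. y i = k} = cls k" for k by (auto simp: class_idx_def)
  ultimately show ?thesis by simp
qed

lemma sum_within_weight_mult: "(\<Sum>j<n. within_weight i j * f j) = 2 / (real n * (nn (y i) - 1)) * (\<Sum>j\<in>cls (y i) - {i}. f j)"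
  unfolding sum_distrib_left
  by (rule sum.mono_neutral_cong_right) (auto simp: within_weight_def class_idx_def)

lemma row_within_weight:
  assumes "i < n"
  shows "(\<Sum>j<n. within_weight i j) = 2 / real n"
proof -
  have "i \<in> cls (y i)" using assms by (simp add: class_idx_def)
  then have card: "(\<Sum>j\<in>cls (y i) - {i}. 1) = nn (y i) - 1"
    using sizes[OF labels[OF assms]] by (simp add: card_Diff_singleton class_size_def of_nat_diff)
  have "2 / (r * u) * u = 2 / r" if "u \<noteq> 0" for r u :: real using that by simp
  from this[of "nn (y i) - 1" "real n"] show ?thesis
    using sum_within_weight_mult[of i "\<lambda>_. 1"] nn_ge[OF labels[OF assms]] unfolding card mult_1_right by simp
qed

text \<open>The weights of the pairs with a given member add up to \<open>2 / n\<close> both in the overall average and in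
  the within-class average. This is why additive terms in the distances do not affect the
  statistic.\<close>
lemma row_pair_weight:
  assumes "i < n"
  shows "(\<Sum>j<n. pair_weight i j) = 0"
proof -
  have "(\<Sum>j<n. pair_weight i j) = (\<Sum>j<n. (if j = i then 0 else 2 / (real n * (real n - 1))) - within_weight i j)"
    by (intro sum.cong refl) (auto simp: pair_weight_def within_weight_def)
  also have "\<dots> = (\<Sum>j\<in>{..<n} - {i}. 2 / (real n * (real n - 1))) - 2 / real n"
    unfolding sum_subtractf row_within_weight[OF assms]
    by (intro arg_cong2[where f = "(-)"] refl sum.mono_neutral_cong_right) auto
  also have "(\<Sum>j\<in>{..<n} - {i}. 2 / (real n * (real n - 1))) = (real n - 1) * (2 / (real n * (real n - 1)))"
    using assms n_real by (simp add: card_Diff_singleton of_nat_diff)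
  also have "\<dots> - 2 / real n = 0"
  proof -
    have "u * (2 / (r * u)) = 2 / r" if "u \<noteq> 0" for r u :: real using that by simp
    from this[of "real n - 1" "real n"] show ?thesis using n_real by simp
  qed
  finally show ?thesis .
qed

lemma within_weight_sym: "within_weight i j = within_weight j i" by (auto simp: within_weight_def)
lemma pair_weight_sym: "pair_weight i j = pair_weight j i" by (auto simp: pair_weight_def within_weight_sym)
lemma pair_weight_diag [simp]: "pair_weight i i = 0" by (simp add: pair_weight_def)

lemma gCov_weights: "gCov p n L x y = (\<Sum>i<n. \<Sum>j<n. pair_weight i j * edist p (x i) (x j)) / 2"
proof -
  let ?D = "\<lambda>i j. edist p (x i) (x j)"
  have "phat n y k * ustat p x (cls k)
      = (\<Sum>i\<in>cls k. \<Sum>j<n. within_weight i j * ?D i j) / 2" if k: "k \<in> L" for k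
  proof -
    have "phat n y k * ustat p x (cls k)
        = (\<Sum>i\<in>cls k. \<Sum>j\<in>cls k. ?D i j) * (nn k / (real n * (nn k * (nn k - 1))))"
      by (simp add: ustat_eq phat_def class_size_def)
    also have "nn k / (real n * (nn k * (nn k - 1))) = (2 / (real n * (nn k - 1))) / 2"
      using nn_ge[OF k] by simp
    also have "(\<Sum>i\<in>cls k. \<Sum>j\<in>cls k. ?D i j) * ((2 / (real n * (nn k - 1))) / 2)
        = (\<Sum>i\<in>cls k. 2 / (real n * (nn k - 1)) * (\<Sum>j\<in>cls k. ?D i j)) / 2"
      by (simp only: sum_distrib_left[symmetric]) simp
    also have "\<dots> = (\<Sum>i\<in>cls k. \<Sum>j<n. within_weight i j * ?D i j) / 2"
    proof (intro arg_cong2[where f = "(/)"] refl, rule sum.cong[OF refl])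
      fix i assume i: "i \<in> cls k"
      then have "(\<Sum>j\<in>cls k. ?D i j) = (\<Sum>j\<in>cls k - {i}. ?D i j)"
        by (subst sum.remove[of _ i]) auto
      then show "2 / (real n * (nn k - 1)) * (\<Sum>j\<in>cls k. ?D i j) = (\<Sum>j<n. within_weight i j * ?D i j)"
        using i by (simp add: sum_within_weight_mult class_idx_def)
    qed
    finally show ?thesis .
  qed
  then have "(\<Sum>k\<in>L. phat n y k * ustat p x (cls k))
      = (\<Sum>k\<in>L. (\<Sum>i\<in>cls k. \<Sum>j<n. within_weight i j * ?D i j) / 2)"
    by (rule sum.cong[OF refl])
  then have "(\<Sum>k\<in>L. phat n y k * ustat p x (cls k)) = (\<Sum>i<n. \<Sum>j<n. within_weight i j * ?D i j) / 2"
    unfolding sum_divide_distrib[symmetric] sum_by_class .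
  moreover have "ustat p x {..<n} = (\<Sum>i<n. \<Sum>j<n. 2 / (real n * (real n - 1)) * ?D i j) / 2"
    by (simp only: ustat_eq[OF finite_lessThan] card_lessThan sum_distrib_left[symmetric]) simp
  moreover have "pair_weight i j * ?D i j = 2 / (real n * (real n - 1)) * ?D i j - within_weight i j * ?D i j" for i j
    by (cases "i = j") (auto simp: pair_weight_def algebra_simps)
  ultimately show ?thesis unfolding gCov_def by (simp only: sum_subtractf diff_divide_distrib)
qed

text \<open>The one-observation parts \<open>g\<close> of the distances cancel because rows and columns of the weights sum to
  zero. It is used with the doubly centered distances as \<open>E\<close>.\<close>
lemma gCov_weights_additive:
  assumes D: "\<And>i j. edist p (x i) (x j) = (if i = j then 0 else E i j + g i + g j)" and E: "\<And>i. E i i = 0"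
  shows "gCov p n L x y = (\<Sum>i<n. \<Sum>j<n. pair_weight i j * E i j) / 2"
proof -
  have "pair_weight i j * edist p (x i) (x j) = pair_weight i j * E i j + pair_weight i j * g i + pair_weight i j * g j" for i j
    using E D[of i j] by (auto simp: algebra_simps)
  then have "(\<Sum>i<n. \<Sum>j<n. pair_weight i j * edist p (x i) (x j))
      = (\<Sum>i<n. \<Sum>j<n. pair_weight i j * E i j) + (\<Sum>i<n. \<Sum>j<n. pair_weight i j * g i) + (\<Sum>i<n. \<Sum>j<n. pair_weight i j * g j)"
    by (simp only: sum.distrib)
  also have "(\<Sum>i<n. \<Sum>j<n. pair_weight i j * g i) = 0"
    unfolding sum_distrib_right[symmetric] by (intro sum.neutral) (simp add: row_pair_weight)
  also have "(\<Sum>i<n. \<Sum>j<n. pair_weight i j * g j) = 0"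
    by (subst sum.swap, subst pair_weight_sym) (simp add: row_pair_weight flip: sum_distrib_right)
  finally show ?thesis by (simp add: gCov_weights)
qed

lemma weight_var_eq: "weight_var = 2 / (real n)\<^sup>2 * (\<Sum>k\<in>L. nn k / (nn k - 1)) - 2 / (real n * (real n - 1))"
proof -
  have "(phat n y k)\<^sup>2 / real (class_size n y k choose 2) = 2 / (real n)\<^sup>2 * (nn k / (nn k - 1))"
    if "k \<in> L" for k
    using nn_ge[OF that] unfolding phat_def real_choose_two by (simp add: power2_eq_square ac_simps)
  then show ?thesis unfolding weight_var_def by (simp add: real_choose_two sum_distrib_left)
qed

text \<open>The deterministic factor of the variance estimator is the sum of the squared weights over
  unordered pairs, that is, the exact conditional variance up to the second moment of the
  kernel.\<close>
lemma sum_pair_weight_square: "(\<Sum>i<n. \<Sum>j<n. (pair_weight i j)\<^sup>2) = 2 * weight_var"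
proof -
  let ?u = "2 / (real n * (real n - 1))"
  have ring: "(r - s)\<^sup>2 = r * (r - s) - r * s + s * s" for r s :: real
    by (simp add: power2_eq_square algebra_simps)
  have "(pair_weight i j)\<^sup>2 = ?u * pair_weight i j - ?u * within_weight i j + within_weight i j * within_weight i j" for i j
  proof (cases "i = j")
    case False
    then have "pair_weight i j = ?u - within_weight i j" by (simp add: pair_weight_def)
    then show ?thesis by (simp only: ring)
  qed (simp add: within_weight_def)
  then have "(\<Sum>i<n. \<Sum>j<n. (pair_weight i j)\<^sup>2)
      = ?u * (\<Sum>i<n. \<Sum>j<n. pair_weight i j) - ?u * (\<Sum>i<n. \<Sum>j<n. within_weight i j) + (\<Sum>i<n. \<Sum>j<n. within_weight i j * within_weight i j)"
    by (simp only: sum.distrib sum_subtractf sum_distrib_left)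
  also have "(\<Sum>i<n. \<Sum>j<n. pair_weight i j) = 0" by (simp add: row_pair_weight)
  also have "(\<Sum>i<n. \<Sum>j<n. within_weight i j) = 2" using n_real by (simp add: row_within_weight)
  also have "(\<Sum>i<n. \<Sum>j<n. within_weight i j * within_weight i j) = (\<Sum>i<n. 4 / ((real n)\<^sup>2 * (nn (y i) - 1)))"
  proof (rule sum.cong[OF refl])
    fix i assume "i \<in> {..<n}"
    have "(\<Sum>j<n. within_weight i j * within_weight i j) = (\<Sum>j<n. 2 / (real n * (nn (y i) - 1)) * within_weight i j)"
      by (intro sum.cong refl) (auto simp: within_weight_def)
    also have "\<dots> = 2 / (real n * (nn (y i) - 1)) * (2 / real n)"
      using \<open>i \<in> {..<n}\<close> by (simp only: sum_distrib_left[symmetric] row_within_weight lessThan_iff)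
    finally show "(\<Sum>j<n. within_weight i j * within_weight i j) = 4 / ((real n)\<^sup>2 * (nn (y i) - 1))"
      by (simp add: power2_eq_square mult.assoc mult.left_commute)
  qed
  also have "\<dots> = (\<Sum>k\<in>L. \<Sum>i\<in>cls k. 4 / ((real n)\<^sup>2 * (nn k - 1)))"
    unfolding sum_by_class[symmetric]
    by (rule sum.cong[OF refl], rule sum.cong[OF refl]) (simp add: class_idx_def)
  also have "\<dots> = (\<Sum>k\<in>L. 4 / (real n)\<^sup>2 * (nn k / (nn k - 1)))"
    by (rule sum.cong[OF refl]) (simp add: class_size_def)
  finally show ?thesis by (simp add: weight_var_eq sum_distrib_left)
qed

text \<open>Here at least two classes are needed: with a single class all weights vanish.\<close>
lemma weight_var_ge: "weight_var \<ge> 2 / (real n)\<^sup>2"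
proof -
  obtain k0 where k0: "k0 \<in> L" using L_card by (cases "L = {}") auto
  have "card (L - {k0}) \<ge> 1" using L_card k0 L_fin by simp
  then obtain k1 where k1: "k1 \<in> L - {k0}" by (metis card.empty ex_in_conv not_one_le_zero)
  have one: "nn k / (nn k - 1) \<ge> 1" if "k \<in> L" for k using nn_ge[OF that] by simp
  have "(\<Sum>k\<in>L. nn k / (nn k - 1)) = nn k0 / (nn k0 - 1) + (\<Sum>k\<in>L - {k0}. nn k / (nn k - 1))"
    by (rule sum.remove[OF L_fin k0])
  moreover have "(\<Sum>k\<in>L - {k0}. nn k / (nn k - 1)) \<ge> nn k1 / (nn k1 - 1)"
    by (rule member_le_sum) (use k1 L_fin one order_trans[OF zero_le_one one] in auto)
  moreover have "nn k0 / (nn k0 - 1) \<ge> real n / (real n - 1)"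
    using nn_ge[OF k0] nn_le[of k0] n_real by (simp add: field_simps)
  ultimately have s: "(\<Sum>k\<in>L. nn k / (nn k - 1)) \<ge> real n / (real n - 1) + 1"
    using one[of k1] k1 by auto
  have "2 / (real n)\<^sup>2 = 2 / (real n)\<^sup>2 * (real n / (real n - 1) + 1) - 2 / (real n * (real n - 1))"
  proof -
    have "2 / r\<^sup>2 = 2 / r\<^sup>2 * (r / u + 1) - 2 / (r * u)" if "r \<noteq> 0" for r u :: real
      using that by (simp add: power2_eq_square distrib_left)
    then show ?thesis using n_real by simp
  qed
  also have "\<dots> \<le> weight_var"
    unfolding weight_var_eq by (intro diff_right_mono mult_left_mono s) simp
  finally show ?thesis .
qed

lemma pair_weight_bound:
  assumes "i < n" "j < n" and \<rho>: "\<rho> > 0" and big: "\<And>k. k \<in> L \<Longrightarrow> nn k \<ge> real n * \<rho> / 2"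
  shows "\<bar>pair_weight i j\<bar> \<le> 8 / \<rho> / (real n)\<^sup>2"
proof -
  let ?k = "y i"
  have k: "?k \<in> L" using labels assms by simp
  have "nn ?k - 1 \<ge> nn ?k / 2" using nn_ge[OF k] by simp
  then have m: "nn ?k - 1 \<ge> real n * \<rho> / 4" using big[OF k] by simp
  have pos: "real n * \<rho> / 4 > 0" using n_real \<rho> by simp
  have u: "0 \<le> 2 / (real n * (real n - 1))"
    "2 / (real n * (real n - 1)) \<le> 2 / (real n * (nn ?k - 1))"
    using n_real nn_le[of ?k] m pos by (auto intro!: divide_left_mono mult_left_mono mult_pos_pos)
  have ww: "0 \<le> within_weight i j" "within_weight i j \<le> 2 / (real n * (nn ?k - 1))"
    using n_real nn_ge[OF k] by (auto simp: within_weight_def)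
  have "\<bar>pair_weight i j\<bar> \<le> 2 / (real n * (nn ?k - 1))"
  proof (cases "i = j")
    case False
    then have "pair_weight i j = 2 / (real n * (real n - 1)) - within_weight i j" by (simp add: pair_weight_def)
    moreover have "\<bar>r - s\<bar> \<le> t" if "0 \<le> r" "r \<le> t" "0 \<le> s" "s \<le> t" for r s t :: real
      using that by linarith
    ultimately show ?thesis using u ww by simp
  qed (use order_trans[OF u] in simp)
  also have "\<dots> \<le> 2 / (real n * (real n * \<rho> / 4))"
    using m pos n_real by (intro divide_left_mono mult_left_mono mult_pos_pos) auto
  also have "\<dots> = 8 / \<rho> / (real n)\<^sup>2" by (simp add: power2_eq_square)
  finally show ?thesis .
qed

end

section \<open>The doubly centered distance\<close>

lemma enorm_meas [measurable]: "enorm p \<in> borel_measurable (euclid p)"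
  unfolding enorm_def[abs_def] L2_set_def by measurable

lemma edist_meas [measurable]: "(\<lambda>(x, y). edist p x y) \<in> borel_measurable (euclid p \<Otimes>\<^sub>M euclid p)"
  unfolding edist_def enorm_def L2_set_def by measurable

lemma enorm_nonneg [simp]: "enorm p x \<ge> 0" by (simp add: enorm_def)
lemma edist_nonneg [simp]: "edist p x y \<ge> 0" by (simp add: edist_def)

lemma edist_le: "edist p x y \<le> enorm p x + enorm p y"
proof -
  have "L2_set (\<lambda>j. x j + - y j) {..<p} \<le> L2_set x {..<p} + L2_set (\<lambda>j. - y j) {..<p}"
    by (rule L2_set_triangle_ineq)
  also have "L2_set (\<lambda>j. - y j) {..<p} = L2_set y {..<p}" by (simp add: L2_set_def)
  finally show ?thesis by (simp add: edist_def enorm_def)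
qed

lemma power4_sum3_le: "(a + b + c) ^ 4 \<le> 81 * (a ^ 4 + b ^ 4 + c ^ 4)" if "a \<ge> 0" "b \<ge> 0" "c \<ge> 0" for a b c :: real
proof -
  define m where "m = max a (max b c)"
  have "(a + b + c) ^ 4 \<le> (3 * m) ^ 4" using that by (intro power_mono) (auto simp: m_def)
  also have "\<dots> = 81 * m ^ 4" by (simp add: power_mult_distrib)
  also have "m ^ 4 \<le> a ^ 4 + b ^ 4 + c ^ 4"
    using that by (auto simp: m_def max_def)
  finally show ?thesis by simp
qed

text \<open>The law of one observation. The doubly centered distance \<open>centered_dist\<close> is defined pointwise from
  integrals; \<open>dcd_eq_centered_dist\<close> connects it with conditional expectations.\<close>
locale euclid_law = prob_space F for F :: "(nat \<Rightarrow> real) measure" +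
  fixes p :: nat
  assumes F_sets [measurable_cong]: "sets F = sets (euclid p)"
    and fourth: "integrable F (\<lambda>x. enorm p x ^ 4)"
begin

definition mean_dist :: "(nat \<Rightarrow> real) \<Rightarrow> real" where "mean_dist x = (\<integral>y. edist p x y \<partial>F)"
definition grand_mean :: real where "grand_mean = (\<integral>x. mean_dist x \<partial>F)"
definition centered_dist :: "(nat \<Rightarrow> real) \<Rightarrow> (nat \<Rightarrow> real) \<Rightarrow> real" where
  "centered_dist x y = edist p x y - mean_dist x - mean_dist y + grand_mean"

sublocale FF: pair_prob_space F F ..

lemma F_space: "space F = space (euclid p)" using sets_eq_imp_space_eq[OF F_sets] .

lemma edist_meas_FF [measurable]: "(\<lambda>z. edist p (fst z) (snd z)) \<in> borel_measurable (F \<Otimes>\<^sub>M F)"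
  using edist_meas[of p] by (simp add: case_prod_beta' cong: measurable_cong_sets sets_pair_measure_cong F_sets)

lemma enorm_meas_F [measurable]: "enorm p \<in> borel_measurable F"
  using enorm_meas[of p] by (simp cong: measurable_cong_sets add: F_sets)

lemma enorm_int: "integrable F (enorm p)"
proof (rule Bochner_Integration.integrable_bound)
  show "integrable F (\<lambda>x. 1 + enorm p x ^ 4)" using fourth by simp
  have "t \<le> 1 + t ^ 4" if "t \<ge> 0" for t :: real
  proof (cases "t \<le> 1")
    case False
    then have "t \<le> t ^ 4" using self_le_power[of t 4] by simp
    then show ?thesis by simp
  qed (simp add: add_increasing2)
  then show "AE x in F. norm (enorm p x) \<le> norm (1 + enorm p x ^ 4)" by auto
qed measurable

lemma edist_int: "x \<in> space F \<Longrightarrow> integrable F (edist p x)"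
proof (rule Bochner_Integration.integrable_bound)
  assume x: "x \<in> space F"
  show "integrable F (\<lambda>y. enorm p x + enorm p y)" using enorm_int by simp
  show "edist p x \<in> borel_measurable F"
    using measurable_Pair2[OF edist_meas_FF x] by simp
  show "AE y in F. norm (edist p x y) \<le> norm (enorm p x + enorm p y)"
    using edist_le[of p x] by auto
qed

lemma mean_dist_meas [measurable]: "mean_dist \<in> borel_measurable F"
  unfolding mean_dist_def[abs_def]
  using borel_measurable_lebesgue_integral[of "\<lambda>x y. edist p x y" F] edist_meas_FF
  by (simp add: case_prod_beta')

lemma fst_int:
  fixes f :: "(nat \<Rightarrow> real) \<Rightarrow> real"
  assumes "integrable F f"
  shows "integrable (F \<Otimes>\<^sub>M F) (\<lambda>z. f (fst z))" "integrable (F \<Otimes>\<^sub>M F) (\<lambda>z. f (snd z))"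
proof -
  have fst: "distr (F \<Otimes>\<^sub>M F) F fst = F" by (rule distr_pair_fst)
  show 1: "integrable (F \<Otimes>\<^sub>M F) (\<lambda>z. f (fst z))"
    using integrable_distr[OF measurable_fst, of F F f] assms by (simp add: fst)
  show "integrable (F \<Otimes>\<^sub>M F) (\<lambda>z. f (snd z))"
    using FF.integrable_product_swap[OF 1] by (simp add: case_prod_beta')
qed

lemma edist_int_FF: "integrable (F \<Otimes>\<^sub>M F) (\<lambda>z. edist p (fst z) (snd z))"
proof (rule Bochner_Integration.integrable_bound)
  show "integrable (F \<Otimes>\<^sub>M F) (\<lambda>z. enorm p (fst z) + enorm p (snd z))"
    using fst_int[OF enorm_int] by simp
  show "AE z in F \<Otimes>\<^sub>M F. norm (edist p (fst z) (snd z)) \<le> norm (enorm p (fst z) + enorm p (snd z))"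
    using edist_le[of p] by auto
qed measurable

lemma mean_dist_int: "integrable F mean_dist"
  using FF.integrable_fst'[OF edist_int_FF] by (simp add: mean_dist_def[abs_def])

lemma grand_mean_eq: "grand_mean = (\<integral>z. edist p (fst z) (snd z) \<partial>(F \<Otimes>\<^sub>M F))"
  using FF.integral_fst'[OF edist_int_FF] by (simp add: grand_mean_def mean_dist_def)

definition mean_norm :: real where "mean_norm = (\<integral>y. enorm p y \<partial>F)"

lemma mean_dist_bounds:
  assumes "x \<in> space F"
  shows "0 \<le> mean_dist x" "mean_dist x \<le> enorm p x + mean_norm"
proof -
  show "0 \<le> mean_dist x" unfolding mean_dist_def by (intro integral_nonneg_AE) auto
  have "mean_dist x \<le> (\<integral>y. enorm p x + enorm p y \<partial>F)"
    unfolding mean_dist_def using edist_int[OF assms] enorm_int edist_le by (intro integral_mono) auto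
  then show "mean_dist x \<le> enorm p x + mean_norm" using enorm_int by (simp add: mean_norm_def prob_space)
qed

lemma grand_mean_bounds: "0 \<le> grand_mean" "grand_mean \<le> 2 * mean_norm" "0 \<le> mean_norm"
proof -
  show "0 \<le> grand_mean" unfolding grand_mean_def using mean_dist_bounds by (intro integral_nonneg_AE) auto
  have "grand_mean \<le> (\<integral>x. enorm p x + mean_norm \<partial>F)"
    unfolding grand_mean_def using mean_dist_int enorm_int mean_dist_bounds by (intro integral_mono) auto
  then show "grand_mean \<le> 2 * mean_norm" using enorm_int by (simp add: prob_space) (simp add: mean_norm_def)
  show "0 \<le> mean_norm" unfolding mean_norm_def by (intro integral_nonneg_AE) auto
qed

text \<open>The triangle inequality reduces the fourth moment of the doubly centered distance to that of the
  norm.\<close>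
lemma centered_dist_bound:
  assumes "x \<in> space F" "y \<in> space F"
  shows "\<bar>centered_dist x y\<bar> \<le> 2 * enorm p x + 2 * enorm p y + 4 * mean_norm"
proof -
  have *: "0 \<le> edist p x y" "edist p x y \<le> enorm p x + enorm p y" by (simp_all add: edist_le)
  show ?thesis
    unfolding centered_dist_def
    using * mean_dist_bounds[OF assms(1)] mean_dist_bounds[OF assms(2)] grand_mean_bounds enorm_nonneg[of p x] enorm_nonneg[of p y]
    by linarith
qed

lemma centered_dist_meas: "case_prod centered_dist \<in> borel_measurable (F \<Otimes>\<^sub>M F)"
  unfolding centered_dist_def case_prod_beta' by measurable

sublocale degenerate_kernel F centered_dist
proof unfold_locales
  show "case_prod centered_dist \<in> borel_measurable (F \<Otimes>\<^sub>M F)" by (rule centered_dist_meas)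
  show "centered_dist x y = centered_dist y x" for x y by (simp add: centered_dist_def edist_sym)
  fix x assume x: "x \<in> space F"
  show "integrable F (centered_dist x)" unfolding centered_dist_def[abs_def] using edist_int[OF x] mean_dist_int by simp
  show "(\<integral>y. centered_dist x y \<partial>F) = 0"
    unfolding centered_dist_def using edist_int[OF x] mean_dist_int
    by (simp add: prob_space) (simp add: mean_dist_def grand_mean_def)
next
  show "integrable (F \<Otimes>\<^sub>M F) (\<lambda>(x, y). centered_dist x y ^ 4)"
  proof (rule Bochner_Integration.integrable_bound)
    let ?b = "\<lambda>z. 81 * (16 * enorm p (fst z) ^ 4 + 16 * enorm p (snd z) ^ 4 + 256 * mean_norm ^ 4)"
    show "integrable (F \<Otimes>\<^sub>M F) ?b" using fst_int[OF fourth] by simp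
    show "(\<lambda>(x, y). centered_dist x y ^ 4) \<in> borel_measurable (F \<Otimes>\<^sub>M F)"
      using centered_dist_meas by (simp add: case_prod_beta')
    show "AE z in F \<Otimes>\<^sub>M F. norm (case z of (x, y) \<Rightarrow> centered_dist x y ^ 4) \<le> norm (?b z)"
    proof (rule AE_I2)
      fix z assume z: "z \<in> space (F \<Otimes>\<^sub>M F)"
      obtain x y where xy: "z = (x, y)" "x \<in> space F" "y \<in> space F" using z by (auto simp: space_pair_measure)
      have "\<bar>centered_dist x y\<bar> ^ 4 \<le> (2 * enorm p x + 2 * enorm p y + 4 * mean_norm) ^ 4"
        by (intro power_mono centered_dist_bound xy) simp
      also have "\<dots> \<le> 81 * ((2 * enorm p x) ^ 4 + (2 * enorm p y) ^ 4 + (4 * mean_norm) ^ 4)"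
        using grand_mean_bounds by (intro power4_sum3_le) auto
      finally have "\<bar>centered_dist x y\<bar> ^ 4 \<le> ?b z" by (simp add: xy power_mult_distrib)
      then have "centered_dist x y ^ 4 \<le> ?b z" by simp
      moreover have "0 \<le> centered_dist x y ^ 4" by simp
      ultimately show "norm (case z of (x, y) \<Rightarrow> centered_dist x y ^ 4) \<le> norm (?b z)"
        unfolding xy real_norm_def by (simp only: prod.case abs_of_nonneg order_trans[OF _ abs_ge_self])
    qed
  qed
qed

lemma edist_centered_dist: "edist p x y = centered_dist x y + (mean_dist x - grand_mean / 2) + (mean_dist y - grand_mean / 2)"
  by (simp add: centered_dist_def)

text \<open>For independent copies, conditioning on the first one amounts to integrating over the second
  one.\<close>
lemma cond_exp_edist:
  assumes C: "prob_space C" and [measurable]: "U \<in> measurable C (euclid p)" "V \<in> measurable C (euclid p)"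
    and law: "distr C (euclid p \<Otimes>\<^sub>M euclid p) (\<lambda>\<omega>. (U \<omega>, V \<omega>)) = F \<Otimes>\<^sub>M F"
  shows "AE \<omega> in C. cond_exp_given C (euclid p) U (\<lambda>\<xi>. edist p (U \<xi>) (V \<xi>)) \<omega> = mean_dist (U \<omega>)"
proof -
  interpret C: prob_space C by fact
  let ?G = "vimage_algebra (space C) U (euclid p)"
  have [measurable]: "U \<in> measurable C F" "V \<in> measurable C F"
    by (simp_all cong: measurable_cong_sets add: F_sets)
  have UG: "U \<in> measurable ?G F"
  proof -
    have "U \<in> measurable ?G (euclid p)"
      by (rule measurable_vimage_algebra1) (use measurable_space[OF assms(2)] in auto)
    then show ?thesis by (simp cong: measurable_cong_sets add: F_sets)
  qed
  have sub: "subalgebra C ?G"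
    unfolding subalgebra_def by (auto simp: sets_vimage_algebra2 measurable_sets[OF assms(2)]
        measurable_space[OF assms(2)] Pi_iff)
  interpret G: finite_measure_subalgebra C ?G
    by unfold_locales (rule sub)
  have law': "distr C (F \<Otimes>\<^sub>M F) (\<lambda>\<omega>. (U \<omega>, V \<omega>)) = F \<Otimes>\<^sub>M F"
    unfolding law[symmetric] by (rule distr_cong) (auto intro!: sets_pair_measure_cong simp: F_sets)
  have mUV: "(\<lambda>\<omega>. (U \<omega>, V \<omega>)) \<in> measurable C (F \<Otimes>\<^sub>M F)" by measurable
  have transfer: "(\<integral>\<omega>. f (U \<omega>, V \<omega>) \<partial>C) = (\<integral>z. f z \<partial>(F \<Otimes>\<^sub>M F))"
    "integrable C (\<lambda>\<omega>. f (U \<omega>, V \<omega>)) \<longleftrightarrow> integrable (F \<Otimes>\<^sub>M F) f"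
    if "f \<in> borel_measurable (F \<Otimes>\<^sub>M F)" for f :: "_ \<Rightarrow> real"
    using integral_distr[OF mUV that] integrable_distr_eq[OF mUV that] by (simp_all add: law')
  have "AE \<omega> in C. real_cond_exp C ?G (\<lambda>\<xi>. edist p (U \<xi>) (V \<xi>)) \<omega> = mean_dist (U \<omega>)"
  proof (rule G.real_cond_exp_charact)
    show "integrable C (\<lambda>\<xi>. edist p (U \<xi>) (V \<xi>))"
      using transfer(2)[OF edist_meas_FF] edist_int_FF by simp
    have "(\<lambda>z. mean_dist (fst z)) \<in> borel_measurable (F \<Otimes>\<^sub>M F)" by measurable
    from transfer(2)[OF this] show "integrable C (\<lambda>\<xi>. mean_dist (U \<xi>))"
      using fst_int(1)[OF mean_dist_int] by simp
    show "(\<lambda>\<xi>. mean_dist (U \<xi>)) \<in> borel_measurable ?G" by (rule measurable_compose[OF UG mean_dist_meas])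
    fix A assume "A \<in> sets ?G"
    then obtain B where B: "B \<in> sets (euclid p)" and A: "A = U -` B \<inter> space C"
      by (auto simp: sets_vimage_algebra2 measurable_space[OF assms(2)] Pi_iff)
    have [measurable]: "B \<in> sets F" using B by (simp add: F_sets)
    let ?f1 = "\<lambda>z. indicator B (fst z) * edist p (fst z) (snd z) :: real"
    let ?f2 = "\<lambda>z. indicator B (fst z) * mean_dist (fst z) :: real"
    have m1: "?f1 \<in> borel_measurable (F \<Otimes>\<^sub>M F)" and m2: "?f2 \<in> borel_measurable (F \<Otimes>\<^sub>M F)"
      by measurable
    have i1: "integrable (F \<Otimes>\<^sub>M F) ?f1"
      by (rule Bochner_Integration.integrable_bound[OF edist_int_FF m1]) (auto simp: indicator_def)
    have i2: "integrable (F \<Otimes>\<^sub>M F) ?f2"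
      by (rule Bochner_Integration.integrable_bound[OF fst_int(1)[OF mean_dist_int] m2]) (auto simp: indicator_def)
    have "(\<integral>\<omega>\<in>A. edist p (U \<omega>) (V \<omega>) \<partial>C) = (\<integral>\<omega>. ?f1 (U \<omega>, V \<omega>) \<partial>C)"
      unfolding set_lebesgue_integral_def
      by (intro Bochner_Integration.integral_cong refl) (auto simp: A indicator_def)
    also have "\<dots> = (\<integral>x. (\<integral>y. ?f1 (x, y) \<partial>F) \<partial>F)"
      unfolding transfer(1)[OF m1] by (rule FF.integral_fst'[OF i1, symmetric])
    also have "\<dots> = (\<integral>x. (\<integral>y. ?f2 (x, y) \<partial>F) \<partial>F)"
      by (simp add: mean_dist_def prob_space)
    also have "\<dots> = (\<integral>\<omega>. ?f2 (U \<omega>, V \<omega>) \<partial>C)"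
      unfolding transfer(1)[OF m2] by (rule FF.integral_fst'[OF i2])
    also have "\<dots> = (\<integral>\<omega>\<in>A. mean_dist (U \<omega>) \<partial>C)"
      unfolding set_lebesgue_integral_def
      by (intro Bochner_Integration.integral_cong refl) (auto simp: A indicator_def)
    finally show "(\<integral>\<omega>\<in>A. edist p (U \<omega>) (V \<omega>) \<partial>C) = (\<integral>\<omega>\<in>A. mean_dist (U \<omega>) \<partial>C)" .
  qed
  then show ?thesis by (simp add: cond_exp_given_def)
qed

lemma dcd_eq_centered_dist:
  assumes C: "prob_space C" and U: "U \<in> measurable C (euclid p)" and V: "V \<in> measurable C (euclid p)"
    and law: "distr C (euclid p \<Otimes>\<^sub>M euclid p) (\<lambda>\<omega>. (U \<omega>, V \<omega>)) = F \<Otimes>\<^sub>M F"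
    and law': "distr C (euclid p \<Otimes>\<^sub>M euclid p) (\<lambda>\<omega>. (V \<omega>, U \<omega>)) = F \<Otimes>\<^sub>M F"
  shows "AE \<omega> in C. dcd C p U V \<omega> = centered_dist (U \<omega>) (V \<omega>)"
proof -
  have mUV: "(\<lambda>\<omega>. (U \<omega>, V \<omega>)) \<in> measurable C (euclid p \<Otimes>\<^sub>M euclid p)" using U V by simp
  have "(\<integral>\<omega>. edist p (U \<omega>) (V \<omega>) \<partial>C) = grand_mean"
    using integral_distr[OF mUV edist_meas] by (simp add: law grand_mean_eq case_prod_beta')
  moreover have "AE \<omega> in C. cond_exp_given C (euclid p) V (\<lambda>\<xi>. edist p (U \<xi>) (V \<xi>)) \<omega> = mean_dist (V \<omega>)"
    using cond_exp_edist[OF C V U law'] by (simp add: edist_sym)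
  ultimately show ?thesis
    using cond_exp_edist[OF C U V law] by (auto simp: dcd_def centered_dist_def)
qed

lemma dcd_meas: "U \<in> measurable C (euclid p) \<Longrightarrow> V \<in> measurable C (euclid p) \<Longrightarrow> dcd C p U V \<in> borel_measurable C"
proof -
  assume [measurable]: "U \<in> measurable C (euclid p)" "V \<in> measurable C (euclid p)"
  have "(\<lambda>\<omega>. case_prod (edist p) (U \<omega>, V \<omega>)) \<in> borel_measurable C" by measurable
  then show ?thesis unfolding dcd_def[abs_def] cond_exp_given_def by (auto intro!: borel_measurable_add borel_measurable_diff borel_measurable_cond_exp2)
qed

text \<open>The random variables \<open>dcd\<close> involve conditional expectations; almost surely they are values of the
  kernel \<open>centered_dist\<close> at independent arguments.\<close>
lemma copies_moments:
  assumes "iid_from C {1..4::nat} Z (euclid p) F"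
  shows "(\<integral>\<omega>. (dcd C p (Z 1) (Z 2) \<omega>)\<^sup>2 \<partial>C) = m2"
    and "(\<integral>\<omega>. dcd C p (Z 1) (Z 2) \<omega> ^ 4 \<partial>C) = m4"
    and "(\<integral>\<omega>. dcd C p (Z 1) (Z 3) \<omega> * dcd C p (Z 2) (Z 3) \<omega>
        * dcd C p (Z 1) (Z 4) \<omega> * dcd C p (Z 2) (Z 4) \<omega> \<partial>C) = cyc"
proof -
  let ?I = "{1..4::nat}" and ?Z = "\<lambda>\<omega>. \<lambda>i\<in>{1..4}. Z i \<omega>"
  interpret C: prob_space C using assms by (simp add: iid_from_def)
  interpret K: kernel_sample F centered_dist "{1..4}" by unfold_locales simp
  have ind: "C.indep_vars (\<lambda>_. euclid p) Z ?I" and D: "\<And>i. i \<in> ?I \<Longrightarrow> distr C (euclid p) (Z i) = F"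
    using assms by (auto simp: iid_from_def)
  have Zm: "Z i \<in> measurable C (euclid p)" if "i \<in> ?I" for i
    using ind that by (auto simp: C.indep_vars_def)
  have sP: "sets (Pi\<^sub>M ?I (\<lambda>_. euclid p)) = sets (Pi\<^sub>M ?I (\<lambda>_. F))"
    by (intro sets_PiM_cong) (simp_all add: F_sets)
  have "distr C (Pi\<^sub>M ?I (\<lambda>_. euclid p)) ?Z = Pi\<^sub>M ?I (\<lambda>i. distr C (euclid p) (Z i))"
    using C.indep_vars_iff_distr_eq_PiM'[of ?I Z "\<lambda>_. euclid p"] ind Zm by auto
  also have "\<dots> = Pi\<^sub>M ?I (\<lambda>_. F)" by (intro PiM_cong refl D)
  finally have "distr C (Pi\<^sub>M ?I (\<lambda>_. euclid p)) ?Z = Pi\<^sub>M ?I (\<lambda>_. F)" .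
  moreover have "distr C (Pi\<^sub>M ?I (\<lambda>_. F)) ?Z = distr C (Pi\<^sub>M ?I (\<lambda>_. euclid p)) ?Z"
    by (rule distr_cong[OF refl sP[symmetric] refl])
  ultimately have law: "distr C (Pi\<^sub>M ?I (\<lambda>_. F)) ?Z = Pi\<^sub>M ?I (\<lambda>_. F)" by simp
  have Zm': "?Z \<in> measurable C (Pi\<^sub>M ?I (\<lambda>_. F))"
    using Zm by (intro measurable_restrict) (simp cong: measurable_cong_sets add: F_sets)
  have pair: "distr C (euclid p \<Otimes>\<^sub>M euclid p) (\<lambda>\<omega>. (Z i \<omega>, Z j \<omega>)) = F \<Otimes>\<^sub>M F"
    if ij: "i \<in> ?I" "j \<in> ?I" "i \<noteq> j" for i j
  proof -
    have "distr C (euclid p \<Otimes>\<^sub>M euclid p) (\<lambda>\<omega>. (Z i \<omega>, Z j \<omega>)) = distr C (F \<Otimes>\<^sub>M F) (\<lambda>\<omega>. (Z i \<omega>, Z j \<omega>))"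
      by (rule distr_cong) (auto intro!: sets_pair_measure_cong simp: F_sets)
    also have "\<dots> = distr (distr C (Pi\<^sub>M ?I (\<lambda>_. F)) ?Z) (F \<Otimes>\<^sub>M F) (\<lambda>x. (x i, x j))"
      using ij by (subst distr_distr[OF _ Zm'])
        (auto intro!: measurable_Pair K.component_meas arg_cong[where f = "distr C (F \<Otimes>\<^sub>M F)"] simp: comp_def)
    also have "\<dots> = F \<Otimes>\<^sub>M F" unfolding law by (rule K.pair_distr[OF ij])
    finally show ?thesis .
  qed
  have dc: "AE \<omega> in C. dcd C p (Z i) (Z j) \<omega> = H i j (?Z \<omega>)" if ij: "i \<in> ?I" "j \<in> ?I" "i \<noteq> j" for i j
    using dcd_eq_centered_dist[OF C.prob_space_axioms Zm[OF ij(1)] Zm[OF ij(2)] pair[OF ij] pair[OF ij(2,1)]] ij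
    by (auto simp: H_def)
  have dm: "dcd C p (Z i) (Z j) \<in> borel_measurable C" if "i \<in> ?I" "j \<in> ?I" for i j
    by (rule dcd_meas[OF Zm[OF that(1)] Zm[OF that(2)]])
  have tr: "(\<integral>\<omega>. f \<omega> \<partial>C) = (\<integral>x. f' x \<partial>Pi\<^sub>M ?I (\<lambda>_. F))"
    if "f \<in> borel_measurable C" "f' \<in> borel_measurable (Pi\<^sub>M ?I (\<lambda>_. F))" "AE \<omega> in C. f \<omega> = f' (?Z \<omega>)"
    for f f' :: "_ \<Rightarrow> real"
  proof -
    have "(\<integral>\<omega>. f \<omega> \<partial>C) = (\<integral>\<omega>. f' (?Z \<omega>) \<partial>C)"
      by (rule integral_cong_AE) (use that measurable_compose[OF Zm' that(2)] in auto)
    then show ?thesis using integral_distr[OF Zm' that(2)] unfolding law by simp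
  qed
  have "(\<integral>\<omega>. (dcd C p (Z 1) (Z 2) \<omega>)\<^sup>2 \<partial>C) = (\<integral>x. (H 1 2 x)\<^sup>2 \<partial>Pi\<^sub>M ?I (\<lambda>_. F))"
    by (rule tr) (use dm[of 1 2] dc[of 1 2] K.H_meas[of 1 2] in auto)
  also have "\<dots> = m2" by (rule K.H_square) auto
  finally show "(\<integral>\<omega>. (dcd C p (Z 1) (Z 2) \<omega>)\<^sup>2 \<partial>C) = m2" .
  have "(\<integral>\<omega>. dcd C p (Z 1) (Z 2) \<omega> ^ 4 \<partial>C) = (\<integral>x. H 1 2 x ^ 4 \<partial>Pi\<^sub>M ?I (\<lambda>_. F))"
    by (rule tr) (use dm[of 1 2] dc[of 1 2] K.H_meas[of 1 2] in auto)
  also have "\<dots> = m4" by (rule K.H_fourth) auto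
  finally show "(\<integral>\<omega>. dcd C p (Z 1) (Z 2) \<omega> ^ 4 \<partial>C) = m4" .
  have "(\<integral>\<omega>. dcd C p (Z 1) (Z 3) \<omega> * dcd C p (Z 2) (Z 3) \<omega>
        * dcd C p (Z 1) (Z 4) \<omega> * dcd C p (Z 2) (Z 4) \<omega> \<partial>C)
      = (\<integral>x. H 1 3 x * H 2 3 x * H 1 4 x * H 2 4 x \<partial>Pi\<^sub>M ?I (\<lambda>_. F))"
    by (rule tr) (use dm[of 1 3] dm[of 2 3] dm[of 1 4] dm[of 2 4] K.H_meas[of 1 3] K.H_meas[of 2 3]
        K.H_meas[of 1 4] K.H_meas[of 2 4] dc[of 1 3] dc[of 2 3] dc[of 1 4] dc[of 2 4] in auto)
  also have "\<dots> = cyc" by (rule K.cycle_moment) auto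
  finally show "(\<integral>\<omega>. dcd C p (Z 1) (Z 3) \<omega> * dcd C p (Z 2) (Z 3) \<omega>
        * dcd C p (Z 1) (Z 4) \<omega> * dcd C p (Z 2) (Z 4) \<omega> \<partial>C) = cyc" .
qed

end

section \<open>Conditioning on the labels\<close>

text \<open>An i.i.d. sample of features and labels, where within an observation the feature is independent of
  the label. The assumption \<open>cell\<close> states the joint law of an observation on rectangles.\<close>
locale labelled_sample = euclid_law F p for F p +
  fixes L :: "'l set" and pr :: "'l \<Rightarrow> real" and n :: nat
    and S :: "'b measure" and Xs :: "nat \<Rightarrow> 'b \<Rightarrow> nat \<Rightarrow> real" and Ys :: "nat \<Rightarrow> 'b \<Rightarrow> 'l"
  assumes L_fin: "finite L" and L_card: "card L \<ge> 2" and n_pos: "n > 0"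
    and S_prob: "prob_space S"
    and indep: "prob_space.indep_vars S (\<lambda>_. euclid p \<Otimes>\<^sub>M count_space L) (\<lambda>i \<omega>. (Xs i \<omega>, Ys i \<omega>)) {..<n}"
    and cell: "\<And>i B k. i < n \<Longrightarrow> B \<in> sets (euclid p) \<Longrightarrow> k \<in> L \<Longrightarrow>
      measure S {\<omega> \<in> space S. Xs i \<omega> \<in> B \<and> Ys i \<omega> = k} = measure F B * pr k"
begin

sublocale S: prob_space S by (rule S_prob)

sublocale K: kernel_sample F centered_dist "{..<n}" by unfold_locales simp

abbreviation PF where "PF \<equiv> Pi\<^sub>M {..<n} (\<lambda>_. F)"

definition sample_vec :: "'b \<Rightarrow> nat \<Rightarrow> nat \<Rightarrow> real" where "sample_vec \<omega> = (\<lambda>i\<in>{..<n}. Xs i \<omega>)"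
definition label_vec :: "'b \<Rightarrow> nat \<Rightarrow> 'l" where "label_vec \<omega> = (\<lambda>i\<in>{..<n}. Ys i \<omega>)"
definition labellings :: "(nat \<Rightarrow> 'l) set" where "labellings = {..<n} \<rightarrow>\<^sub>E L"
text \<open>There are finitely many of these events, so conditioning on the labels is elementary.\<close>
definition label_event :: "(nat \<Rightarrow> 'l) \<Rightarrow> 'b set" where "label_event y = {\<omega> \<in> space S. label_vec \<omega> = y}"

lemma labellings_finite [simp]: "finite labellings"
  unfolding labellings_def using L_fin by (intro finite_PiE) auto

lemma pair_meas: "i < n \<Longrightarrow> (\<lambda>\<omega>. (Xs i \<omega>, Ys i \<omega>)) \<in> measurable S (euclid p \<Otimes>\<^sub>M count_space L)"
  using indep by (auto simp: S.indep_vars_def)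

lemma Xs_meas: "i < n \<Longrightarrow> Xs i \<in> measurable S (euclid p)"
  using measurable_compose[OF pair_meas measurable_fst] by simp

lemma Ys_meas [measurable]: "i < n \<Longrightarrow> Ys i \<in> measurable S (count_space L)"
  using measurable_compose[OF pair_meas measurable_snd] by simp

lemma sample_vec_meas: "sample_vec \<in> measurable S PF"
  unfolding sample_vec_def[abs_def]
  by (intro measurable_restrict) (simp cong: measurable_cong_sets add: F_sets Xs_meas)

lemma label_vec_mem: "\<omega> \<in> space S \<Longrightarrow> label_vec \<omega> \<in> labellings"
  unfolding label_vec_def labellings_def using measurable_space[OF Ys_meas] by auto

lemma label_vec_eq: "y \<in> labellings \<Longrightarrow> label_vec \<omega> = y \<longleftrightarrow> (\<forall>i<n. Ys i \<omega> = y i)"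
  unfolding label_vec_def labellings_def by (auto simp: fun_eq_iff PiE_def extensional_def)

lemma label_event_sets [measurable]: "y \<in> labellings \<Longrightarrow> label_event y \<in> sets S"
proof -
  assume y: "y \<in> labellings"
  have "{\<omega> \<in> space S. Ys i \<omega> = y i} \<in> sets S" if "i < n" for i
  proof -
    have "y i \<in> L" using y that by (auto simp: labellings_def)
    then have "Ys i -` {y i} \<inter> space S \<in> sets S" using that by (intro measurable_sets[OF Ys_meas]) auto
    then show ?thesis by (simp add: vimage_def Int_def conj_commute)
  qed
  then have "{\<omega> \<in> space S. \<forall>i\<in>{..<n}. Ys i \<omega> = y i} \<in> sets S" by (intro sets.sets_Collect_finite_All) auto
  moreover have "label_event y = {\<omega> \<in> space S. \<forall>i\<in>{..<n}. Ys i \<omega> = y i}"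
    unfolding label_event_def label_vec_eq[OF y] by auto
  ultimately show ?thesis by simp
qed

lemma sum_indicator_label_event:
  fixes f :: "(nat \<Rightarrow> 'l) \<Rightarrow> 'c::real_vector"
  assumes "\<omega> \<in> space S"
  shows "(\<Sum>y\<in>labellings. indicator (label_event y) \<omega> *\<^sub>R f y) = f (label_vec \<omega>)"
proof -
  have "(\<Sum>y\<in>labellings. indicator (label_event y) \<omega> *\<^sub>R f y) = (\<Sum>y\<in>labellings. if y = label_vec \<omega> then f y else 0)"
    using assms by (intro sum.cong refl) (auto simp: label_event_def)
  also have "\<dots> = f (label_vec \<omega>)" using label_vec_mem[OF assms] by simp
  finally show ?thesis .
qed

lemma box_prob:
  assumes y: "y \<in> labellings" and B: "\<And>i. i < n \<Longrightarrow> B i \<in> sets (euclid p)"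
  shows "measure S {\<omega> \<in> space S. (\<forall>i<n. Xs i \<omega> \<in> B i) \<and> label_vec \<omega> = y} = (\<Prod>i<n. measure F (B i) * pr (y i))"
proof -
  let ?Z = "\<lambda>i \<omega>. (Xs i \<omega>, Ys i \<omega>)"
  have yi: "y i \<in> L" if "i < n" for i using y that by (auto simp: labellings_def)
  have "measure S (\<Inter>i\<in>{..<n}. ?Z i -` (B i \<times> {y i}) \<inter> space S)
      = (\<Prod>i<n. measure S (?Z i -` (B i \<times> {y i}) \<inter> space S))"
    using n_pos by (intro S.indep_varsD[OF indep]) (auto intro!: pair_measureI B yi)
  also have "(\<Inter>i\<in>{..<n}. ?Z i -` (B i \<times> {y i}) \<inter> space S)
      = {\<omega> \<in> space S. (\<forall>i<n. Xs i \<omega> \<in> B i) \<and> label_vec \<omega> = y}"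
    unfolding label_vec_eq[OF y] using n_pos by auto
  also have "(\<Prod>i<n. measure S (?Z i -` (B i \<times> {y i}) \<inter> space S)) = (\<Prod>i<n. measure F (B i) * pr (y i))"
  proof (rule prod.cong[OF refl])
    fix i assume "i \<in> {..<n}"
    then have i: "i < n" by simp
    have "?Z i -` (B i \<times> {y i}) \<inter> space S = {\<omega> \<in> space S. Xs i \<omega> \<in> B i \<and> Ys i \<omega> = y i}" by auto
    then show "measure S (?Z i -` (B i \<times> {y i}) \<inter> space S) = measure F (B i) * pr (y i)"
      using cell[OF i B[OF i] yi[OF i]] by simp
  qed
  finally show ?thesis .
qed

lemma label_event_prob:
  assumes "y \<in> labellings"
  shows "measure S (label_event y) = (\<Prod>i<n. pr (y i))"
proof -
  have "label_event y = {\<omega> \<in> space S. (\<forall>i<n. Xs i \<omega> \<in> space (euclid p)) \<and> label_vec \<omega> = y}"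
    unfolding label_event_def using measurable_space[OF Xs_meas] by blast
  also have "measure S \<dots> = (\<Prod>i<n. measure F (space (euclid p)) * pr (y i))"
    by (rule box_prob[OF assms]) simp
  finally show ?thesis by (simp add: F_space[symmetric] prob_space)
qed

text \<open>On the event that the labels are \<open>y\<close>, the features still follow the product law: both sides are
  integrals with respect to finite measures that agree on boxes.\<close>
lemma integral_given_labels:
  fixes f :: "(nat \<Rightarrow> nat \<Rightarrow> real) \<Rightarrow> complex"
  assumes y: "y \<in> labellings" and f: "f \<in> borel_measurable PF"
  shows "(\<integral>\<omega>. indicator (label_event y) \<omega> *\<^sub>R f (sample_vec \<omega>) \<partial>S) = measure S (label_event y) *\<^sub>R (\<integral>x. f x \<partial>PF)"
proof -
  let ?D = "density S (\<lambda>\<omega>. ennreal (indicator (label_event y) \<omega>))"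
  let ?N1 = "distr ?D PF sample_vec"
  let ?N2 = "density PF (\<lambda>_. ennreal (measure S (label_event y)))"
  note As = label_event_sets[OF y]
  have XX1: "sample_vec \<in> measurable ?D PF"
    using sample_vec_meas by (simp cong: measurable_cong_sets)
  have "?N1 = ?N2"
  proof (rule measure_eqI_PiM_finite[of "{..<n}" _ "\<lambda>_. F" _ "\<lambda>_. space PF"])
    fix B :: "nat \<Rightarrow> (nat \<Rightarrow> real) set" assume "\<And>i. i \<in> {..<n} \<Longrightarrow> B i \<in> sets F"
    then have B: "\<And>i. i < n \<Longrightarrow> B i \<in> sets F" by simp
    have Bs: "Pi\<^sub>E {..<n} B \<in> sets PF" using B by (intro sets_PiM_I_finite) auto
    let ?pre = "sample_vec -` Pi\<^sub>E {..<n} B \<inter> space S"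
    have XXB: "?pre \<in> sets S" by (rule measurable_sets[OF sample_vec_meas Bs])
    have "emeasure ?N1 (Pi\<^sub>E {..<n} B)
        = emeasure ?D ?pre"
      by (subst emeasure_distr[OF XX1 Bs]) simp
    also have "\<dots> = (\<integral>\<^sup>+\<omega>. ennreal (indicator (label_event y) \<omega>) * indicator ?pre \<omega> \<partial>S)"
      using As XXB by (intro emeasure_density) auto
    also have "\<dots> = (\<integral>\<^sup>+\<omega>. indicator (label_event y \<inter> ?pre) \<omega> \<partial>S)"
      by (intro nn_integral_cong) (auto simp: indicator_def)
    also have "\<dots> = emeasure S (label_event y \<inter> ?pre)"
      using As XXB by (intro nn_integral_indicator) auto
    also have "label_event y \<inter> ?pre
        = {\<omega> \<in> space S. (\<forall>i<n. Xs i \<omega> \<in> B i) \<and> label_vec \<omega> = y}"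
    proof -
      have "sample_vec \<omega> \<in> Pi\<^sub>E {..<n} B \<longleftrightarrow> (\<forall>i<n. Xs i \<omega> \<in> B i)" for \<omega>
        unfolding sample_vec_def PiE_def Pi_def by simp
      then show ?thesis unfolding label_event_def by blast
    qed
    also have "emeasure S \<dots> = ennreal (\<Prod>i<n. measure F (B i) * pr (y i))"
      using box_prob[OF y, of B] B by (simp add: S.emeasure_eq_measure F_sets)
    also have "\<dots> = ennreal (measure S (label_event y)) * ennreal (\<Prod>i<n. measure F (B i))"
      by (simp add: label_event_prob[OF y, symmetric] prod.distrib prod_nonneg ennreal_mult'' mult.commute)
    also have "ennreal (\<Prod>i<n. measure F (B i)) = emeasure PF (Pi\<^sub>E {..<n} B)"
      using B by (subst K.PP.measure_times) (auto simp: emeasure_eq_measure prod_ennreal)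
    also have "ennreal (measure S (label_event y)) * emeasure PF (Pi\<^sub>E {..<n} B) = emeasure ?N2 (Pi\<^sub>E {..<n} B)"
      using Bs by (subst emeasure_density) (auto simp: nn_integral_cmult_indicator)
    finally show "emeasure ?N1 (Pi\<^sub>E {..<n} B) = emeasure ?N2 (Pi\<^sub>E {..<n} B)" .
  next
    show "range (\<lambda>_. space PF) \<subseteq> prod_algebra {..<n} (\<lambda>_. F)"
      using space_in_prod_algebra[of "{..<n}" "\<lambda>_. F"] by (auto simp: space_PiM)
    fix i :: nat
    have "emeasure ?N1 (space PF) = emeasure ?D (sample_vec -` space PF \<inter> space S)"
      by (subst emeasure_distr[OF XX1]) auto
    also have "\<dots> = (\<integral>\<^sup>+\<omega>. ennreal (indicator (label_event y) \<omega>) * indicator (sample_vec -` space PF \<inter> space S) \<omega> \<partial>S)"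
      using As measurable_sets[OF sample_vec_meas sets.top] by (intro emeasure_density) auto
    also have "\<dots> \<le> (\<integral>\<^sup>+\<omega>. 1 \<partial>S)"
      by (intro nn_integral_mono) (auto simp: indicator_def)
    also have "\<dots> = 1" by (simp add: S.emeasure_space_1)
    finally show "emeasure ?N1 (space PF) \<noteq> \<infinity>" by (auto simp: top_unique)
  qed auto
  then have "(\<integral>x. f x \<partial>?N1) = (\<integral>x. f x \<partial>?N2)" by simp
  moreover have "(\<integral>x. f x \<partial>?N1) = (\<integral>\<omega>. indicator (label_event y) \<omega> *\<^sub>R f (sample_vec \<omega>) \<partial>S)"
    using integral_distr[OF XX1 f] measurable_compose[OF sample_vec_meas f] As
    by (simp add: integral_density)
  moreover have "(\<integral>x. f x \<partial>?N2) = measure S (label_event y) *\<^sub>R (\<integral>x. f x \<partial>PF)"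
    using f by (subst integral_density) auto
  ultimately show ?thesis by simp
qed

lemma integral_by_labels:
  fixes \<Phi> :: "(nat \<Rightarrow> 'l) \<Rightarrow> (nat \<Rightarrow> nat \<Rightarrow> real) \<Rightarrow> complex"
  assumes \<Phi>: "\<And>y. y \<in> labellings \<Longrightarrow> \<Phi> y \<in> borel_measurable PF" and bnd: "\<And>y x. cmod (\<Phi> y x) \<le> 1"
  shows "(\<integral>\<omega>. \<Phi> (label_vec \<omega>) (sample_vec \<omega>) \<partial>S) = (\<Sum>y\<in>labellings. measure S (label_event y) *\<^sub>R (\<integral>x. \<Phi> y x \<partial>PF))"
proof -
  have int: "integrable S (\<lambda>\<omega>. indicator (label_event y) \<omega> *\<^sub>R \<Phi> y (sample_vec \<omega>))" if y: "y \<in> labellings" for y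
  proof (rule S.integrable_const_bound[of _ 1])
    show "AE \<omega> in S. cmod (indicator (label_event y) \<omega> *\<^sub>R \<Phi> y (sample_vec \<omega>)) \<le> 1"
      using bnd by (intro AE_I2) (auto simp: indicator_def)
    show "(\<lambda>\<omega>. indicator (label_event y) \<omega> *\<^sub>R \<Phi> y (sample_vec \<omega>)) \<in> borel_measurable S"
      using label_event_sets[OF y] measurable_compose[OF sample_vec_meas \<Phi>[OF y]] by auto
  qed
  have "(\<integral>\<omega>. \<Phi> (label_vec \<omega>) (sample_vec \<omega>) \<partial>S) = (\<integral>\<omega>. (\<Sum>y\<in>labellings. indicator (label_event y) \<omega> *\<^sub>R \<Phi> y (sample_vec \<omega>)) \<partial>S)"
  proof (rule Bochner_Integration.integral_cong[OF refl])
    fix \<omega> assume "\<omega> \<in> space S"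
    from sum_indicator_label_event[OF this, of "\<lambda>y. \<Phi> y (sample_vec \<omega>)"]
    show "\<Phi> (label_vec \<omega>) (sample_vec \<omega>) = (\<Sum>y\<in>labellings. indicator (label_event y) \<omega> *\<^sub>R \<Phi> y (sample_vec \<omega>))" ..
  qed
  also have "\<dots> = (\<Sum>y\<in>labellings. \<integral>\<omega>. indicator (label_event y) \<omega> *\<^sub>R \<Phi> y (sample_vec \<omega>) \<partial>S)"
    by (rule Bochner_Integration.integral_sum[OF int])
  also have "\<dots> = (\<Sum>y\<in>labellings. measure S (label_event y) *\<^sub>R (\<integral>x. \<Phi> y x \<partial>PF))"
    by (intro sum.cong refl integral_given_labels \<Phi>)
  finally show ?thesis .
qed

lemma measurable_by_labels:
  fixes \<Phi> :: "(nat \<Rightarrow> 'l) \<Rightarrow> (nat \<Rightarrow> nat \<Rightarrow> real) \<Rightarrow> real"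
  assumes \<Phi>: "\<And>y. y \<in> labellings \<Longrightarrow> \<Phi> y \<in> borel_measurable PF"
  shows "(\<lambda>\<omega>. \<Phi> (label_vec \<omega>) (sample_vec \<omega>)) \<in> borel_measurable S"
proof -
  have "(\<lambda>\<omega>. \<Sum>y\<in>labellings. indicator (label_event y) \<omega> *\<^sub>R \<Phi> y (sample_vec \<omega>)) \<in> borel_measurable S"
    using label_event_sets measurable_compose[OF sample_vec_meas \<Phi>] by (intro borel_measurable_sum) auto
  moreover have "(\<lambda>\<omega>. \<Sum>y\<in>labellings. indicator (label_event y) \<omega> *\<^sub>R \<Phi> y (sample_vec \<omega>)) \<in> borel_measurable S
      \<longleftrightarrow> (\<lambda>\<omega>. \<Phi> (label_vec \<omega>) (sample_vec \<omega>)) \<in> borel_measurable S"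
  proof (rule measurable_cong)
    fix \<omega> assume "\<omega> \<in> space S"
    from sum_indicator_label_event[OF this, of "\<lambda>y. \<Phi> y (sample_vec \<omega>)"]
    show "(\<Sum>y\<in>labellings. indicator (label_event y) \<omega> *\<^sub>R \<Phi> y (sample_vec \<omega>)) = \<Phi> (label_vec \<omega>) (sample_vec \<omega>)" .
  qed
  ultimately show ?thesis by simp
qed

lemma sum_prob_label_event: "B \<subseteq> labellings \<Longrightarrow> (\<Sum>y\<in>B. measure S (label_event y)) = measure S (\<Union>y\<in>B. label_event y)"
proof (rule S.finite_measure_finite_Union[symmetric])
  assume B: "B \<subseteq> labellings"
  then show "finite B" by (rule finite_subset) simp
  show "label_event ` B \<subseteq> sets S" using B label_event_sets by auto
  show "disjoint_family_on label_event B" by (auto simp: disjoint_family_on_def label_event_def)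
qed

lemma total_prob_label_event: "(\<Sum>y\<in>labellings. measure S (label_event y)) = 1"
proof -
  have "(\<Sum>y\<in>labellings. measure S (label_event y)) = measure S (\<Union>y\<in>labellings. label_event y)"
    by (rule sum_prob_label_event) simp
  also have "(\<Union>y\<in>labellings. label_event y) = space S" using label_vec_mem by (auto simp: label_event_def)
  finally show ?thesis by (simp add: S.prob_space)
qed

definition stat :: "(nat \<Rightarrow> 'l) \<Rightarrow> (nat \<Rightarrow> nat \<Rightarrow> real) \<Rightarrow> real" where
  "stat y x = gCov p n L x y / sqrt (sigma0_sq p n L x y)"

lemma class_idx_restrict: "class_idx n (\<lambda>i\<in>{..<n}. y i) k = class_idx n y k"
  by (auto simp: class_idx_def)

lemma stat_restrict: "stat (label_vec \<omega>) (sample_vec \<omega>)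
  = gCov p n L (\<lambda>i. Xs i \<omega>) (\<lambda>i. Ys i \<omega>) / sqrt (sigma0_sq p n L (\<lambda>i. Xs i \<omega>) (\<lambda>i. Ys i \<omega>))"
proof -
  have c: "class_idx n (label_vec \<omega>) k = class_idx n (\<lambda>i. Ys i \<omega>) k" for k
    unfolding label_vec_def by (rule class_idx_restrict)
  have x: "sample_vec \<omega> i = Xs i \<omega>" if "i < n" for i using that by (simp add: sample_vec_def)
  have u: "ustat p (sample_vec \<omega>) I = ustat p (\<lambda>i. Xs i \<omega>) I" if "I \<subseteq> {..<n}" for I
    unfolding ustat_def using that x
    by (intro arg_cong2[where f = "(/)"] refl sum.cong) auto
  have uc: "ustat p (sample_vec \<omega>) (class_idx n y k) = ustat p (\<lambda>i. Xs i \<omega>) (class_idx n y k)" for y :: "nat \<Rightarrow> 'l" and k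
    by (rule u) (auto simp: class_idx_def)
  have "gCov p n L (sample_vec \<omega>) (label_vec \<omega>) = gCov p n L (\<lambda>i. Xs i \<omega>) (\<lambda>i. Ys i \<omega>)"
    unfolding gCov_def phat_def class_size_def c uc u[OF order_refl] ..
  moreover have "Vn2 p n (sample_vec \<omega>) = Vn2 p n (\<lambda>i. Xs i \<omega>)"
    unfolding Vn2_def ucent_def using x by (auto intro!: sum.cong arg_cong2[where f = "(/)"])
  then have "sigma0_sq p n L (sample_vec \<omega>) (label_vec \<omega>) = sigma0_sq p n L (\<lambda>i. Xs i \<omega>) (\<lambda>i. Ys i \<omega>)"
    unfolding sigma0_sq_def phat_def class_size_def c by simp
  ultimately show ?thesis by (simp add: stat_def)
qed

lemma edist_coord_meas: "i < n \<Longrightarrow> j < n \<Longrightarrow> (\<lambda>x. edist p (x i) (x j)) \<in> borel_measurable PF"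
proof -
  assume ij: "i < n" "j < n"
  have "(\<lambda>x. (x i, x j)) \<in> measurable PF (F \<Otimes>\<^sub>M F)"
    using ij by (intro measurable_Pair K.component_meas) auto
  from measurable_compose[OF this edist_meas_FF] show ?thesis by simp
qed

lemma stat_meas: "stat y \<in> borel_measurable PF"
proof -
  note e = edist_coord_meas
  have u: "(\<lambda>x. ustat p x I) \<in> borel_measurable PF" if "I \<subseteq> {..<n}" for I
    unfolding ustat_def using that e
    by (intro borel_measurable_divide borel_measurable_sum) auto
  have "class_idx n y k \<subseteq> {..<n}" for k by (auto simp: class_idx_def)
  then have "(\<lambda>x. gCov p n L x y) \<in> borel_measurable PF"
    unfolding gCov_def using u by (intro borel_measurable_diff borel_measurable_sum borel_measurable_times) auto
  moreover have "(\<lambda>x. Vn2 p n x) \<in> borel_measurable PF"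
    unfolding Vn2_def ucent_def using e
    by (intro borel_measurable_divide borel_measurable_sum borel_measurable_power borel_measurable_add
        borel_measurable_diff) auto
  ultimately show ?thesis unfolding stat_def[abs_def] sigma0_sq_def by simp
qed

text \<open>If every class has at least \<open>n \<rho> / 2\<close> members, each weight is at most of order \<open>1 / n\<^sup>2\<close>, and the
  sum of the squared weights is at least of that order. After normalization the weights are at most
  \<open>c / (n * sqrt m2)\<close> with \<open>c = 8 / \<rho>\<close>, as the bound for fixed weights requires.\<close>
lemma stat_char_given_labels:
  assumes y: "y \<in> labellings" and m2: "m2 > 0" and n: "n \<ge> 4" and \<rho>: "\<rho> > 0" "real n * \<rho> / 2 \<ge> 2"
    and good: "\<And>k. k \<in> L \<Longrightarrow> real (class_size n y k) \<ge> real n * \<rho> / 2"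
    and pos: "\<epsilon> > 0" "\<eta> > 0" "\<delta> > 0" "\<delta> \<le> 1 / 2"
    and \<epsilon>: "(8 / \<rho>) ^ 4 * (16 * (m4 / (real n * m2\<^sup>2)) + \<bar>cyc\<bar> / m2\<^sup>2) \<le> \<epsilon>\<^sup>2"
    and \<eta>: "64 * (m4 / (real n * m2\<^sup>2)) \<le> \<eta>\<^sup>2" and n\<eta>: "40 / real n \<le> \<eta>"
  shows "cmod ((\<integral>x. iexp (t * stat y x) \<partial>PF) - of_real (exp (- (t\<^sup>2 / 2))))
    \<le> \<epsilon> * (t\<^sup>2 + \<bar>t\<bar> ^ 3) + (\<bar>t\<bar> * \<delta> + 4 * \<eta> / \<delta>)"
proof -
  interpret W: class_weights n L y
  proof
    show "finite L" "2 \<le> card L" by (rule L_fin, rule L_card)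
    show "\<And>i. i < n \<Longrightarrow> y i \<in> L" using y by (auto simp: labellings_def)
    show "2 \<le> class_size n y k" if "k \<in> L" for k using good[OF that] \<rho>(2) by linarith
  qed
  define q where "q = sqrt (W.weight_var * m2)"
  define a where "a i j = W.pair_weight i j / q" for i j
  \<comment> \<open>The weights are at most \<open>8 / (\<rho> n\<^sup>2)\<close> and \<open>q\<close> is at least \<open>sqrt m2 / n\<close>.\<close>
  define b where "b = (8 / \<rho>) / (real n * sqrt m2)"
  have n0: "real n > 0" using n by simp
  have \<sigma>0: "W.weight_var > 0" using W.weight_var_ge n0 by (smt (verit) divide_pos_pos zero_less_power)
  have q2: "q\<^sup>2 = W.weight_var * m2" "q > 0" using \<sigma>0 m2 by (simp_all add: q_def)
  have q_ge: "q \<ge> sqrt m2 / real n"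
  proof -
    have "m2 / (real n)\<^sup>2 \<le> W.weight_var * m2"
      using W.weight_var_ge m2 mult_right_mono[of "1 / (real n)\<^sup>2" W.weight_var m2] n0
      by (simp add: order_trans[OF divide_right_mono[of 1 2]])
    then have "sqrt (m2 / (real n)\<^sup>2) \<le> q" unfolding q_def by (rule real_sqrt_le_mono)
    then show ?thesis using n0 by (simp add: real_sqrt_divide)
  qed
  interpret WS: weighted_sample F centered_dist "{..<n}" a b
  proof
    show "a i k = a k i" for i k by (simp add: a_def W.pair_weight_sym)
    show "a i i = 0" for i by (simp add: a_def)
    fix i k assume "i \<in> {..<n}" "k \<in> {..<n}"
    then have "\<bar>W.pair_weight i k\<bar> \<le> 8 / \<rho> / (real n)\<^sup>2" using W.pair_weight_bound[of i k \<rho>] \<rho> good by auto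
    then have "\<bar>a i k\<bar> \<le> (8 / \<rho> / (real n)\<^sup>2) / (sqrt m2 / real n)"
      unfolding a_def abs_divide using q2 q_ge m2 n0 \<rho> by (intro frac_le) auto
    also have "\<dots> = b" unfolding b_def using n0 m2 by (simp add: power2_eq_square)
    finally show "\<bar>a i k\<bar> \<le> b" .
  qed
  have norm1: "(\<Sum>i<n. \<Sum>k<n. (a i k)\<^sup>2) * m2 = 2"
  proof -
    have "(\<Sum>i<n. \<Sum>k<n. (a i k)\<^sup>2) = (\<Sum>i<n. \<Sum>k<n. (W.pair_weight i k)\<^sup>2) / q\<^sup>2"
      by (simp add: a_def power_divide sum_divide_distrib)
    then show ?thesis using \<sigma>0 m2 by (simp add: W.sum_pair_weight_square q2)
  qed
  have stat: "stat y x = WS.S x / sqrt (K.U_var n x / m2)" for x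
  proof -
    define E where "E i j = H i j x" for i j
    define e where "e i = mean_dist (x i) - grand_mean / 2" for i
    have D: "edist p (x i) (x j) = (if i = j then 0 else E i j + e i + e j)" for i j
    proof (cases "i = j")
      case False
      then show ?thesis by (simp add: E_def e_def H_def edist_centered_dist)
    qed simp
    have E0: "E i i = 0" for i by (simp add: E_def)
    have gc: "gCov p n L x y = q * WS.S x"
    proof -
      have "WS.S x = (\<Sum>k<n. \<Sum>i<n. W.pair_weight i k * E i k) / q / 2"
        unfolding WS.S_def WS.T_def by (simp add: a_def E_def sum_divide_distrib)
      also have "(\<Sum>k<n. \<Sum>i<n. W.pair_weight i k * E i k) = (\<Sum>i<n. \<Sum>k<n. W.pair_weight i k * E i k)"
        by (rule sum.swap)
      finally show ?thesis using W.gCov_weights_additive[of p x E e, OF D E0] q2 by simp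
    qed
    have "ucent p n x k l = ucentered n E k l" if "k < n" "l < n" "k \<noteq> l" for k l
      using ucentered_additive[OF _ that D E0] n by (simp add: ucent_def ucentered_def)
    then have "Vn2 p n x = K.U_var n x"
      unfolding Vn2_def K.U_var_def E_def
      by (intro arg_cong2[where f = "(/)"] refl sum.cong) auto
    then have "sigma0_sq p n L x y = (W.weight_var * m2) * (K.U_var n x / m2)"
      using m2 by (simp add: sigma0_sq_def W.weight_var_def)
    then have "sqrt (sigma0_sq p n L x y) = q * sqrt (K.U_var n x / m2)"
      by (simp only: real_sqrt_mult q_def)
    then show ?thesis using q2 by (simp add: stat_def gc)
  qed
  show ?thesis
    unfolding stat
    by (rule WS.studentized_char_bound[OF refl n m2 norm1 b_def pos \<epsilon> \<eta> n\<eta>])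
qed

lemma class_size_sum: "real (class_size n (label_vec \<omega>) k) = (\<Sum>i<n. of_bool (Ys i \<omega> = k))"
proof -
  have "class_idx n (label_vec \<omega>) k = {i \<in> {..<n}. Ys i \<omega> = k}" by (auto simp: class_idx_def label_vec_def)
  then show ?thesis by (simp add: class_size_def of_bool_def sum.If_cases Int_def)
qed

abbreviation small :: "'l \<Rightarrow> real \<Rightarrow> 'b set" where
  "small k \<rho> \<equiv> {\<omega> \<in> space S. real (class_size n (label_vec \<omega>) k) < real n * \<rho> / 2}"

text \<open>The size of a class is a sum of independent indicators, so Hoeffding's inequality applies.\<close>
lemma small_class_prob:
  assumes k: "k \<in> L" and \<rho>: "\<rho> > 0" "\<rho> \<le> pr k"
  shows "measure S (small k \<rho>) \<le> exp (- (real n * \<rho>\<^sup>2 / 2))"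
proof -
  let ?X = "\<lambda>i \<omega>. of_bool (Ys i \<omega> = k) :: real"
  let ?dev = "{\<omega> \<in> space S. (\<Sum>i<n. ?X i \<omega>) \<le> (\<Sum>i<n. S.expectation (?X i)) - real n * \<rho> / 2}"
  have EX: "S.expectation (?X i) = pr k" if i: "i < n" for i
  proof -
    have "{\<omega> \<in> space S. Xs i \<omega> \<in> space (euclid p) \<and> Ys i \<omega> = k} = {\<omega> \<in> space S. Ys i \<omega> = k}"
      using measurable_space[OF Xs_meas[OF i]] by blast
    then have "measure S {\<omega> \<in> space S. Ys i \<omega> = k} = pr k"
      using cell[OF i sets.top k] by (simp add: F_space[symmetric] prob_space)
    moreover have "S.expectation (?X i) = (\<integral>\<omega>. indicator {\<omega> \<in> space S. Ys i \<omega> = k} \<omega> \<partial>S)"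
      by (intro Bochner_Integration.integral_cong refl) (simp add: indicator_def)
    ultimately show ?thesis by (simp add: Int_def conj_commute cong: conj_cong)
  qed
  have ind: "S.indep_vars (\<lambda>_. borel) ?X {..<n}"
  proof -
    have "(\<lambda>z. of_bool (snd z = k) :: real) \<in> borel_measurable (euclid p \<Otimes>\<^sub>M count_space L)"
      by (rule measurable_compose[OF measurable_snd]) simp
    from S.indep_vars_compose2[OF indep, of "\<lambda>_ z. of_bool (snd z = k) :: real" "\<lambda>_. borel"] this
    show ?thesis by simp
  qed
  interpret Hf: Hoeffding_ineq S "{..<n}" ?X "\<lambda>_. 0" "\<lambda>_. 1" "\<Sum>i<n. S.expectation (?X i)"
    by unfold_locales (use ind in auto)
  have "measure S (small k \<rho>)
      \<le> measure S ?dev"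
  proof (rule S.finite_measure_mono)
    have "(\<Sum>i<n. S.expectation (?X i)) = real n * pr k" using EX by simp
    moreover have "real n * \<rho> \<le> real n * pr k" using \<rho> by (intro mult_left_mono) auto
    ultimately show "small k \<rho>
      \<subseteq> ?dev"
      unfolding class_size_sum by auto
    have "(\<lambda>\<omega>. \<Sum>i<n. ?X i \<omega>) \<in> borel_measurable S"
      using Hf.random_variable by (intro borel_measurable_sum) auto
    then show "?dev \<in> sets S"
      by measurable
  qed
  also have "\<dots> \<le> exp (- 2 * (real n * \<rho> / 2)\<^sup>2 / (\<Sum>i<n. (1 - 0)\<^sup>2))"
    using \<rho> n_pos by (intro Hf.Hoeffding_ineq_le) auto
  also have "- 2 * (real n * \<rho> / 2)\<^sup>2 / (\<Sum>i<n. (1 - 0)\<^sup>2) = - (real n * \<rho>\<^sup>2 / 2)"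
    using n_pos by (simp add: power2_eq_square)
  finally show ?thesis .
qed

text \<open>Averaging over the labels: unbalanced labels contribute at most \<open>2\<close> each, weighted with an
  exponentially small probability.\<close>
lemma stat_char_bound:
  assumes m2: "m2 > 0" and n: "n \<ge> 4" and \<rho>: "\<rho> > 0" "real n * \<rho> / 2 \<ge> 2" "\<And>k. k \<in> L \<Longrightarrow> \<rho> \<le> pr k"
    and pos: "\<epsilon> > 0" "\<eta> > 0" "\<delta> > 0" "\<delta> \<le> 1 / 2"
    and \<epsilon>: "(8 / \<rho>) ^ 4 * (16 * (m4 / (real n * m2\<^sup>2)) + \<bar>cyc\<bar> / m2\<^sup>2) \<le> \<epsilon>\<^sup>2"
    and \<eta>: "64 * (m4 / (real n * m2\<^sup>2)) \<le> \<eta>\<^sup>2" and n\<eta>: "40 / real n \<le> \<eta>"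
  shows "cmod ((\<integral>\<omega>. iexp (t * stat (label_vec \<omega>) (sample_vec \<omega>)) \<partial>S) - of_real (exp (- (t\<^sup>2 / 2))))
    \<le> \<epsilon> * (t\<^sup>2 + \<bar>t\<bar> ^ 3) + (\<bar>t\<bar> * \<delta> + 4 * \<eta> / \<delta>) + 2 * (real (card L) * exp (- (real n * \<rho>\<^sup>2 / 2)))"
proof -
  let ?e = "of_real (exp (- (t\<^sup>2 / 2))) :: complex"
  let ?\<phi> = "\<lambda>y. \<integral>x. iexp (t * stat y x) \<partial>PF"
  let ?B = "\<epsilon> * (t\<^sup>2 + \<bar>t\<bar> ^ 3) + (\<bar>t\<bar> * \<delta> + 4 * \<eta> / \<delta>)"
  define bad where "bad = {y \<in> labellings. \<exists>k\<in>L. real (class_size n y k) < real n * \<rho> / 2}"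
  have B0: "?B \<ge> 0" using pos by (intro add_nonneg_nonneg mult_nonneg_nonneg divide_nonneg_nonneg) auto
  have bound: "cmod (?\<phi> y - ?e) \<le> ?B + 2 * of_bool (y \<in> bad)" if y: "y \<in> labellings" for y
  proof (cases "y \<in> bad")
    case False
    then have "real (class_size n y k) \<ge> real n * \<rho> / 2" if "k \<in> L" for k
      using y that by (auto simp: bad_def not_less)
    from stat_char_given_labels[OF y m2 n \<rho>(1,2) this pos \<epsilon> \<eta> n\<eta>] show ?thesis using False by simp
  next
    case True
    have "cmod (?\<phi> y) \<le> (\<integral>x. 1 \<partial>PF)"
      by (intro norm_integral_le K.PP.integrable_const_bound[of _ 1])
        (use stat_meas[of y] in auto)
    then have "cmod (?\<phi> y) \<le> 1" by simp
    moreover have "cmod ?e \<le> 1" by (simp del: of_real_exp)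
    ultimately have "cmod (?\<phi> y - ?e) \<le> 1 + 1" by (intro order_trans[OF norm_triangle_ineq4] add_mono)
    then show ?thesis using True B0 by simp
  qed
  have bad_prob: "(\<Sum>y\<in>labellings. measure S (label_event y) * of_bool (y \<in> bad)) \<le> real (card L) * exp (- (real n * \<rho>\<^sup>2 / 2))"
  proof -
    have bs: "bad \<subseteq> labellings" by (auto simp: bad_def)
    have C: "small k \<rho> \<in> sets S" for k
    proof -
      have "(\<lambda>\<omega>. real (class_size n (label_vec \<omega>) k)) \<in> borel_measurable S"
        by (rule measurable_by_labels) simp
      then show ?thesis by measurable
    qed
    have "(\<Sum>y\<in>labellings. measure S (label_event y) * of_bool (y \<in> bad)) = (\<Sum>y\<in>bad. measure S (label_event y))"
      using bs by (intro sum.mono_neutral_cong_right) auto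
    also have "\<dots> = measure S (\<Union>y\<in>bad. label_event y)"
      by (rule sum_prob_label_event[OF bs])
    also have "\<dots> \<le> measure S (\<Union>k\<in>L. small k \<rho>)"
      using C L_fin by (intro S.finite_measure_mono sets.finite_UN) (auto simp: bad_def label_event_def)
    also have "\<dots> \<le> (\<Sum>k\<in>L. measure S (small k \<rho>))"
      using C L_fin by (intro S.finite_measure_subadditive_finite) auto
    also have "\<dots> \<le> (\<Sum>k\<in>L. exp (- (real n * \<rho>\<^sup>2 / 2)))"
      by (intro sum_mono small_class_prob \<rho>)
    finally show ?thesis by simp
  qed
  have "(\<integral>\<omega>. iexp (t * stat (label_vec \<omega>) (sample_vec \<omega>)) \<partial>S) = (\<Sum>y\<in>labellings. measure S (label_event y) *\<^sub>R ?\<phi> y)"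
    by (rule integral_by_labels[of "\<lambda>y x. iexp (t * stat y x)"]) (use stat_meas in auto)
  moreover have "?e = (\<Sum>y\<in>labellings. measure S (label_event y) *\<^sub>R ?e)"
    unfolding scaleR_sum_left[symmetric] total_prob_label_event by simp
  ultimately have eq: "(\<integral>\<omega>. iexp (t * stat (label_vec \<omega>) (sample_vec \<omega>)) \<partial>S) - ?e = (\<Sum>y\<in>labellings. measure S (label_event y) *\<^sub>R (?\<phi> y - ?e))"
    by (simp only: scaleR_diff_right sum_subtractf)
  have "cmod (\<Sum>y\<in>labellings. measure S (label_event y) *\<^sub>R (?\<phi> y - ?e)) \<le> (\<Sum>y\<in>labellings. measure S (label_event y) * (?B + 2 * of_bool (y \<in> bad)))"
  proof (rule sum_norm_le)
    fix y assume y: "y \<in> labellings"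
    show "norm (measure S (label_event y) *\<^sub>R (?\<phi> y - ?e)) \<le> measure S (label_event y) * (?B + 2 * of_bool (y \<in> bad))"
      unfolding norm_scaleR abs_of_nonneg[OF measure_nonneg] by (rule mult_left_mono[OF bound[OF y] measure_nonneg])
  qed
  also have "\<dots> = (\<Sum>y\<in>labellings. measure S (label_event y)) * ?B + 2 * (\<Sum>y\<in>labellings. measure S (label_event y) * of_bool (y \<in> bad))"
  proof -
    have "(\<Sum>y\<in>labellings. f y * (r + 2 * i y)) = (\<Sum>y\<in>labellings. f y) * r + 2 * (\<Sum>y\<in>labellings. f y * i y)"
      for f i :: "(nat \<Rightarrow> 'l) \<Rightarrow> real" and r
    proof -
      have "f y * (r + 2 * i y) = f y * r + 2 * (f y * i y)" for y by (simp add: algebra_simps)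
      then show ?thesis by (simp only: sum.distrib sum_distrib_right sum_distrib_left)
    qed
    then show ?thesis .
  qed
  also have "\<dots> \<le> 1 * ?B + 2 * (real (card L) * exp (- (real n * \<rho>\<^sup>2 / 2)))"
    unfolding total_prob_label_event by (rule add_mono[OF order_refl mult_left_mono[OF bad_prob]]) simp
  finally show ?thesis unfolding eq by (simp only: mult_1_left)
qed

end

section \<open>Asymptotic normality\<close>

theorem theorem2p2:
  fixes M :: "nat \<Rightarrow> 'a measure"
    and X :: "nat \<Rightarrow> 'a \<Rightarrow> nat \<Rightarrow> real"
    and Y :: "nat \<Rightarrow> 'a \<Rightarrow> 'l"
    and L :: "'l set"
    and pr :: "'l \<Rightarrow> real"
    and n p :: "nat \<Rightarrow> nat"
    and S :: "nat \<Rightarrow> 'b measure"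
    and Xs :: "nat \<Rightarrow> nat \<Rightarrow> 'b \<Rightarrow> nat \<Rightarrow> real"
    and Ys :: "nat \<Rightarrow> nat \<Rightarrow> 'b \<Rightarrow> 'l"
    and C :: "nat \<Rightarrow> 'c measure"
    and Z :: "nat \<Rightarrow> nat \<Rightarrow> 'c \<Rightarrow> nat \<Rightarrow> real"
  assumes L_fin: "finite L" and L_card: "card L \<ge> 2"
    and prob: "\<And>m. prob_space (M m)"
    and X_rv: "\<And>m. X m \<in> measurable (M m) (euclid (p m))"
    and Y_rv: "\<And>m. Y m \<in> measurable (M m) (count_space L)"
    and Y_law: "\<And>m k. k \<in> L \<Longrightarrow> measure (M m) {\<omega> \<in> space (M m). Y m \<omega> = k} = pr k"
    and pr_pos: "\<And>k. k \<in> L \<Longrightarrow> pr k > 0"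
    and sample: "\<And>m. iid_from (S m) {..<n m} (\<lambda>i \<omega>. (Xs m i \<omega>, Ys m i \<omega>))
          (euclid (p m) \<Otimes>\<^sub>M count_space L)
          (distr (M m) (euclid (p m) \<Otimes>\<^sub>M count_space L) (\<lambda>\<omega>. (X m \<omega>, Y m \<omega>)))"
    and copies: "\<And>m. iid_from (C m) {1..4} (Z m)
          (euclid (p m)) (distr (M m) (euclid (p m)) (X m))"
    and indep: "\<And>m. indep_rv (M m) (euclid (p m)) (X m) (count_space L) (Y m)"
    and n_lim: "filterlim n at_top sequentially"
    and p_lim: "filterlim p at_top sequentially"
    and min_lim: "\<And>c :: nat. (\<lambda>m. measure (S m) {\<omega> \<in> space (S m).
          c \<le> Min ((\<lambda>k. class_size (n m) (\<lambda>i. Ys m i \<omega>) k) ` L)}) \<longlonglongrightarrow> 1"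
    and cond1: "\<And>m. integrable (M m) (\<lambda>\<omega>. enorm (p m) (X m \<omega>) ^ 4)"
    and nondeg: "\<And>m. (\<integral>\<omega>. (dcd (C m) (p m) (Z m 1) (Z m 2) \<omega>)\<^sup>2 \<partial>C m) > 0"
    and cond2: "(\<lambda>m. (\<integral>\<omega>. dcd (C m) (p m) (Z m 1) (Z m 2) \<omega> ^ 4 \<partial>C m)
          / (real (n m) * (\<integral>\<omega>. (dcd (C m) (p m) (Z m 1) (Z m 2) \<omega>)\<^sup>2 \<partial>C m)\<^sup>2)) \<longlonglongrightarrow> 0"
    and cond3: "(\<lambda>m. (\<integral>\<omega>. dcd (C m) (p m) (Z m 1) (Z m 3) \<omega> * dcd (C m) (p m) (Z m 2) (Z m 3) \<omega>
                         * dcd (C m) (p m) (Z m 1) (Z m 4) \<omega> * dcd (C m) (p m) (Z m 2) (Z m 4) \<omega> \<partial>C m)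
          / (\<integral>\<omega>. (dcd (C m) (p m) (Z m 1) (Z m 2) \<omega>)\<^sup>2 \<partial>C m)\<^sup>2) \<longlonglongrightarrow> 0"
  shows "weak_conv_m
    (\<lambda>m. distr (S m) borel (\<lambda>\<omega>.
        gCov (p m) (n m) L (\<lambda>i. Xs m i \<omega>) (\<lambda>i. Ys m i \<omega>)
        / sqrt (sigma0_sq (p m) (n m) L (\<lambda>i. Xs m i \<omega>) (\<lambda>i. Ys m i \<omega>))))
    std_normal_distribution"
proof (rule levy_continuity)
  let ?F = "\<lambda>m. distr (M m) (euclid (p m)) (X m)"
  let ?stat = "\<lambda>m \<omega>. gCov (p m) (n m) L (\<lambda>i. Xs m i \<omega>) (\<lambda>i. Ys m i \<omega>)
      / sqrt (sigma0_sq (p m) (n m) L (\<lambda>i. Xs m i \<omega>) (\<lambda>i. Ys m i \<omega>))"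
  have S_prob: "prob_space (S m)" for m using sample[of m] by (simp add: iid_from_def)
  have law: "euclid_law (?F m) (p m)" for m
  proof -
    interpret Mm: prob_space "M m" by (rule prob)
    interpret Fm: prob_space "?F m" by (rule Mm.prob_space_distr[OF X_rv])
    show ?thesis
      by unfold_locales (simp_all add: integrable_distr_eq[OF X_rv] cond1)
  qed
  have lsample: "labelled_sample (?F m) (p m) L pr (n m) (S m) (Xs m) (Ys m)" if n0: "n m > 0" for m
  proof (intro labelled_sample.intro law labelled_sample_axioms.intro L_fin L_card n0 S_prob)
    interpret Mm: prob_space "M m" by (rule prob)
    interpret Sm: prob_space "S m" by (rule S_prob)
    let ?E = "euclid (p m) \<Otimes>\<^sub>M count_space L"
    show ind: "Sm.indep_vars (\<lambda>_. ?E) (\<lambda>i \<omega>. (Xs m i \<omega>, Ys m i \<omega>)) {..<n m}"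
      using sample[of m] by (simp add: iid_from_def)
    fix i B k assume i: "i < n m" and B: "B \<in> sets (euclid (p m))" and k: "k \<in> L"
    have Zm: "(\<lambda>\<omega>. (Xs m i \<omega>, Ys m i \<omega>)) \<in> measurable (S m) ?E"
      using ind i by (auto simp: Sm.indep_vars_def)
    have XY: "(\<lambda>\<omega>. (X m \<omega>, Y m \<omega>)) \<in> measurable (M m) ?E"
      by (intro measurable_Pair X_rv Y_rv)
    have Bk: "B \<times> {k} \<in> sets ?E" using B k by (intro pair_measureI) auto
    have "{\<omega> \<in> space (S m). Xs m i \<omega> \<in> B \<and> Ys m i \<omega> = k} = (\<lambda>\<omega>. (Xs m i \<omega>, Ys m i \<omega>)) -` (B \<times> {k}) \<inter> space (S m)"
      by auto
    then have "measure (S m) {\<omega> \<in> space (S m). Xs m i \<omega> \<in> B \<and> Ys m i \<omega> = k}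
        = measure (distr (S m) ?E (\<lambda>\<omega>. (Xs m i \<omega>, Ys m i \<omega>))) (B \<times> {k})"
      by (simp add: measure_distr[OF Zm Bk])
    also have "distr (S m) ?E (\<lambda>\<omega>. (Xs m i \<omega>, Ys m i \<omega>)) = distr (M m) ?E (\<lambda>\<omega>. (X m \<omega>, Y m \<omega>))"
      using sample[of m] i by (simp add: iid_from_def)
    also have "measure \<dots> (B \<times> {k}) = measure (M m) ((X m -` B \<inter> space (M m)) \<inter> (Y m -` {k} \<inter> space (M m)))"
      unfolding measure_distr[OF XY Bk] by (rule arg_cong[where f = "measure (M m)"]) auto
    also have "\<dots> = measure (M m) (X m -` B \<inter> space (M m)) * measure (M m) (Y m -` {k} \<inter> space (M m))"
    proof (rule Mm.indep_setD)
      show "Mm.indep_set {X m -` A \<inter> space (M m) | A. A \<in> sets (euclid (p m))}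
          {Y m -` B \<inter> space (M m) | B. B \<in> sets (count_space L)}"
        using indep[of m] by (simp add: indep_rv_def)
    qed (use B k in auto)
    also have "measure (M m) (X m -` B \<inter> space (M m)) = measure (?F m) B"
      by (rule measure_distr[OF X_rv B, symmetric])
    also have "Y m -` {k} \<inter> space (M m) = {\<omega> \<in> space (M m). Y m \<omega> = k}" by auto
    also have "measure (M m) {\<omega> \<in> space (M m). Y m \<omega> = k} = pr k" by (rule Y_law[OF k])
    finally show "measure (S m) {\<omega> \<in> space (S m). Xs m i \<omega> \<in> B \<and> Ys m i \<omega> = k} = measure (?F m) B * pr k" .
  qed
  have stat_meas: "?stat m \<in> borel_measurable (S m)" for m
  proof (cases "n m > 0")
    case True
    interpret A: labelled_sample "?F m" "p m" L pr "n m" "S m" "Xs m" "Ys m" by (rule lsample[OF True])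
    show ?thesis using A.measurable_by_labels[of A.stat, OF A.stat_meas] by (simp add: A.stat_restrict)
  next
    case False
    then show ?thesis by (simp add: gCov_def ustat_def sigma0_sq_def Vn2_def phat_def)
  qed
  show "real_distribution (distr (S m) borel (?stat m))" for m
    by (rule prob_space.real_distribution_distr[OF S_prob stat_meas])
  show "real_distribution std_normal_distribution" by (rule real_dist_normal_dist)
  fix t :: real
  define m2 where "m2 m = (\<integral>\<omega>. (dcd (C m) (p m) (Z m 1) (Z m 2) \<omega>)\<^sup>2 \<partial>C m)" for m
  define r where "r m = (\<integral>\<omega>. dcd (C m) (p m) (Z m 1) (Z m 2) \<omega> ^ 4 \<partial>C m) / (real (n m) * (m2 m)\<^sup>2)" for m
  define s where "s m = (\<integral>\<omega>. dcd (C m) (p m) (Z m 1) (Z m 3) \<omega> * dcd (C m) (p m) (Z m 2) (Z m 3) \<omega>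
      * dcd (C m) (p m) (Z m 1) (Z m 4) \<omega> * dcd (C m) (p m) (Z m 2) (Z m 4) \<omega> \<partial>C m) / (m2 m)\<^sup>2" for m
  have r0: "r \<longlonglongrightarrow> 0" using cond2 by (simp add: r_def[abs_def] m2_def)
  have s0: "s \<longlonglongrightarrow> 0" using cond3 by (simp add: s_def[abs_def] m2_def)
  have n_real: "filterlim (\<lambda>m. real (n m)) at_top sequentially"
    by (rule filterlim_compose[OF filterlim_real_sequentially n_lim])
  define \<rho> where "\<rho> = Min (pr ` L)"
  have L_ne: "L \<noteq> {}" using L_card by auto
  have \<rho>: "\<rho> > 0" "\<And>k. k \<in> L \<Longrightarrow> \<rho> \<le> pr k"
    unfolding \<rho>_def using L_fin L_ne pr_pos by (auto simp: Min_gr_iff)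
  \<comment> \<open>The tolerances are free here; they are chosen after \<open>e\<close> below.\<close>
  have bound: "cmod (char (distr (S m) borel (?stat m)) t - of_real (exp (- (t\<^sup>2 / 2))))
      \<le> \<epsilon> * (t\<^sup>2 + \<bar>t\<bar> ^ 3) + (\<bar>t\<bar> * \<delta> + 4 * \<eta> / \<delta>)
        + 2 * (real (card L) * exp (- (real (n m) * \<rho>\<^sup>2 / 2)))"
    if "n m \<ge> 4" "real (n m) * \<rho> / 2 \<ge> 2" "\<epsilon> > 0" "\<eta> > 0" "\<delta> > 0" "\<delta> \<le> 1 / 2"
      "(8 / \<rho>) ^ 4 * (16 * r m + \<bar>s m\<bar>) \<le> \<epsilon>\<^sup>2" "64 * r m \<le> \<eta>\<^sup>2" "40 / real (n m) \<le> \<eta>" for m \<epsilon> \<eta> \<delta>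
  proof -
    have n0: "n m > 0" using that(1) by simp
    interpret A: labelled_sample "?F m" "p m" L pr "n m" "S m" "Xs m" "Ys m" by (rule lsample[OF n0])
    note mom = A.copies_moments[OF copies[of m]]
    have m2: "A.m2 = m2 m" unfolding m2_def by (rule mom(1)[symmetric])
    have r: "A.m4 / (real (n m) * A.m2\<^sup>2) = r m" unfolding r_def m2 mom(2) ..
    have s: "\<bar>A.cyc\<bar> / A.m2\<^sup>2 = \<bar>s m\<bar>" unfolding s_def m2 mom(3) by (simp add: abs_divide)
    have "A.m2 > 0" unfolding m2 m2_def by (rule nondeg)
    from A.stat_char_bound[OF this that(1) \<rho>(1) that(2) \<rho>(2) that(3-6), unfolded r s, OF _ that(7-9), of t]
    show ?thesis
      unfolding char_def using integral_distr[OF stat_meas[of m], of "\<lambda>x. iexp (t * x)"]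
      by (simp add: A.stat_restrict)
  qed
  have "(\<lambda>m. char (distr (S m) borel (?stat m)) t) \<longlonglongrightarrow> of_real (exp (- (t\<^sup>2 / 2)))"
  proof (rule tendstoI)
    fix e :: real assume e: "e > 0"
    \<comment> \<open>The three error terms of the bound are made at most a quarter of \<open>e\<close> each.\<close>
    define \<delta> where "\<delta> = min (1 / 2) (e / (4 * (\<bar>t\<bar> + 1)))"
    define \<eta> where "\<eta> = \<delta> * e / 16"
    define \<epsilon> where "\<epsilon> = e / (4 * (t\<^sup>2 + \<bar>t\<bar> ^ 3 + 1))"
    have t0: "0 \<le> t\<^sup>2 + \<bar>t\<bar> ^ 3" by simp
    have "\<delta> > 0" using e by (auto simp: \<delta>_def intro!: divide_pos_pos)
    moreover have "\<delta> \<le> 1 / 2" unfolding \<delta>_def by (rule min.cobounded1)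
    ultimately have \<delta>: "\<delta> > 0" "\<delta> \<le> 1 / 2" by blast+
    have \<delta>t: "\<bar>t\<bar> * \<delta> \<le> e / 4"
    proof -
      have "\<bar>t\<bar> * \<delta> \<le> (\<bar>t\<bar> + 1) * (e / (4 * (\<bar>t\<bar> + 1)))"
        using \<delta> by (intro mult_mono) (auto simp: \<delta>_def)
      also have "\<dots> = e / 4"
      proof -
        have "u * (e / (4 * u)) = e / 4" if "u \<noteq> 0" for u :: real using that by simp
        from this[of "\<bar>t\<bar> + 1"] show ?thesis by linarith
      qed
      finally show ?thesis .
    qed
    have \<eta>: "\<eta> > 0" "4 * \<eta> / \<delta> = e / 4" using \<delta> e by (simp_all add: \<eta>_def)
    have \<epsilon>: "\<epsilon> > 0" using e t0 by (auto simp: \<epsilon>_def intro!: divide_pos_pos add_nonneg_pos)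
    have \<epsilon>t: "\<epsilon> * (t\<^sup>2 + \<bar>t\<bar> ^ 3) \<le> e / 4"
    proof -
      have "\<epsilon> * (t\<^sup>2 + \<bar>t\<bar> ^ 3) \<le> \<epsilon> * (t\<^sup>2 + \<bar>t\<bar> ^ 3 + 1)"
        using \<epsilon> by (intro mult_left_mono) auto
      also have "\<dots> = e / 4"
      proof -
        have "e / (4 * u) * u = e / 4" if "u \<noteq> 0" for u :: real using that by simp
        then show ?thesis unfolding \<epsilon>_def using t0 by (metis add_nonneg_eq_0_iff zero_le_one zero_neq_one)
      qed
      finally show ?thesis .
    qed
    have "(\<lambda>m. (8 / \<rho>) ^ 4 * (16 * r m + \<bar>s m\<bar>)) \<longlonglongrightarrow> (8 / \<rho>) ^ 4 * (16 * 0 + \<bar>0\<bar>)"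
      by (intro tendsto_intros r0 s0)
    from order_tendstoD(2)[OF this, of "\<epsilon>\<^sup>2"]
    have 1: "\<forall>\<^sub>F m in sequentially. (8 / \<rho>) ^ 4 * (16 * r m + \<bar>s m\<bar>) < \<epsilon>\<^sup>2"
      using \<epsilon> by simp
    have "(\<lambda>m. 64 * r m) \<longlonglongrightarrow> 64 * 0" by (intro tendsto_intros r0)
    from order_tendstoD(2)[OF this, of "\<eta>\<^sup>2"]
    have 2: "\<forall>\<^sub>F m in sequentially. 64 * r m < \<eta>\<^sup>2"
      using \<eta>(1) by simp
    have 3: "\<forall>\<^sub>F m in sequentially. real (n m) \<ge> c" for c
      using n_real by (simp add: filterlim_at_top)
    have "(\<lambda>m. 2 * (real (card L) * exp (- (real (n m) * \<rho>\<^sup>2 / 2)))) \<longlonglongrightarrow> 2 * (real (card L) * 0)"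
    proof (intro tendsto_intros)
      have "filterlim (\<lambda>m. real (n m) * (\<rho>\<^sup>2 / 2)) at_top sequentially"
        using \<rho> by (intro filterlim_at_top_mult_tendsto_pos[OF tendsto_const _ n_real]) auto
      then have "filterlim (\<lambda>m. - (real (n m) * \<rho>\<^sup>2 / 2)) at_bot sequentially"
        by (simp add: filterlim_uminus_at_bot)
      then show "(\<lambda>m. exp (- (real (n m) * \<rho>\<^sup>2 / 2))) \<longlonglongrightarrow> 0"
        by (rule filterlim_compose[OF exp_at_bot])
    qed
    from order_tendstoD(2)[OF this, of "e / 8"]
    have 4: "\<forall>\<^sub>F m in sequentially. 2 * (real (card L) * exp (- (real (n m) * \<rho>\<^sup>2 / 2))) < e / 8"
      using e by simp
    show "\<forall>\<^sub>F m in sequentially. dist (char (distr (S m) borel (?stat m)) t) (of_real (exp (- (t\<^sup>2 / 2)))) < e"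
      using 1 2 4 3[of 4] 3[of "4 / \<rho>"] 3[of "40 / \<eta>"]
    proof eventually_elim
      case (elim m)
      have "real (n m) * \<rho> / 2 \<ge> 2" using elim(5) \<rho>(1) by (simp add: field_simps)
      moreover have "40 / real (n m) \<le> \<eta>" using elim(4,6) \<eta>(1) by (simp add: field_simps)
      ultimately have "cmod (char (distr (S m) borel (?stat m)) t - of_real (exp (- (t\<^sup>2 / 2))))
          \<le> \<epsilon> * (t\<^sup>2 + \<bar>t\<bar> ^ 3) + (\<bar>t\<bar> * \<delta> + 4 * \<eta> / \<delta>)
            + 2 * (real (card L) * exp (- (real (n m) * \<rho>\<^sup>2 / 2)))"
        using elim \<epsilon> \<eta> \<delta> by (intro bound) auto
      also have "\<dots> < e" using \<epsilon>t \<delta>t \<eta>(2) elim(3) e by linarith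
      finally show ?case by (simp add: dist_norm)
    qed
  qed
  then show "(\<lambda>m. char (distr (S m) borel (?stat m)) t) \<longlonglongrightarrow> char std_normal_distribution t"
    by (simp add: char_std_normal_distribution)
qed

end
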